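(* Let $k\geq 2$ and $s\geq 2$ be integers and let $n\geq 36288\left(\lfloor\frac{s+1}{2}\rfloor\right)^8$. Then the following hold, where each equality means that the given graph is, up to isomorphism, the unique graph in $\mathrm{Ex}_{sp}(n,\{K_{k+1}\}\cup\mathcal{L}_s)$. \begin{enumerate} \item If $s$ is odd and $s\leq 2k-1$, then $\mathrm{Ex}_{sp}(n,\{K_{k+1}\}\cup\mathcal{L}_{s})=K_{\frac{s-1}{2}}\vee \overline{K}_{n-\frac{s-1}{2}}$. \item If $s$ is odd and $s\geq 2k+1$, then $\mathrm{Ex}_{sp}(n,\{K_{k+1}\}\cup\mathcal{L}_{s})=T_{\frac{s-1}{2},\,k-1}\vee \overline{K}_{n-\frac{s-1}{2}}$. \item If $s$ is even and $s\leq 2k-2$, then $\mathrm{Ex}_{sp}(n,\{K_{k+1}\}\cup\mathcal{L}_{s})=K_{\frac{s}{2}-1}\vee \left(P_2\cup \overline{K}_{n-\frac{s}{2}-1}\right)$. \item If $s$ is even and $s\geq 2k$, then $\mathrm{Ex}_{sp}(n,\{K_{k+1}\}\cup\mathcal{L}_{s})=T_{\frac{s}{2}-1,\,k-1}\vee \overline{K}_{n-\frac{s}{2}+1}$. \end{enumerate}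
   Context: All graphs are finite, simple and undirected. For a family of graphs $\mathcal{F}$, a graph is $\mathcal{F}$-free if it contains no member of $\mathcal{F}$ as a (not necessarily induced) subgraph. The spectral radius $\rho(G)$ is the largest eigenvalue of the adjacency matrix $A(G)$. $\mathrm{Ex}_{sp}(n,\mathcal{F})$ denotes the set of $\mathcal{F}$-free graphs on $n$ vertices with maximum spectral radius. A linear forest is a graph each of whose connected components is a path; $\mathcal{L}_s$ denotes the family of all linear forests with exactly $s$ edges. $K_m$ is the complete graph, $\overline{K}_m$ the edgeless graph on $m$ vertices, $P_2$ the path with 2 vertices (one edge); $K_0$ is the empty graph. $G\cup H$ is the vertex-disjoint union, and $G\vee H$ (join) is obtained from $G\cup H$ by adding all edges between $V(G)$ and $V(H)$. $T_{m,r}$ is the $r$-partite Turán graph: the complete $r$-partite graph on $m$ vertices whose part sizes differ pairwise by at most one. *)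

theory Defs
  imports "Jordan_Normal_Form.Spectral_Radius"
begin

datatype 'a graph = Graph (verts: "'a set") (edges: "'a set set")

definition simple_graph :: "'a graph \<Rightarrow> bool" where
  "simple_graph G \<longleftrightarrow>
     finite (verts G) \<and> (\<forall>e\<in>edges G. e \<subseteq> verts G \<and> card e = 2)"

text \<open>Isomorphism relates graphs over possibly different vertex types and is meant
  for simple graphs: edges outside the vertex set are ignored.\<close>

definition isomorphic :: "'a graph \<Rightarrow> 'b graph \<Rightarrow> bool" where
  "isomorphic G H \<longleftrightarrow>
     (\<exists>f. bij_betw f (verts G) (verts H) \<and>
          (\<forall>u\<in>verts G. \<forall>v\<in>verts G. {u, v} \<in> edges G \<longleftrightarrow> {f u, f v} \<in> edges H))"

definition iso_class :: "'b graph \<Rightarrow> 'a graph set" where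
  "iso_class H = {G. simple_graph G \<and> isomorphic G H}"

definition subgraph :: "'a graph \<Rightarrow> 'a graph \<Rightarrow> bool" where
  "subgraph H G \<longleftrightarrow>
     simple_graph H \<and> verts H \<subseteq> verts G \<and> edges H \<subseteq> edges G"

definition free_of :: "'b graph set \<Rightarrow> 'a graph \<Rightarrow> bool" where
  "free_of \<F> G \<longleftrightarrow> (\<forall>F\<in>\<F>. \<not> (\<exists>H. subgraph H G \<and> isomorphic F H))"

definition induced_subgraph :: "'a graph \<Rightarrow> 'a set \<Rightarrow> 'a graph" where
  "induced_subgraph G S = Graph S {e \<in> edges G. e \<subseteq> S}"

definition reachable :: "'a graph \<Rightarrow> 'a \<Rightarrow> 'a \<Rightarrow> bool" where
  "reachable G u v \<longleftrightarrow> (u, v) \<in> {(x, y). {x, y} \<in> edges G}\<^sup>*"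

definition components :: "'a graph \<Rightarrow> 'a graph set" where
  "components G =
     (\<lambda>u. induced_subgraph G {v \<in> verts G. reachable G u v}) ` verts G"

definition complete_graph :: "nat \<Rightarrow> nat graph" where
  "complete_graph m = Graph {..<m} {{i, j} |i j. i < m \<and> j < m \<and> i \<noteq> j}"

definition edgeless_graph :: "nat \<Rightarrow> nat graph" where
  "edgeless_graph m = Graph {..<m} {}"

text \<open>\<open>path_graph m\<close> is the path with \<open>m\<close> vertices, hence \<open>m - 1\<close> edges.\<close>

definition path_graph :: "nat \<Rightarrow> nat graph" where
  "path_graph m = Graph {..<m} {{i, Suc i} |i. Suc i < m}"

definition linear_forest :: "'a graph \<Rightarrow> bool" where
  "linear_forest G \<longleftrightarrow>
     simple_graph G \<and> (\<forall>C\<in>components G. \<exists>m\<ge>1. isomorphic C (path_graph m))"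

text \<open>Every finite graph has an isomorphic copy with vertices in \<^typ>\<open>nat\<close>, so this
  contains all linear forests with \<open>s\<close> edges up to isomorphism. Components may be
  single vertices, which are paths with one vertex.\<close>

definition linear_forests :: "nat \<Rightarrow> nat graph set" where
  "linear_forests s = {F. linear_forest F \<and> card (edges F) = s}"

text \<open>The parts are the residue classes modulo \<open>r\<close> in \<open>{..<m}\<close>; their sizes
  are \<open>m div r\<close> or \<open>m div r + 1\<close>.\<close>

definition turan_graph :: "nat \<Rightarrow> nat \<Rightarrow> nat graph" where
  "turan_graph m r = Graph {..<m} {{i, j} |i j. i < m \<and> j < m \<and> i mod r \<noteq> j mod r}"

definition disjoint_union :: "'a graph \<Rightarrow> 'b graph \<Rightarrow> ('a + 'b) graph" where
  "disjoint_union G H =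
     Graph (verts G <+> verts H) ((`) Inl ` edges G \<union> (`) Inr ` edges H)"

definition graph_join :: "'a graph \<Rightarrow> 'b graph \<Rightarrow> ('a + 'b) graph" where
  "graph_join G H =
     Graph (verts (disjoint_union G H))
       (edges (disjoint_union G H) \<union> {{Inl u, Inr v} |u v. u \<in> verts G \<and> v \<in> verts H})"

text \<open>Rows and columns are indexed by the vertices in increasing order.\<close>

definition adjacency_matrix :: "'a::linorder graph \<Rightarrow> real mat" where
  "adjacency_matrix G =
     (let vs = sorted_list_of_set (verts G); n = card (verts G)
      in mat n n (\<lambda>(i, j). if {vs ! i, vs ! j} \<in> edges G then 1 else 0))"

text \<open>The largest eigenvalue over the reals; not to be confused with
  \<^const>\<open>spectral_radius\<close>, the largest modulus of a complex eigenvalue.\<close>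

definition graph_spectral_radius :: "'a::linorder graph \<Rightarrow> real" where
  "graph_spectral_radius G = Max (spectrum (adjacency_matrix G))"

definition Ex_sp :: "nat \<Rightarrow> 'b graph set \<Rightarrow> 'a::linorder graph set" where
  "Ex_sp n \<F> =
     {G. simple_graph G \<and> card (verts G) = n \<and> free_of \<F> G \<and>
         (\<forall>H::'a graph. simple_graph H \<and> card (verts H) = n \<and> free_of \<F> H \<longrightarrow>
            graph_spectral_radius H \<le> graph_spectral_radius G)}"

end

theory Submission
  imports Defs "HOL-Analysis.Function_Topology"
begin

text \<open>
  Put \<open>h = (s - 1) div 2\<close>. In a graph without linear forests of \<open>s\<close> edges, at most \<open>h\<close> vertices have
  degree at least \<open>4 * h + 4\<close>, and the graph induced on the others has bounded degree and a bounded
  vertex cover, hence only \<open>O(h\<^sup>2)\<close> edges. If moreover \<open>\<rho>\<^sup>2 \<ge> h * (n - h)\<close>, as for the claimed extremal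
  graph, the Perron vector, scaled to maximum \<open>1\<close>, forces exactly \<open>h\<close> such vertices, with entries close
  to \<open>1\<close>, and a vertex adjacent to all of them; so the graph \<open>Q\<close> induced on this core \<open>L\<close> has no
  \<open>K\<^sub>k\<close>. Let \<open>S\<close> be the sum of the Perron entries over \<open>L\<close>, and replace the entries outside \<open>L\<close> by
  \<open>S / \<rho>\<close>. The Rayleigh quotient of this vector in the candidate graph with core \<open>L\<close> exceeds \<open>\<rho>\<close> if
  \<open>Q\<close> has fewer edges than the Turan graph, or if an edge between \<open>L\<close> and its complement is missing.
  What remains is a join of a Turan graph with a graph with at most one edge.
\<close>

text \<open>With \<open>r = k - 1\<close> the four cases become one: the forbidden clique has
  \<open>r + 2\<close> vertices, and a complete graph on \<open>h\<close> \<le> \<open>r\<close>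
  vertices is the Turan graph with \<open>r\<close> parts. Only \<open>b\<close>, the number of
  edges outside the core, varies. A linear forest has at most \<open>2 * h\<close> edges meeting the
  core, so \<open>s = 2 * h + 1\<close> leaves no room for an outside edge and
  \<open>s = 2 * h + 2\<close> leaves room for one; that edge completes a forbidden clique exactly
  when all \<open>r\<close> parts are nonempty, that is, when \<open>h\<close> \<ge>
  \<open>r\<close>.

  \<open>G\<close> may be disconnected, so Perron entries may vanish; no eigenvector of the
  candidate is computed, only Rayleigh quotients are compared. The errors must stay below the gain
  of one adjacency. With \<open>m = h + 1\<close> the bound on \<open>n\<close> gives \<rho> \<ge>
  \<open>190 * m ^ 4\<close> (\<open>190 ^ 2 = 36100\<close> is just below 36288), hence entries at
  most \<open>1 / (95 * m ^ 3)\<close> off the core and at least 1 - \<delta> on it, where \<delta>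
  is \<open>1 / (47 * m ^ 2)\<close>. Replacing a deficient core then gains at least 1/2, while the
  edges outside it are worth less than 1/4.\<close>

definition adj :: "'a graph \<Rightarrow> 'a \<Rightarrow> 'a \<Rightarrow> real" where
  "adj G u v = (if {u, v} \<in> edges G then 1 else 0)"

lemma adj_sym: "adj G u v = adj G v u"
  by (simp add: adj_def insert_commute)

lemma adj_nonneg: "0 \<le> adj G u v"
  by (simp add: adj_def)

lemma simple_graph_no_loop: "simple_graph G \<Longrightarrow> {u} \<notin> edges G"
  by (auto simp: simple_graph_def)

lemma simple_graph_edge_verts: "simple_graph G \<Longrightarrow> {u, v} \<in> edges G \<Longrightarrow> u \<in> verts G \<and> v \<in> verts G"
  by (auto simp: simple_graph_def)

subsection \<open>The spectral radius as a Rayleigh quotient\<close>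

text \<open>Compactness of the unit sphere is taken from Tychonoff's theorem on the full function
  space. The form reads only coordinates in \<open>V\<close>, so a competitor may be replaced by its
  restriction \<open>g\<close>, which vanishes elsewhere.\<close>

lemma quadratic_form_attains_max:
  fixes a :: "'a \<Rightarrow> 'a \<Rightarrow> real"
  assumes "finite V" "V \<noteq> {}"
  obtains x where "(\<Sum>u\<in>V. (x u)\<^sup>2) = 1"
    "\<And>f. (\<Sum>u\<in>V. (f u)\<^sup>2) = 1 \<Longrightarrow>
       (\<Sum>u\<in>V. \<Sum>v\<in>V. a u v * f u * f v) \<le> (\<Sum>u\<in>V. \<Sum>v\<in>V. a u v * x u * x v)"
proof -
  \<comment> \<open>Freezing the coordinates outside \<open>V\<close> at 0 makes every factor
    compact; on \<open>V\<close> the unit sphere lies in [-1, 1] anyway.\<close>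
  define K where "K = PiE UNIV (\<lambda>u. if u \<in> V then {-1..1::real} else {0})"
  define S where "S = {f::'a \<Rightarrow> real. (\<Sum>u\<in>V. (f u)\<^sup>2) = 1}"
  have contc: "continuous_on UNIV (\<lambda>f::'a \<Rightarrow> real. f u)" for u
    by (rule continuous_on_product_coordinates)
  have "compactin (product_topology (\<lambda>_. euclidean) UNIV) K"
    unfolding K_def by (subst compactin_PiE) auto
  then have K: "compact K" by (simp add: euclidean_product_topology)
  have "closed S" unfolding S_def
    by (intro closed_Collect_eq continuous_intros contc)
  with K have comp: "compact (K \<inter> S)" by blast
  obtain u0 where u0: "u0 \<in> V" using assms by blast
  have "(\<lambda>u. if u = u0 then 1 else 0) \<in> K \<inter> S"
    using u0 assms by (auto simp: K_def S_def PiE_iff if_distrib[of "\<lambda>z. z ^ 2"] cong: if_cong)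
  then have ne: "K \<inter> S \<noteq> {}" by blast
  have cont: "continuous_on (K \<inter> S) (\<lambda>f. \<Sum>u\<in>V. \<Sum>v\<in>V. a u v * f u * f v)"
    by (intro continuous_intros continuous_on_subset[OF contc]) auto
  obtain x where x: "x \<in> K \<inter> S"
    "\<forall>y\<in>K \<inter> S. (\<Sum>u\<in>V. \<Sum>v\<in>V. a u v * y u * y v) \<le> (\<Sum>u\<in>V. \<Sum>v\<in>V. a u v * x u * x v)"
    using continuous_attains_sup[OF comp ne cont] by blast
  show thesis
  proof (rule that)
    show "(\<Sum>u\<in>V. (x u)\<^sup>2) = 1" using x by (auto simp: S_def)
    fix f :: "'a \<Rightarrow> real" assume f: "(\<Sum>u\<in>V. (f u)\<^sup>2) = 1"
    define g where "g = (\<lambda>u. if u \<in> V then f u else 0)"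
    have "g \<in> S" using f by (simp add: S_def g_def)
    moreover have "g \<in> K" unfolding K_def
    proof (rule PiE_I)
      fix u
      have "(f u)\<^sup>2 \<le> 1" if "u \<in> V"
        using member_le_sum[OF that, of "\<lambda>u. (f u)\<^sup>2"] assms f by auto
      then have "u \<in> V \<Longrightarrow> \<bar>f u\<bar> \<le> 1" by (simp add: abs_square_le_1)
      then show "g u \<in> (if u \<in> V then {- 1..1} else {0})"
        by (auto simp: g_def)
    qed auto
    ultimately have "(\<Sum>u\<in>V. \<Sum>v\<in>V. a u v * g u * g v) \<le> (\<Sum>u\<in>V. \<Sum>v\<in>V. a u v * x u * x v)"
      using x by blast
    then show "(\<Sum>u\<in>V. \<Sum>v\<in>V. a u v * f u * f v) \<le> (\<Sum>u\<in>V. \<Sum>v\<in>V. a u v * x u * x v)"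
      by (simp add: g_def)
  qed
qed

lemma linear_coeff_zero_if_quadratic_nonneg:
  fixes b c :: real
  assumes "\<And>t. 0 \<le> t * b + t\<^sup>2 * c"
  shows "b = 0"
proof (rule ccontr)
  assume b: "b \<noteq> 0"
  \<comment> \<open>At t = -b/d the polynomial equals (b^2/d)(c/d - 1), negative as soon as c < d;
    adding 1 to the absolute value keeps d positive for every sign of c.\<close>
  define d where "d = \<bar>c\<bar> + 1"
  have d: "d > 0" "c < d" by (auto simp: d_def)
  have "0 \<le> (- b / d) * b + (- b / d)\<^sup>2 * c" by (rule assms)
  also have "\<dots> = (b\<^sup>2 / d) * (c / d - 1)"
    using d by (simp add: field_simps power2_eq_square)
  finally have "0 \<le> (b\<^sup>2 / d) * (c / d - 1)" .
  moreover have "b\<^sup>2 / d > 0" using b d by simp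
  ultimately have "0 \<le> c / d - 1" by (metis zero_le_mult_iff not_less)
  then show False using d by (simp add: field_simps)
qed

text \<open>First variation in the single coordinate \<open>w\<close>: moving \<open>x w\<close> by
  t leaves the slack in the Rayleigh inequality a nonnegative quadratic in t without constant term,
  so its linear coefficient, the defect in the eigenvalue equation at \<open>w\<close>, is
  zero.\<close>

lemma rayleigh_maximizer_eigenvector:
  fixes a :: "'a \<Rightarrow> 'a \<Rightarrow> real"
  assumes fin: "finite V" and sym: "\<And>u v. a u v = a v u"
    and max: "\<And>f. (\<Sum>u\<in>V. \<Sum>v\<in>V. a u v * f u * f v) \<le> \<mu> * (\<Sum>u\<in>V. (f u)\<^sup>2)"
    and att: "(\<Sum>u\<in>V. \<Sum>v\<in>V. a u v * x u * x v) = \<mu> * (\<Sum>u\<in>V. (x u)\<^sup>2)"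
    and w: "w \<in> V"
  shows "(\<Sum>v\<in>V. a w v * x v) = \<mu> * x w"
proof -
  let ?e = "\<lambda>u. if u = w then 1 else (0::real)"
  have "0 \<le> t * (2 * \<mu> * x w - 2 * (\<Sum>v\<in>V. a w v * x v)) + t\<^sup>2 * (\<mu> - a w w)" for t
  proof -
    let ?f = "\<lambda>u. x u + t * ?e u"
    have "(\<Sum>u\<in>V. (?f u)\<^sup>2) = (\<Sum>u\<in>V. (x u)\<^sup>2 + (2 * t * x u * ?e u + t\<^sup>2 * ?e u))"
      by (intro sum.cong) (auto simp: power2_eq_square algebra_simps)
    also have "\<dots> = (\<Sum>u\<in>V. (x u)\<^sup>2) + 2 * t * x w + t\<^sup>2"
      using w fin by (simp only: sum.distrib) (simp add: if_distrib cong: if_cong)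
    finally have n: "(\<Sum>u\<in>V. (?f u)\<^sup>2) = (\<Sum>u\<in>V. (x u)\<^sup>2) + 2 * t * x w + t\<^sup>2" .
    have "(\<Sum>u\<in>V. \<Sum>v\<in>V. a u v * ?f u * ?f v)
      = (\<Sum>u\<in>V. \<Sum>v\<in>V. a u v * x u * x v + t * (if v = w then a u v * x u else 0)
          + t * (if u = w then a u v * x v else 0) + t\<^sup>2 * (if u = w then if v = w then a u v else 0 else 0))"
      by (intro sum.cong refl) (auto simp: power2_eq_square algebra_simps)
    also have "\<dots> = (\<Sum>u\<in>V. \<Sum>v\<in>V. a u v * x u * x v) + t * (\<Sum>u\<in>V. a u w * x u)
         + t * (\<Sum>v\<in>V. a w v * x v) + t\<^sup>2 * a w w"
    proof -
      have "(\<Sum>u\<in>V. \<Sum>v\<in>V. if u = w then a u v * x v else 0) = (\<Sum>v\<in>V. a w v * x v)"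
        using w fin by (subst sum.swap) simp
      moreover have "(\<Sum>u\<in>V. \<Sum>v\<in>V. if u = w then if v = w then a u v else 0 else 0) = a w w"
        using w fin by (subst sum.swap) simp
      ultimately show ?thesis
        using w fin by (simp add: sum.distrib flip: sum_distrib_left)
    qed
    also have "(\<Sum>u\<in>V. a u w * x u) = (\<Sum>v\<in>V. a w v * x v)"
      by (intro sum.cong refl) (simp add: sym)
    finally show ?thesis
      using max[of ?f] unfolding n att distrib_left by (simp add: algebra_simps)
  qed
  from linear_coeff_zero_if_quadratic_nonneg[OF this] show ?thesis by simp
qed

text \<open>With nonnegative weights, passing to absolute values preserves the norm and cannot
  decrease the form. A maximiser may therefore be taken nonnegative, and a maximiser is an
  eigenvector.\<close>

lemma rayleigh_perron:
  fixes a :: "'a \<Rightarrow> 'a \<Rightarrow> real"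
  assumes fin: "finite V" and ne: "V \<noteq> {}" and sym: "\<And>u v. a u v = a v u"
    and nn: "\<And>u v. 0 \<le> a u v"
  obtains \<mu> x where
    "\<And>f. (\<Sum>u\<in>V. \<Sum>v\<in>V. a u v * f u * f v) \<le> \<mu> * (\<Sum>u\<in>V. (f u)\<^sup>2)"
    "\<And>u. 0 \<le> x u" "\<exists>u\<in>V. x u \<noteq> 0" "\<And>u. u \<in> V \<Longrightarrow> (\<Sum>v\<in>V. a u v * x v) = \<mu> * x u"
proof -
  let ?Q = "\<lambda>f. \<Sum>u\<in>V. \<Sum>v\<in>V. a u v * f u * f v"
  obtain x where x1: "(\<Sum>u\<in>V. (x u)\<^sup>2) = 1"
    and xm: "\<And>f. (\<Sum>u\<in>V. (f u)\<^sup>2) = 1 \<Longrightarrow> ?Q f \<le> ?Q x"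
    using quadratic_form_attains_max[OF fin ne, of a] by blast
  define \<mu> where "\<mu> = ?Q x"
  have max: "?Q f \<le> \<mu> * (\<Sum>u\<in>V. (f u)\<^sup>2)" for f
  proof (cases "(\<Sum>u\<in>V. (f u)\<^sup>2) = 0")
    case True
    then have "\<forall>u\<in>V. f u = 0" using fin by (simp add: sum_nonneg_eq_0_iff)
    then show ?thesis by simp
  next
    case False
    define N where "N = (\<Sum>u\<in>V. (f u)\<^sup>2)"
    have N: "N > 0" using False sum_nonneg[of V "\<lambda>u. (f u)\<^sup>2"] by (auto simp: N_def)
    have "(\<Sum>u\<in>V. (f u / sqrt N)\<^sup>2) = 1"
      using N by (simp add: power_divide N_def flip: sum_divide_distrib)
    from xm[OF this] have "?Q (\<lambda>u. f u / sqrt N) \<le> \<mu>" by (simp add: \<mu>_def)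
    also have "?Q (\<lambda>u. f u / sqrt N) = ?Q f / N"
      using N by (simp add: sum_divide_distrib)
    finally show ?thesis using N by (simp add: N_def field_simps)
  qed
  define y where "y = (\<lambda>u. \<bar>x u\<bar>)"
  have y1: "(\<Sum>u\<in>V. (y u)\<^sup>2) = 1" using x1 by (simp add: y_def)
  have "?Q x \<le> ?Q y"
  proof (intro sum_mono)
    fix u v
    have "x u * x v \<le> \<bar>x u\<bar> * \<bar>x v\<bar>" by (metis abs_ge_self abs_mult)
    then show "a u v * x u * x v \<le> a u v * y u * y v"
      using nn[of u v] by (simp add: y_def mult.assoc mult_left_mono)
  qed
  with xm[OF y1] have "?Q y = \<mu> * (\<Sum>u\<in>V. (y u)\<^sup>2)" by (simp add: y1 \<mu>_def)
  from rayleigh_maximizer_eigenvector[OF fin sym max this]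
  have ev: "(\<Sum>v\<in>V. a u v * y v) = \<mu> * y u" if "u \<in> V" for u using that by blast
  have "\<exists>u\<in>V. y u \<noteq> 0" using y1 by (metis (no_types, lifting) power_zero_numeral sum.neutral zero_neq_one)
  then show thesis using that[of \<mu> y] max ev by (auto simp: y_def)
qed

text \<open>The only contact with matrices. The sorted vertex list turns sums over vertices into
  sums over indices: \<open>x\<close> becomes an eigenvector for \<mu>, and any eigenvector of the
  matrix, read back as a function on vertices, has Rayleigh quotient at most \<mu>.\<close>

lemma graph_spectral_radius_eqI:
  fixes G :: "'a::linorder graph"
  assumes fin: "finite (verts G)"
    and max: "\<And>f. (\<Sum>u\<in>verts G. \<Sum>v\<in>verts G. adj G u v * f u * f v) \<le> \<mu> * (\<Sum>u\<in>verts G. (f u)\<^sup>2)"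
    and ne: "\<exists>u\<in>verts G. x u \<noteq> 0"
    and ev: "\<And>u. u \<in> verts G \<Longrightarrow> (\<Sum>v\<in>verts G. adj G u v * x v) = \<mu> * x u"
  shows "graph_spectral_radius G = \<mu>"
proof -
  define vs where "vs = sorted_list_of_set (verts G)"
  define n where "n = card (verts G)"
  define A where "A = adjacency_matrix G"
  have A: "A = mat n n (\<lambda>(i, j). adj G (vs ! i) (vs ! j))"
    by (simp add: A_def adjacency_matrix_def Let_def vs_def n_def adj_def)
  have Ac: "A \<in> carrier_mat n n" by (simp add: A)
  have bij: "bij_betw ((!) vs) {..<n} (verts G)"
    using fin by (intro bij_betw_nth) (auto simp: vs_def n_def)
  have sum_vs: "(\<Sum>i<n. g (vs ! i)) = (\<Sum>u\<in>verts G. g u)" for g :: "'a \<Rightarrow> real"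
    by (rule sum.reindex_bij_betw[OF bij])
  have Av: "(A *\<^sub>v v) $ i = (\<Sum>j<n. adj G (vs ! i) (vs ! j) * v $ j)"
    if "v \<in> carrier_vec n" "i < n" for v i
    using that by (auto simp: A scalar_prod_def lessThan_atLeast0 intro!: sum.cong)
  have "eigenvalue A \<mu>"
  proof -
    define v where "v = vec n (\<lambda>i. x (vs ! i))"
    have v: "v \<in> carrier_vec n" by (simp add: v_def)
    obtain u where "u \<in> verts G" "x u \<noteq> 0" using ne by blast
    then obtain i where "i < n" "x (vs ! i) \<noteq> 0"
      using bij by (metis bij_betw_def imageE lessThan_iff)
    then have "v \<noteq> 0\<^sub>v n" by (metis index_vec index_zero_vec(1) v_def)
    moreover have "A *\<^sub>v v = \<mu> \<cdot>\<^sub>v v"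
    proof (rule eq_vecI)
      fix i assume "i < dim_vec (\<mu> \<cdot>\<^sub>v v)"
      then have i: "i < n" by (simp add: v_def)
      then have "vs ! i \<in> verts G" using bij by (auto simp: bij_betw_def)
      have "(A *\<^sub>v v) $ i = (\<Sum>j<n. adj G (vs ! i) (vs ! j) * x (vs ! j))"
        unfolding Av[OF v i] by (intro sum.cong) (auto simp: v_def)
      also have "\<dots> = \<mu> * x (vs ! i)"
        using ev[OF \<open>vs ! i \<in> verts G\<close>] sum_vs[of "\<lambda>v. adj G (vs ! i) v * x v"] by simp
      finally show "(A *\<^sub>v v) $ i = (\<mu> \<cdot>\<^sub>v v) $ i" using i by (simp add: v_def)
    qed (use v Ac in auto)
    ultimately show ?thesis
      unfolding eigenvalue_def eigenvector_def using v Ac by (intro exI[of _ v]) auto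
  qed
  moreover have "l \<le> \<mu>" if "eigenvalue A l" for l
  proof -
    from that obtain v where v: "v \<in> carrier_vec n" "v \<noteq> 0\<^sub>v n" "A *\<^sub>v v = l \<cdot>\<^sub>v v"
      unfolding eigenvalue_def eigenvector_def using Ac by auto
    define f where "f = (\<lambda>u. v $ (the_inv_into {..<n} ((!) vs) u))"
    have f: "f (vs ! i) = v $ i" if "i < n" for i
      using that bij by (simp add: f_def the_inv_into_f_f bij_betw_def)
    have "(\<Sum>u\<in>verts G. \<Sum>w\<in>verts G. adj G u w * f u * f w)
        = (\<Sum>i<n. \<Sum>j<n. adj G (vs ! i) (vs ! j) * f (vs ! i) * f (vs ! j))"
      unfolding sum_vs[of "\<lambda>u. \<Sum>j<n. adj G u (vs ! j) * f u * f (vs ! j)"]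
      by (intro sum.cong refl sum_vs[symmetric])
    also have "\<dots> = (\<Sum>i<n. \<Sum>j<n. v $ i * (adj G (vs ! i) (vs ! j) * v $ j))"
      by (intro sum.cong refl) (simp add: f)
    also have "\<dots> = (\<Sum>i<n. v $ i * (A *\<^sub>v v) $ i)"
      by (intro sum.cong refl) (simp add: Av v(1) sum_distrib_left)
    also have "\<dots> = l * (\<Sum>i<n. (f (vs ! i))\<^sup>2)"
      unfolding v(3) sum_distrib_left using v(1)
      by (intro sum.cong refl) (simp add: f power2_eq_square)
    finally have *: "l * (\<Sum>u\<in>verts G. (f u)\<^sup>2) \<le> \<mu> * (\<Sum>u\<in>verts G. (f u)\<^sup>2)"
      using max[of f] sum_vs[of "\<lambda>u. (f u)\<^sup>2"] by simp
    obtain i where i: "i < n" "v $ i \<noteq> 0"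
      using v(1,2) by (metis carrier_vecD eq_vecI index_zero_vec)
    have "0 < (f (vs ! i))\<^sup>2" using i f by simp
    also have "\<dots> \<le> (\<Sum>u\<in>verts G. (f u)\<^sup>2)"
      using i bij fin by (intro member_le_sum) (auto simp: bij_betw_def)
    finally show ?thesis using * by simp
  qed
  ultimately show ?thesis
    unfolding graph_spectral_radius_def A_def[symmetric] spectrum_def
    using card_finite_spectrum[OF Ac] by (intro Max_eqI) (auto simp: spectrum_def)
qed

text \<open>Without connectivity, \<open>x\<close> is only nonnegative and nonzero; strict
  positivity on the core has to be earned later.\<close>

lemma graph_spectral_radius_perron:
  fixes G :: "'a::linorder graph"
  assumes "finite (verts G)" "verts G \<noteq> {}"
  obtains x where "\<And>u. 0 \<le> x u" "\<exists>u\<in>verts G. x u \<noteq> 0"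
    "\<And>u. u \<in> verts G \<Longrightarrow> (\<Sum>v\<in>verts G. adj G u v * x v) = graph_spectral_radius G * x u"
proof -
  obtain \<mu> x where *:
    "\<And>f. (\<Sum>u\<in>verts G. \<Sum>v\<in>verts G. adj G u v * f u * f v) \<le> \<mu> * (\<Sum>u\<in>verts G. (f u)\<^sup>2)"
    "\<And>u. 0 \<le> x u" "\<exists>u\<in>verts G. x u \<noteq> 0"
    "\<And>u. u \<in> verts G \<Longrightarrow> (\<Sum>v\<in>verts G. adj G u v * x v) = \<mu> * x u"
    by (rule rayleigh_perron[OF assms, of "adj G"]) (auto simp: adj_sym adj_nonneg)
  have "graph_spectral_radius G = \<mu>"
    by (rule graph_spectral_radius_eqI[OF assms(1) *(1,3,4)])
  with that[of x] * show thesis by simp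
qed

text \<open>Source of all lower bounds on spectral radii: any test function \<open>f\<close> may be
  inserted.\<close>

lemma graph_spectral_radius_rayleigh:
  fixes G :: "'a::linorder graph"
  assumes "finite (verts G)" "verts G \<noteq> {}"
  shows "(\<Sum>u\<in>verts G. \<Sum>v\<in>verts G. adj G u v * f u * f v)
      \<le> graph_spectral_radius G * (\<Sum>u\<in>verts G. (f u)\<^sup>2)"
proof -
  obtain \<mu> x where *:
    "\<And>f. (\<Sum>u\<in>verts G. \<Sum>v\<in>verts G. adj G u v * f u * f v) \<le> \<mu> * (\<Sum>u\<in>verts G. (f u)\<^sup>2)"
    "\<And>u. 0 \<le> x u" "\<exists>u\<in>verts G. x u \<noteq> 0"
    "\<And>u. u \<in> verts G \<Longrightarrow> (\<Sum>v\<in>verts G. adj G u v * x v) = \<mu> * x u"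
    by (rule rayleigh_perron[OF assms, of "adj G"]) (auto simp: adj_sym adj_nonneg)
  have "graph_spectral_radius G = \<mu>"
    by (rule graph_spectral_radius_eqI[OF assms(1) *(1,3,4)])
  with * show ?thesis by simp
qed

subsection \<open>Linear forests\<close>

text \<open>A walk moves by one position at a time, so it cannot jump over a missing edge {i, i+1}.
  In the induction, one more step changes the set of indices between the endpoints by at most the
  index of the edge just used.\<close>

lemma reachable_consecutive_edges:
  assumes E: "edges F = {{i, Suc i} |i. i \<in> I}"
  shows "reachable F u v \<longleftrightarrow> (\<forall>i. min u v \<le> i \<and> i < max u v \<longrightarrow> i \<in> I)"
proof
  let ?R = "{(x, y). {x, y} \<in> edges F}"
  assume "reachable F u v"
  then have "(u, v) \<in> ?R\<^sup>*" by (simp add: reachable_def)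
  then show "\<forall>i. min u v \<le> i \<and> i < max u v \<longrightarrow> i \<in> I"
  proof (induction rule: rtrancl_induct)
    case base
    then show ?case by auto
  next
    case (step y z)
    then obtain i where i: "i \<in> I" "(y = i \<and> z = Suc i) \<or> (z = i \<and> y = Suc i)"
      by (auto simp: E doubleton_eq_iff)
    show ?case
    proof (intro allI impI)
      fix j assume j: "min u z \<le> j \<and> j < max u z"
      show "j \<in> I"
      proof (cases "j = i")
        case False
        with i(2) j have "min u y \<le> j \<and> j < max u y" by auto
        then show ?thesis using step.IH by blast
      qed (use i in simp)
    qed
  qed
next
  let ?R = "{(x, y). {x, y} \<in> edges F}"
  have *: "(u, v) \<in> ?R\<^sup>*" if "u \<le> v" "\<forall>i. u \<le> i \<and> i < v \<longrightarrow> i \<in> I" for u v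
    using that
  proof (induction v rule: dec_induct)
    case (step n)
    then have "(u, n) \<in> ?R\<^sup>*" "(n, Suc n) \<in> ?R" by (auto simp: E)
    then show ?case by (rule rtrancl_into_rtrancl)
  qed auto
  have sym: "sym (?R\<^sup>*)"
    by (intro sym_rtrancl symI) (auto simp: insert_commute)
  assume R: "\<forall>i. min u v \<le> i \<and> i < max u v \<longrightarrow> i \<in> I"
  show "reachable F u v"
  proof (cases "u \<le> v")
    case True
    then show ?thesis using * R by (auto simp: reachable_def)
  next
    case False
    then have "(v, u) \<in> ?R\<^sup>*" using R by (intro *) auto
    then show ?thesis using sym by (auto simp: reachable_def dest: symD)
  qed
qed

text \<open>Each component is an interval, and subtracting its minimum \<open>a\<close> maps it onto
  an initial segment. This yields linear forests without constructing their components
  separately.\<close>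

lemma linear_forest_consecutive_edges:
  assumes I: "\<And>i. i \<in> I \<Longrightarrow> Suc i < N"
  defines "F \<equiv> Graph {..<N} {{i, Suc i} |i. i \<in> I}"
  shows "linear_forest F"
  unfolding linear_forest_def
proof
  show "simple_graph F" using I by (fastforce simp: simple_graph_def F_def)
  have E: "edges F = {{i, Suc i} |i. i \<in> I}" by (simp add: F_def)
  note reach = reachable_consecutive_edges[OF E]
  show "\<forall>C\<in>Defs.components F. \<exists>m\<ge>1. isomorphic C (path_graph m)"
  proof
    fix C assume "C \<in> Defs.components F"
    then obtain u where u: "u < N" and C: "C = induced_subgraph F {v \<in> verts F. reachable F u v}"
      by (auto simp: Defs.components_def F_def)
    define W where "W = {v. v < N \<and> reachable F u v}"
    have CW: "verts C = W" "edges C = {e \<in> edges F. e \<subseteq> W}"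
      by (auto simp: C W_def F_def induced_subgraph_def)
    have uW: "u \<in> W" using u by (simp add: W_def reachable_def)
    have fin: "finite W" by (simp add: W_def)
    define a where "a = Min W"
    define b where "b = Max W"
    have ab: "a \<in> W" "b \<in> W" "a \<le> u" "u \<le> b" using fin uW by (auto simp: a_def b_def intro: Min_in Max_in)
    have inI: "i \<in> I" if "a \<le> i" "i < b" for i
    proof (cases "i < u")
      case True
      then show ?thesis using ab that by (auto simp: W_def reach)
    next
      case False
      then show ?thesis using ab that by (auto simp: W_def reach)
    qed
    have W: "W = {a..b}"
    proof
      show "W \<subseteq> {a..b}" using fin by (auto simp: a_def b_def)
      show "{a..b} \<subseteq> W" using inI ab by (auto simp: W_def reach)
    qed
    have "isomorphic C (path_graph (Suc (b - a)))"
      unfolding isomorphic_def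
    proof (intro exI conjI ballI)
      show "bij_betw (\<lambda>v. v - a) (verts C) (verts (path_graph (Suc (b - a))))"
        by (rule bij_betwI[where g = "\<lambda>v. v + a"]) (use ab in \<open>auto simp: CW W path_graph_def\<close>)
      fix v w assume vw: "v \<in> verts C" "w \<in> verts C"
      then have vw': "a \<le> v" "v \<le> b" "a \<le> w" "w \<le> b" by (auto simp: CW W)
      have "{v, w} \<in> edges C \<longleftrightarrow> (w = Suc v \<and> v \<in> I) \<or> (v = Suc w \<and> w \<in> I)"
        using vw by (auto simp: CW E doubleton_eq_iff)
      also have "\<dots> \<longleftrightarrow> (w = Suc v) \<or> (v = Suc w)"
        using inI vw' by auto
      also have "\<dots> \<longleftrightarrow> {v - a, w - a} \<in> edges (path_graph (Suc (b - a)))"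
      proof
        assume "w = Suc v \<or> v = Suc w"
        then have "{v - a, w - a} = {min v w - a, Suc (min v w - a)} \<and> Suc (min v w - a) < Suc (b - a)"
          using vw' by (auto simp: min_def Suc_diff_le)
        then show "{v - a, w - a} \<in> edges (path_graph (Suc (b - a)))"
          unfolding path_graph_def by auto
      qed (use vw' in \<open>auto simp: path_graph_def doubleton_eq_iff\<close>)
      finally show "{v, w} \<in> edges C \<longleftrightarrow> {v - a, w - a} \<in> edges (path_graph (Suc (b - a)))" .
    qed
    then show "\<exists>m\<ge>1. isomorphic C (path_graph m)" by (intro exI[of _ "Suc (b - a)"]) auto
  qed
qed

text \<open>A duplicate-free vertex list encodes a linear forest: consecutive entries that are
  adjacent form its edges, and non-adjacent ones separate its paths. Forests can then be built by
  appending to lists, and forest-freeness becomes a bound on \<open>links\<close>.\<close>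

fun links :: "'a graph \<Rightarrow> 'a list \<Rightarrow> nat" where
  "links G (x # y # zs) = (if {x, y} \<in> edges G then 1 else 0) + links G (y # zs)"
| "links G _ = 0"

lemma links_eq_card:
  "links G zs = card {i. Suc i < length zs \<and> {zs ! i, zs ! Suc i} \<in> edges G}"
proof (induction G zs rule: links.induct)
  case (1 G x y zs)
  let ?A = "{i. Suc i < length (y # zs) \<and> {(y # zs) ! i, (y # zs) ! Suc i} \<in> edges G}"
  let ?B = "{i. Suc i < length (x # y # zs) \<and> {(x # y # zs) ! i, (x # y # zs) ! Suc i} \<in> edges G}"
  have "?B = (if {x, y} \<in> edges G then {0} else {}) \<union> Suc ` ?A"
  proof (rule Set.set_eqI)
    fix i show "i \<in> ?B \<longleftrightarrow> i \<in> (if {x, y} \<in> edges G then {0} else {}) \<union> Suc ` ?A"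
      by (cases i) auto
  qed
  moreover have "finite ?A" by (rule finite_subset[of _ "{..<length (y # zs)}"]) auto
  ultimately have "card ?B = (if {x, y} \<in> edges G then 1 else 0) + card ?A"
    by (auto simp: card_image card_insert_if)
  then show ?case using 1 by simp
qed auto

text \<open>Only an inequality, because the last entry of \<open>xs\<close> may be adjacent to the
  first of \<open>ys\<close>.\<close>

lemma links_append: "links G xs + links G ys \<le> links G (xs @ ys)"
proof (induction G xs rule: links.induct)
  case ("2_2" G v)
  then show ?case by (cases ys) auto
qed auto

lemma linear_forest_in_graph:
  assumes G: "simple_graph G" and zs: "distinct zs" "set zs \<subseteq> verts G" and s: "s \<le> links G zs"
  shows "\<exists>F\<in>linear_forests s. \<exists>H. subgraph H G \<and> isomorphic F H"
proof -
  \<comment> \<open>The list may carry more than \<open>s\<close> links; exactly \<open>s\<close> of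
    them are kept, and list vertices left without an edge become one-vertex paths.\<close>
  obtain I where I: "I \<subseteq> {i. Suc i < length zs \<and> {zs ! i, zs ! Suc i} \<in> edges G}" "card I = s" "finite I"
    using s unfolding links_eq_card by (rule obtain_subset_with_card_n)
  define F where "F = Graph {..<length zs} {{i, Suc i} |i. i \<in> I}"
  define H where "H = Graph (set zs) {{zs ! i, zs ! Suc i} |i. i \<in> I}"
  have "edges F = (\<lambda>i. {i, Suc i}) ` I" by (auto simp: F_def)
  moreover have "inj_on (\<lambda>i. {i, Suc i}) I" by (auto simp: inj_on_def doubleton_eq_iff)
  ultimately have "card (edges F) = s" using I by (simp add: card_image)
  moreover have "linear_forest F"
    unfolding F_def by (rule linear_forest_consecutive_edges) (use I in auto)
  ultimately have "F \<in> linear_forests s" by (simp add: linear_forests_def)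
  moreover have "subgraph H G"
    using zs I by (auto simp: subgraph_def H_def simple_graph_def nth_eq_iff_index_eq)
  moreover have "isomorphic F H"
    unfolding isomorphic_def
  proof (intro exI conjI ballI)
    show "bij_betw ((!) zs) (verts F) (verts H)"
      using zs by (intro bij_betw_nth) (auto simp: F_def H_def)
    fix u v assume "u \<in> verts F" "v \<in> verts F"
    then have uv: "u < length zs" "v < length zs" by (auto simp: F_def)
    have "{zs ! u, zs ! v} = {zs ! i, zs ! Suc i} \<longleftrightarrow> {u, v} = {i, Suc i}" if "i \<in> I" for i
      using that I uv zs(1) by (auto simp: doubleton_eq_iff nth_eq_iff_index_eq)
    then show "{u, v} \<in> edges F \<longleftrightarrow> {zs ! u, zs ! v} \<in> edges H"
      by (auto simp: F_def H_def)
  qed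
  ultimately show ?thesis by blast
qed

text \<open>All neighbours of \<open>v\<close> lie in its component, and an isomorphism
  \<open>f\<close> onto a path sends them to the positions next to \<open>f v\<close>. If
  \<open>f v = 0\<close>, truncated subtraction only adds a harmless position to the bounding
  set.\<close>

lemma linear_forest_degree_le_2:
  assumes F: "linear_forest F" and v: "v \<in> verts F"
  shows "finite {w. {v, w} \<in> edges F}" "card {w. {v, w} \<in> edges F} \<le> 2"
proof -
  define C where "C = induced_subgraph F {w \<in> verts F. reachable F v w}"
  have "C \<in> Defs.components F" using v by (auto simp: Defs.components_def C_def)
  then obtain m f where f: "bij_betw f (verts C) (verts (path_graph m))"
    and fe: "\<And>u w. u \<in> verts C \<Longrightarrow> w \<in> verts C \<Longrightarrow> {u, w} \<in> edges C \<longleftrightarrow> {f u, f w} \<in> edges (path_graph m)"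
    using F unfolding linear_forest_def isomorphic_def by blast
  have sg: "simple_graph F" using F by (simp add: linear_forest_def)
  have vC: "v \<in> verts C" using v by (auto simp: C_def induced_subgraph_def reachable_def)
  have nb: "w \<in> verts C \<and> f w \<in> {f v - 1, Suc (f v)}" if w: "{v, w} \<in> edges F" for w
  proof -
    have "w \<in> verts F" using w sg by (auto simp: simple_graph_def)
    moreover have "reachable F v w" using w by (auto simp: reachable_def)
    ultimately have wC: "w \<in> verts C" by (simp add: C_def induced_subgraph_def)
    have "{v, w} \<in> edges C" using w vC wC by (simp add: C_def induced_subgraph_def)
    then have "{f v, f w} \<in> edges (path_graph m)" using fe vC wC by blast
    then show ?thesis using wC by (auto simp: path_graph_def doubleton_eq_iff)
  qed
  have inj: "inj_on f {w. {v, w} \<in> edges F}"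
    using f nb by (auto simp: bij_betw_def inj_on_def)
  have sub: "f ` {w. {v, w} \<in> edges F} \<subseteq> {f v - 1, Suc (f v)}" using nb by blast
  show "finite {w. {v, w} \<in> edges F}"
    using inj sub by (metis finite.emptyI finite.insertI finite_imageD finite_subset)
  have "card {w. {v, w} \<in> edges F} = card (f ` {w. {v, w} \<in> edges F})"
    using inj by (simp add: card_image)
  also have "\<dots> \<le> card {f v - 1, Suc (f v)}" using sub by (intro card_mono) auto
  also have "\<dots> \<le> 2" by (simp add: card_insert_if)
  finally show "card {w. {v, w} \<in> edges F} \<le> 2" .
qed

lemma linear_forest_incident_edges:
  assumes F: "linear_forest F" and A: "A \<subseteq> verts F"
  shows "card {e \<in> edges F. e \<inter> A \<noteq> {}} \<le> 2 * card A"
proof -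
  have sg: "simple_graph F" using F by (simp add: linear_forest_def)
  have finA: "finite A" using A sg by (auto simp: simple_graph_def intro: finite_subset)
  let ?B = "\<lambda>v. (\<lambda>w. {v, w}) ` {w. {v, w} \<in> edges F}"
  have "{e \<in> edges F. e \<inter> A \<noteq> {}} \<subseteq> (\<Union>v\<in>A. ?B v)"
  proof
    fix e assume e: "e \<in> {e \<in> edges F. e \<inter> A \<noteq> {}}"
    then obtain v where v: "v \<in> A" "v \<in> e" by blast
    have "card e = 2" using e sg by (simp add: simple_graph_def)
    then obtain w where "e = {v, w}" using v(2) by (auto simp: card_2_iff)
    then show "e \<in> (\<Union>v\<in>A. ?B v)" using v e by blast
  qed
  moreover have finB: "finite (?B v)" if "v \<in> A" for v
    using linear_forest_degree_le_2[OF F] A that by blast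
  ultimately have "card {e \<in> edges F. e \<inter> A \<noteq> {}} \<le> card (\<Union>v\<in>A. ?B v)"
    using finA by (intro card_mono) auto
  also have "\<dots> \<le> (\<Sum>v\<in>A. card (?B v))" by (rule card_UN_le[OF finA])
  also have "\<dots> \<le> (\<Sum>v\<in>A. 2)"
  proof (rule sum_mono)
    fix v assume "v \<in> A"
    then show "card (?B v) \<le> 2"
      using linear_forest_degree_le_2[OF F, of v] A
      by (intro order.trans[OF card_image_le]) auto
  qed
  finally show ?thesis by simp
qed

text \<open>Let \<open>A\<close> be the part of the forest placed on \<open>L\<close>. At most
  \<open>2 * card A\<close> forest edges meet \<open>A\<close>, by the degree bound; the remaining
  ones are mapped injectively to edges of \<open>G\<close> avoiding \<open>L\<close>.\<close>

lemma no_linear_forest: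
  assumes G: "simple_graph G" and L: "finite L" and t: "card {e \<in> edges G. e \<inter> L = {}} \<le> t"
    and s: "2 * card L + t < s" and F: "F \<in> linear_forests s"
  shows "\<not> (\<exists>H. subgraph H G \<and> isomorphic F H)"
proof
  assume "\<exists>H. subgraph H G \<and> isomorphic F H"
  then obtain H f where H: "subgraph H G" and f: "bij_betw f (verts F) (verts H)"
    and fe: "\<And>u v. u \<in> verts F \<Longrightarrow> v \<in> verts F \<Longrightarrow> {u, v} \<in> edges F \<longleftrightarrow> {f u, f v} \<in> edges H"
    unfolding isomorphic_def by blast
  have lf: "linear_forest F" and cF: "card (edges F) = s" using F by (auto simp: linear_forests_def)
  have sF: "simple_graph F" using lf by (simp add: linear_forest_def)
  have finE: "finite (edges G)" using G
    by (auto simp: simple_graph_def intro: finite_subset[of _ "Pow (verts G)"])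
  have finEF: "finite (edges F)" using sF
    by (auto simp: simple_graph_def intro: finite_subset[of _ "Pow (verts F)"])
  have inj: "inj_on f (verts F)" using f by (simp add: bij_betw_def)
  define A where "A = {v \<in> verts F. f v \<in> L}"
  have "card A = card (f ` A)" by (intro card_image[symmetric] inj_on_subset[OF inj]) (auto simp: A_def)
  also have "\<dots> \<le> card L" using L by (intro card_mono) (auto simp: A_def)
  finally have A: "card A \<le> card L" .
  have eF: "e \<in> edges F \<Longrightarrow> e \<subseteq> verts F" for e using sF by (simp add: simple_graph_def)
  have "card {e \<in> edges F. e \<inter> A = {}} = card ((`) f ` {e \<in> edges F. e \<inter> A = {}})"
    using inj eF by (intro card_image[symmetric] inj_onI) (auto simp: inj_on_image_eq_iff)
  also have "\<dots> \<le> card {e \<in> edges G. e \<inter> L = {}}"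
  proof (intro card_mono subsetI)
    fix e' assume "e' \<in> (`) f ` {e \<in> edges F. e \<inter> A = {}}"
    then obtain e where e: "e \<in> edges F" "e \<inter> A = {}" "e' = f ` e" by blast
    have "card e = 2" "e \<subseteq> verts F" using e sF by (auto simp: simple_graph_def)
    then obtain u v where uv: "e = {u, v}" "u \<in> verts F" "v \<in> verts F" by (auto simp: card_2_iff)
    then have "{f u, f v} \<in> edges H" using fe e by blast
    then have "e' \<in> edges G" using H e uv by (auto simp: subgraph_def)
    moreover have "e' \<inter> L = {}" using e uv by (auto simp: A_def)
    ultimately show "e' \<in> {e \<in> edges G. e \<inter> L = {}}" by simp
  qed (use finE in auto)
  finally have 1: "card {e \<in> edges F. e \<inter> A = {}} \<le> t" using t by simp
  have "edges F = {e \<in> edges F. e \<inter> A = {}} \<union> {e \<in> edges F. e \<inter> A \<noteq> {}}" by blast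
  then have "card (edges F) \<le> card {e \<in> edges F. e \<inter> A = {}} + card {e \<in> edges F. e \<inter> A \<noteq> {}}"
    by (metis (no_types, lifting) card_Un_le)
  also have "\<dots> \<le> t + 2 * card L"
    using 1 A linear_forest_incident_edges[OF lf, of A] by (auto simp: A_def)
  finally show False using cF s by simp
qed

subsection \<open>Structure of graphs without large linear forests\<close>

lemma degree_eq_card:
  assumes "simple_graph G"
  shows "(\<Sum>w\<in>verts G. adj G v w) = card {w. {v, w} \<in> edges G}"
proof -
  have "{w. {v, w} \<in> edges G} = {w \<in> verts G. {v, w} \<in> edges G}"
    using assms by (auto simp: simple_graph_def)
  then show ?thesis using assms by (simp add: adj_def simple_graph_def flip: sum.inter_filter)
qed

text \<open>Otherwise \<open>h + 1\<close> disjoint copies of \<open>P\<^sub>3\<close> can be chosen greedily around the vertices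
  of large degree.\<close>

lemma few_vertices_of_large_degree:
  assumes G: "simple_graph G"
    and free: "\<And>zs. distinct zs \<Longrightarrow> set zs \<subseteq> verts G \<Longrightarrow> links G zs < s" and s: "s \<le> 2 * h + 2"
  shows "card {v \<in> verts G. 4 * h + 4 \<le> card {w. {v, w} \<in> edges G}} \<le> h" (is "card ?B \<le> h")
proof (rule ccontr)
  assume "\<not> card ?B \<le> h"
  then have "h + 1 \<le> card ?B" by simp
  then obtain W where W: "W \<subseteq> ?B" "card W = h + 1" "finite W" by (rule obtain_subset_with_card_n)
  have "\<exists>zs. distinct zs \<and> set zs \<subseteq> verts G \<and> set zs \<inter> (W - W') = {} \<and> length zs = 3 * card W'
      \<and> 2 * card W' \<le> links G zs" if "W' \<subseteq> W" for W'
    using finite_subset[OF that W(3)] that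
  proof (induction W' rule: finite_induct)
    case empty
    then show ?case by (intro exI[of _ "[]"]) auto
  next
    case (insert w W')
    then obtain zs where zs: "distinct zs" "set zs \<subseteq> verts G" "set zs \<inter> (W - W') = {}"
      "length zs = 3 * card W'" "2 * card W' \<le> links G zs" by auto
    have "card (insert w W') \<le> h + 1" using card_mono[OF W(3) insert.prems] W by simp
    then have cW: "card W' \<le> h" using insert by simp
    \<comment> \<open>At most \<open>3 * h\<close> vertices are used so far and all
      \<open>h + 1\<close> centres are kept in reserve, so degree \<open>4 * h + 4\<close> leaves
      two fresh neighbours of \<open>w\<close>.\<close>
    let ?N = "{v. {w, v} \<in> edges G} - (set zs \<union> W)"
    have "card (set zs \<union> W) \<le> 3 * h + (h + 1)"
      using card_Un_le[of "set zs" W] card_length[of zs] zs(4) W cW by linarith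
    moreover have "4 * h + 4 \<le> card {v. {w, v} \<in> edges G}" using insert.prems W by auto
    moreover have "card {v. {w, v} \<in> edges G} - card (set zs \<union> W) \<le> card ?N"
      using W by (intro diff_card_le_card_Diff) auto
    ultimately have "2 \<le> card ?N" by linarith
    then obtain N2 where "N2 \<subseteq> ?N" "card N2 = 2" by (meson obtain_subset_with_card_n)
    then obtain a b where ab: "a \<in> ?N" "b \<in> ?N" "a \<noteq> b" by (auto simp: card_2_iff)
    have w: "w \<in> W" "w \<in> verts G" "w \<notin> W'" "w \<notin> set zs" using insert zs W by auto
    have abw: "a \<noteq> w" "b \<noteq> w" "a \<in> verts G" "b \<in> verts G"
      using ab w simple_graph_edge_verts[OF G] by auto
    have "links G zs + links G [a, w, b] \<le> links G (zs @ [a, w, b])" by (rule links_append)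
    moreover have "links G [a, w, b] = 2" using ab by (simp add: insert_commute)
    ultimately show ?case
      using zs ab w abw insert by (intro exI[of _ "zs @ [a, w, b]"]) auto
  qed
  from this[of W] obtain zs where "distinct zs" "set zs \<subseteq> verts G" "2 * card W \<le> links G zs" by auto
  with free[of zs] s W show False by simp
qed

text \<open>Greedy matching: the list holds \<open>t\<close> matched pairs one after another. If no
  edge inside \<open>R\<close> avoids its \<open>2 * t\<close> vertices, these vertices already form
  a cover.\<close>

lemma matching_or_cover:
  fixes G :: "'a graph"
  assumes "simple_graph G"
  shows "(\<exists>zs. distinct zs \<and> set zs \<subseteq> R \<inter> verts G \<and> t \<le> links G zs \<and> length zs = 2 * t)
    \<or> (\<exists>U. finite U \<and> card U \<le> 2 * t \<and> (\<forall>u\<in>R. \<forall>v\<in>R. {u, v} \<in> edges G \<longrightarrow> u \<in> U \<or> v \<in> U))"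
proof (induction t)
  case 0
  then show ?case by (intro disjI1 exI[of _ "[]"]) auto
next
  case (Suc t)
  show ?case
  proof (cases "\<exists>zs. distinct zs \<and> set zs \<subseteq> R \<inter> verts G \<and> t \<le> links G zs \<and> length zs = 2 * t")
    case True
    then obtain zs where zs: "distinct zs" "set zs \<subseteq> R \<inter> verts G" "t \<le> links G zs" "length zs = 2 * t"
      by blast
    show ?thesis
    proof (cases "\<forall>u\<in>R. \<forall>v\<in>R. {u, v} \<in> edges G \<longrightarrow> u \<in> set zs \<or> v \<in> set zs")
      case True
      then show ?thesis
        using zs card_length[of zs] by (intro disjI2 exI[of _ "set zs"]) auto
    next
      case False
      then obtain u v where uv: "u \<in> R" "v \<in> R" "{u, v} \<in> edges G" "u \<notin> set zs" "v \<notin> set zs" by blast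
      then have "u \<noteq> v" "u \<in> verts G" "v \<in> verts G"
        using assms simple_graph_no_loop[OF assms] simple_graph_edge_verts[OF assms] by auto
      moreover have "Suc t \<le> links G (zs @ [u, v])"
        using links_append[of G zs "[u, v]"] uv zs by simp
      ultimately show ?thesis using zs uv by (intro disjI1 exI[of _ "zs @ [u, v]"]) auto
    qed
  next
    case False
    with Suc.IH obtain U where U: "finite U" "card U \<le> 2 * t"
      "\<forall>u\<in>R. \<forall>v\<in>R. {u, v} \<in> edges G \<longrightarrow> u \<in> U \<or> v \<in> U" by blast
    then have "card U \<le> 2 * Suc t" by simp
    with U show ?thesis by blast
  qed
qed

text \<open>A matching of \<open>s\<close> edges would be a forbidden forest, so at most
  \<open>2 * s\<close> vertices cover all edges inside \<open>R\<close>. Each covering vertex in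
  \<open>R\<close> contributes at most \<open>d\<close>; the remaining factor 2 arises because
  ordered pairs are summed.\<close>

lemma few_edges_if_small_degree:
  assumes G: "simple_graph G" and R: "R \<subseteq> verts G"
    and free: "\<And>zs. distinct zs \<Longrightarrow> set zs \<subseteq> verts G \<Longrightarrow> links G zs < s"
    and deg: "\<And>u. u \<in> R \<Longrightarrow> (\<Sum>w\<in>verts G. adj G u w) \<le> d" and d: "0 \<le> d"
  shows "(\<Sum>u\<in>R. \<Sum>v\<in>R. adj G u v) \<le> 4 * real s * d"
proof -
  have fin: "finite (verts G)" "finite R" using G R by (auto simp: simple_graph_def intro: finite_subset)
  have "\<not> (\<exists>zs. distinct zs \<and> set zs \<subseteq> R \<inter> verts G \<and> s \<le> links G zs \<and> length zs = 2 * s)"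
    using free by (metis Int_subset_iff not_le)
  with matching_or_cover[OF G, of R s] obtain U where U: "finite U" "card U \<le> 2 * s"
    "\<forall>u\<in>R. \<forall>v\<in>R. {u, v} \<in> edges G \<longrightarrow> u \<in> U \<or> v \<in> U" by blast
  have R_deg: "(\<Sum>v\<in>R. adj G u v) \<le> d" if "u \<in> R" for u
  proof -
    have "(\<Sum>v\<in>R. adj G u v) \<le> (\<Sum>v\<in>verts G. adj G u v)"
      using fin R by (intro sum_mono2) (auto simp: adj_nonneg)
    with deg[OF that] show ?thesis by simp
  qed
  have "(\<Sum>u\<in>R. \<Sum>v\<in>R. adj G u v)
      \<le> (\<Sum>u\<in>R. \<Sum>v\<in>R. (if u \<in> U then adj G u v else 0) + (if v \<in> U then adj G u v else 0))"
    using U(3) by (intro sum_mono) (auto simp: adj_def)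
  also have "\<dots> = 2 * (\<Sum>u\<in>R. \<Sum>v\<in>R. if u \<in> U then adj G u v else 0)"
  proof -
    have "(\<Sum>u\<in>R. \<Sum>v\<in>R. if v \<in> U then adj G u v else 0) = (\<Sum>u\<in>R. \<Sum>v\<in>R. if u \<in> U then adj G u v else 0)"
      by (subst sum.swap) (intro sum.cong refl, simp add: adj_sym)
    then show ?thesis by (simp add: sum.distrib)
  qed
  also have "(\<Sum>u\<in>R. \<Sum>v\<in>R. if u \<in> U then adj G u v else 0) = (\<Sum>u\<in>R. if u \<in> U then (\<Sum>v\<in>R. adj G u v) else 0)"
    by (intro sum.cong) auto
  also have "\<dots> \<le> (\<Sum>u\<in>R. if u \<in> U then d else 0)"
    using R_deg by (intro sum_mono) auto
  also have "\<dots> = card (R \<inter> U) * d"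
    using fin by (simp flip: sum.inter_restrict)
  also have "\<dots> \<le> (2 * real s) * d"
  proof -
    have "card (R \<inter> U) \<le> 2 * s" using U card_mono[of U "R \<inter> U"] by auto
    then have "real (card (R \<inter> U)) \<le> 2 * real s" by linarith
    then show ?thesis using d by (rule mult_right_mono)
  qed
  finally show ?thesis by simp
qed

section \<open>Edges outside a fully joined core\<close>

lemma links_snoc:
  "zs \<noteq> [] \<Longrightarrow> links G (zs @ [x]) = links G zs + (if {last zs, x} \<in> edges G then 1 else 0)"
  by (induction G zs rule: links.induct) auto

lemma extend_links_through_joined_vertices:
  assumes fin: "finite (verts G)" and L: "L \<subseteq> verts G" "L0 \<subseteq> L"
    and join: "\<And>u v. u \<in> L0 \<Longrightarrow> v \<in> verts G - L \<Longrightarrow> {u, v} \<in> edges G"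
    and zs0: "distinct zs0" "set zs0 \<subseteq> verts G" "zs0 \<noteq> []" "set zs0 \<inter> L0 = {}" "last zs0 \<in> verts G - L"
    and big: "length zs0 + 2 * card L0 < card (verts G - L)"
  shows "\<exists>zs. distinct zs \<and> set zs \<subseteq> verts G \<and> links G zs0 + 2 * card L0 \<le> links G zs"
proof -
  have finL: "finite L0" using L fin by (meson finite_subset)
  have "\<exists>zs. distinct zs \<and> set zs \<subseteq> verts G \<and> zs \<noteq> [] \<and> set zs \<inter> (L0 - W) = {} \<and> last zs \<in> verts G - L
     \<and> length zs = length zs0 + 2 * card W \<and> links G zs0 + 2 * card W \<le> links G zs" if "W \<subseteq> L0" for W
    using finite_subset[OF that finL] that
  proof (induction W rule: finite_induct)
    case empty
    then show ?case using zs0 by (intro exI[of _ zs0]) auto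
  next
    case (insert l W)
    then obtain zs where zs: "distinct zs" "set zs \<subseteq> verts G" "zs \<noteq> []" "set zs \<inter> (L0 - W) = {}"
      "last zs \<in> verts G - L" "length zs = length zs0 + 2 * card W" "links G zs0 + 2 * card W \<le> links G zs"
      by auto
    have "card W \<le> card L0" using insert by (intro card_mono finL) auto
    then have "card (set zs) < card (verts G - L)" using zs card_length[of zs] big by linarith
    then have "\<not> verts G - L \<subseteq> set zs" using card_mono[of "set zs" "verts G - L"] by auto
    then obtain w where w: "w \<in> verts G - L" "w \<notin> set zs" by blast
    have l: "l \<in> L0" "l \<notin> set zs" "l \<in> L" "l \<in> verts G" using insert zs L by auto
    have "{l, last zs} \<in> edges G" "{l, w} \<in> edges G" using join l zs w by blast+
    then have "links G (zs @ [l] @ [w]) = links G zs + 2"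
      using zs links_snoc[of "zs @ [l]" G w] by (simp add: links_snoc insert_commute)
    moreover have "l \<noteq> w" "set (zs @ [l] @ [w]) \<inter> (L0 - insert l W) = {}" using zs w l L by auto
    ultimately show ?case using zs w l insert.hyps by (intro exI[of _ "zs @ [l] @ [w]"]) auto
  qed
  from this[of L0] show ?thesis by auto
qed

text \<open>A list through all of \<open>L\<close> already realises \<open>2 * card L\<close> links.
  One edge outside \<open>L\<close>, used as the start of the list, adds one more, and two distinct
  edges add two. The margin 5 in \<open>big\<close> is the length of the longest starting
  list.\<close>

lemma edges_outside_joined_vertices:
  assumes G: "simple_graph G" and L: "L \<subseteq> verts G"
    and join: "\<And>u v. u \<in> L \<Longrightarrow> v \<in> verts G - L \<Longrightarrow> {u, v} \<in> edges G"
    and free: "\<And>zs. distinct zs \<Longrightarrow> set zs \<subseteq> verts G \<Longrightarrow> links G zs < s"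
    and big: "2 * card L + 5 < card (verts G - L)"
  shows "s \<le> 2 * card L + 1 \<Longrightarrow> {e \<in> edges G. e \<inter> L = {}} = {}"
    and "s \<le> 2 * card L + 2 \<Longrightarrow> e1 \<in> edges G \<Longrightarrow> e1 \<inter> L = {} \<Longrightarrow> e2 \<in> edges G \<Longrightarrow> e2 \<inter> L = {} \<Longrightarrow> e1 = e2"
proof -
  have fin: "finite (verts G)" using G by (simp add: simple_graph_def)
  then have finL: "finite L" using L by (rule finite_subset[rotated])
  have ext: "links G zs0 + 2 * card L0 < s"
    if "L0 \<subseteq> L" "distinct zs0" "set zs0 \<subseteq> verts G" "zs0 \<noteq> []" "set zs0 \<inter> L0 = {}" "last zs0 \<in> verts G - L"
      "length zs0 \<le> 5" for zs0 L0
  proof -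
    have "card L0 \<le> card L" using that finL by (intro card_mono)
    then have "length zs0 + 2 * card L0 < card (verts G - L)" using big that(7) by linarith
    from extend_links_through_joined_vertices[OF fin L that(1) _ that(2-6) this] join that(1) free
    show ?thesis by (meson le_less_trans subsetD)
  qed
  have pair: "\<exists>u v. e = {u, v} \<and> u \<noteq> v \<and> u \<in> verts G - L \<and> v \<in> verts G - L"
    if "e \<in> edges G" "e \<inter> L = {}" for e
  proof -
    have "e \<subseteq> verts G" "card e = 2" using that G by (auto simp: simple_graph_def)
    then show ?thesis using that by (auto simp: card_2_iff)
  qed
  show "{e \<in> edges G. e \<inter> L = {}} = {}" if s: "s \<le> 2 * card L + 1"
  proof (rule ccontr)
    assume "{e \<in> edges G. e \<inter> L = {}} \<noteq> {}"
    then obtain u v where uv: "{u, v} \<in> edges G" "u \<noteq> v" "u \<in> verts G - L" "v \<in> verts G - L"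
      using pair by blast
    have "links G [u, v] + 2 * card L < s" by (rule ext) (use uv in auto)
    then show False using s uv by simp
  qed
  assume s: "s \<le> 2 * card L + 2" and e: "e1 \<in> edges G" "e1 \<inter> L = {}" "e2 \<in> edges G" "e2 \<inter> L = {}"
  show "e1 = e2"
  proof (rule ccontr)
    assume ne: "e1 \<noteq> e2"
    obtain u v where 1: "e1 = {u, v}" "u \<noteq> v" "u \<in> verts G - L" "v \<in> verts G - L"
      using pair e by blast
    obtain x y where 2: "e2 = {x, y}" "x \<noteq> y" "x \<in> verts G - L" "y \<in> verts G - L"
      using pair e by blast
    show False
    proof (cases "e1 \<inter> e2 = {}")
      case False
      then obtain p q z where pqz: "e1 = {p, q}" "e2 = {q, z}"
        using 1 2 by (auto simp: insert_commute)
      have "links G [p, q, z] + 2 * card L < s"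
        by (rule ext) (use pqz ne 1 2 in \<open>auto simp: doubleton_eq_iff\<close>)
      then show False using s e pqz by simp
    next
      case True
      show False
      proof (cases "L = {}")
        case True
        have "links G [u, v, x, y] + 2 * card L < s"
          by (rule ext) (use 1 2 \<open>e1 \<inter> e2 = {}\<close> in auto)
        then show False using s e 1 2 by simp
      next
        case False
        then obtain l where l: "l \<in> L" by blast
        have lv: "{l, v} \<in> edges G" "{l, x} \<in> edges G" using join l 1 2 by blast+
        \<comment> \<open>Routing both edges through \<open>l\<close> gives four links at the price
          of one core vertex: two for the edges and the two that \<open>l\<close> is worth.\<close>
        have "links G [u, v, l, x, y] + 2 * card (L - {l}) < s"
          by (rule ext) (use 1 2 l L \<open>e1 \<inter> e2 = {}\<close> in auto)
        moreover have "links G [u, v, l, x, y] = 4" using e 1 2 lv by (simp add: insert_commute)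
        moreover have "card L = Suc (card (L - {l}))" using l finL by (metis card_Suc_Diff1)
        ultimately show False using s by simp
      qed
    qed
  qed
qed

lemma clique_in_graph:
  assumes "C \<subseteq> verts G" "card C = k" "finite C"
    and adj: "\<And>u v. u \<in> C \<Longrightarrow> v \<in> C \<Longrightarrow> u \<noteq> v \<Longrightarrow> {u, v} \<in> edges G"
  shows "\<exists>H. subgraph H G \<and> isomorphic (complete_graph k) H"
proof -
  obtain f where f: "bij_betw f {..<k} C"
    using assms by (metis bij_betw_iff_card card_lessThan finite_lessThan)
  define H where "H = Graph C {{u, v} |u v. u \<in> C \<and> v \<in> C \<and> u \<noteq> v}"
  have "subgraph H G" using assms by (auto simp: subgraph_def H_def simple_graph_def)
  moreover have "isomorphic (complete_graph k) H"
    unfolding isomorphic_def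
  proof (intro exI conjI ballI)
    show "bij_betw f (verts (complete_graph k)) (verts H)" using f by (simp add: complete_graph_def H_def)
    fix u v assume "u \<in> verts (complete_graph k)" "v \<in> verts (complete_graph k)"
    then have uv: "u < k" "v < k" by (auto simp: complete_graph_def)
    then have fuv: "f u \<in> C" "f v \<in> C" "f u = f v \<longleftrightarrow> u = v"
      using f by (auto simp: bij_betw_def inj_on_eq_iff)
    have "{u, v} \<in> edges (complete_graph k) \<longleftrightarrow> u \<noteq> v"
      using uv by (auto simp: complete_graph_def doubleton_eq_iff)
    also have "\<dots> \<longleftrightarrow> {f u, f v} \<in> edges H"
      using fuv by (auto simp: H_def doubleton_eq_iff)
    finally show "{u, v} \<in> edges (complete_graph k) \<longleftrightarrow> {f u, f v} \<in> edges H" .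
  qed
  ultimately show ?thesis by blast
qed

subsection \<open>Turan's theorem with uniqueness\<close>

text \<open>Erdos's degree-majorisation argument. For \<open>v\<close> of maximum degree, its
  neighbourhood \<open>N\<close> has clique number at most one less and is coloured by induction;
  all non-neighbours form one new class \<open>B\<close>. The degree sum over \<open>B\<close> is at
  most \<open>card B * card N\<close>, so the multipartite graph has at least as many edges.
  Equality forces \<open>B\<close> to be independent and completely joined to \<open>N\<close>,
  which gives the second alternative and with it uniqueness.\<close>

lemma turan_multipartite:
  fixes E :: "'a \<Rightarrow> 'a \<Rightarrow> bool"
  assumes "finite V" and sym: "\<And>u v. E u v \<longleftrightarrow> E v u" and irr: "\<And>u. \<not> E u u"
    and "\<And>C. C \<subseteq> V \<Longrightarrow> (\<And>u v. u \<in> C \<Longrightarrow> v \<in> C \<Longrightarrow> u \<noteq> v \<Longrightarrow> E u v) \<Longrightarrow> card C \<le> r"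
  shows "\<exists>f::'a \<Rightarrow> nat. (\<forall>v\<in>V. f v < r) \<and>
     ((\<Sum>u\<in>V. \<Sum>v\<in>V. of_bool (E u v)) < (\<Sum>u\<in>V. \<Sum>v\<in>V. of_bool (f u \<noteq> f v) :: real)
      \<or> (\<forall>u\<in>V. \<forall>v\<in>V. E u v \<longleftrightarrow> f u \<noteq> f v))"
  using assms(1,4)
proof (induction r arbitrary: V)
  case 0
  have "V = {}"
  proof (rule ccontr)
    assume "V \<noteq> {}"
    then obtain v where "v \<in> V" by blast
    then show False using "0.prems"(2)[of "{v}"] by simp
  qed
  then show ?case by simp
next
  case (Suc r)
  show ?case
  proof (cases "V = {}")
    case False
    define d where "d = (\<lambda>v. \<Sum>w\<in>V. of_bool (E v w) :: real)"
    obtain v where v: "v \<in> V" and dmax: "\<And>u. u \<in> V \<Longrightarrow> d u \<le> d v"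
    proof -
      have "Max (d ` V) \<in> d ` V" using Suc.prems False by (intro Max_in) auto
      then obtain v where "v \<in> V" "d v = Max (d ` V)" by auto
      then show thesis using that[of v] Suc.prems by auto
    qed
    define N where "N = {w \<in> V. E v w}"
    define B where "B = V - N"
    have fin: "finite N" "finite B" using Suc.prems by (auto simp: N_def B_def)
    have V: "V = N \<union> B" "N \<inter> B = {}" by (auto simp: N_def B_def)
    have dv: "d v = card N"
      using Suc.prems by (simp add: d_def N_def of_bool_def flip: sum.inter_filter)
    have "card C \<le> r" if "C \<subseteq> N" "\<And>u v. u \<in> C \<Longrightarrow> v \<in> C \<Longrightarrow> u \<noteq> v \<Longrightarrow> E u v" for C
    proof -
      have "v \<notin> C" using that irr by (auto simp: N_def)
      moreover have "card (insert v C) \<le> Suc r"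
        using that v sym by (intro Suc.prems) (auto simp: N_def)
      ultimately show ?thesis using that fin by (simp add: finite_subset)
    qed
    with Suc.IH[OF fin(1)] obtain f :: "'a \<Rightarrow> nat" where f: "\<forall>v\<in>N. f v < r"
      and f': "(\<Sum>u\<in>N. \<Sum>v\<in>N. of_bool (E u v)) < (\<Sum>u\<in>N. \<Sum>v\<in>N. of_bool (f u \<noteq> f v) :: real)
        \<or> (\<forall>u\<in>N. \<forall>v\<in>N. E u v \<longleftrightarrow> f u \<noteq> f v)" by blast
    \<comment> \<open>\<open>r\<close> is the new colour; the class that receives it contains
      \<open>v\<close> itself, since \<open>v\<close> is not its own neighbour.\<close>
    define g where "g = (\<lambda>u. if u \<in> N then f u else r)"
    let ?e = "\<lambda>X Y. \<Sum>u\<in>X. \<Sum>v\<in>Y. of_bool (E u v) :: real"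
    let ?m = "\<lambda>X Y. \<Sum>u\<in>X. \<Sum>v\<in>Y. of_bool (g u \<noteq> g v) :: real"
    have split: "(\<Sum>u\<in>V. \<Sum>v\<in>V. p u v) = (\<Sum>u\<in>N. \<Sum>v\<in>N. p u v) + (\<Sum>u\<in>N. \<Sum>v\<in>B. p u v)
        + ((\<Sum>u\<in>B. \<Sum>v\<in>N. p u v) + (\<Sum>u\<in>B. \<Sum>v\<in>B. p u v))" for p :: "'a \<Rightarrow> 'a \<Rightarrow> real"
      unfolding V(1) using fin V(2) by (simp add: sum.union_disjoint sum.distrib)
    have eNB: "?e N B = ?e B N" by (subst sum.swap) (simp add: sym)
    \<comment> \<open>Every degree in \<open>B\<close> is at most that of \<open>v\<close>, which is
      \<open>card N\<close>.\<close>
    have eBV: "?e B N + ?e B B \<le> real (card B) * real (card N)"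
    proof -
      have "?e B N + ?e B B = (\<Sum>u\<in>B. d u)"
        unfolding d_def V(1) sum.union_disjoint[OF fin V(2)] sum.distrib ..
      also have "\<dots> \<le> (\<Sum>u\<in>B. real (card N))"
        using dmax unfolding dv by (intro sum_mono) (auto simp: B_def)
      finally show ?thesis by simp
    qed
    have mNB: "?m N B = real (card N) * real (card B)"
    proof -
      have "?m N B = (\<Sum>u\<in>N. \<Sum>v\<in>B. 1)"
        using f V(2) by (intro sum.cong refl) (auto simp: g_def)
      then show ?thesis by simp
    qed
    have mBN: "?m B N = real (card N) * real (card B)"
      unfolding mNB[symmetric] by (subst sum.swap) (intro sum.cong refl, auto)
    have mBB: "?m B B = 0" by (intro sum.neutral ballI) (auto simp: g_def B_def)
    have mNN: "?m N N = (\<Sum>u\<in>N. \<Sum>v\<in>N. of_bool (f u \<noteq> f v))"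
      by (intro sum.cong refl) (simp add: g_def)
    have nnBB: "0 \<le> ?e B B" by (intro sum_nonneg) auto
    have nnNB: "?e B N \<le> real (card B) * real (card N)" using eBV nnBB by linarith
    have g: "\<forall>v\<in>V. g v < Suc r" using f by (auto simp: g_def)
    have "?e V V < ?m V V \<or> (\<forall>u\<in>V. \<forall>v\<in>V. E u v \<longleftrightarrow> g u \<noteq> g v)"
    proof (cases "?e V V < ?m V V")
      case False
      then have ge: "?m N N + 2 * (real (card N) * real (card B)) \<le> ?e N N + 2 * ?e B N + ?e B B"
        unfolding split mNB mBN mBB eNB by linarith
      have fE: "\<forall>u\<in>N. \<forall>v\<in>N. E u v \<longleftrightarrow> f u \<noteq> f v"
        using f' ge eBV nnBB unfolding mNN by (auto simp: mult.commute)
      then have eq: "?e N N = ?m N N" unfolding mNN by (intro sum.cong refl) auto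
      have BB0: "?e B B = 0" and BN: "?e B N = real (card B) * real (card N)"
        using ge eBV nnBB nnNB unfolding eq by (auto simp: mult.commute)
      have BB: "\<not> E u w" if "u \<in> B" "w \<in> B" for u w
      proof -
        have "(\<Sum>v\<in>B. of_bool (E u v) :: real) = 0"
          using BB0 that fin by (simp add: sum_nonneg_eq_0_iff sum_nonneg del: sum_of_bool_eq)
        then have "of_bool (E u w) = (0::real)"
          using that fin by (simp add: sum_nonneg_eq_0_iff del: sum_of_bool_eq)
        then show ?thesis by simp
      qed
      have BN1: "E u w" if "u \<in> B" "w \<in> N" for u w
      proof -
        have "(\<Sum>u\<in>B. \<Sum>w\<in>N. 1 - of_bool (E u w) :: real) = 0"
          using BN by (simp only: sum_subtractf) simp
        then have "(\<Sum>w\<in>N. 1 - of_bool (E u w) :: real) = 0"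
          using that fin by (subst (asm) sum_nonneg_eq_0_iff) (auto intro!: sum_nonneg)
        then have "1 - of_bool (E u w) = (0::real)"
          using that fin by (subst (asm) sum_nonneg_eq_0_iff) auto
        then show ?thesis by (cases "E u w") auto
      qed
      have "E u w \<longleftrightarrow> g u \<noteq> g w" if "u \<in> V" "w \<in> V" for u w
        using that f fE BB BN1 sym[of u w] V(2) unfolding V(1) by (auto simp: g_def)
      then show ?thesis by blast
    qed auto
    with g show ?thesis by blast
  qed auto
qed

section \<open>Balanced partitions maximise the number of crossing pairs\<close>

lemma sum_fibre_cards:
  fixes f :: "'a \<Rightarrow> nat"
  assumes "finite V" "\<forall>v\<in>V. f v < r"
  shows "(\<Sum>j<r. card {v \<in> V. f v = j}) = card V"
proof -
  have "card V = card (\<Union>j\<in>{..<r}. {v \<in> V. f v = j})"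
    using assms by (intro arg_cong[of _ _ card]) auto
  also have "\<dots> = (\<Sum>j<r. card {v \<in> V. f v = j})"
    using assms by (intro card_UN_disjoint) auto
  finally show ?thesis by simp
qed

text \<open>The crossing pairs number \<open>card V\<close> squared minus the sum of c^2 over the
  class sizes c, and c^2 = (c - q)(c - q - 1) + (2q + 1)c - q(q + 1). As the class sizes add up to
  \<open>card V\<close>, everything except the products is independent of \<open>f\<close>.\<close>

lemma multipartite_edge_count:
  fixes f :: "'a \<Rightarrow> nat"
  assumes fin: "finite V" and f: "\<forall>v\<in>V. f v < r"
  shows "(\<Sum>u\<in>V. \<Sum>v\<in>V. of_bool (f u \<noteq> f v) :: real)
     = (real (card V))\<^sup>2 - (2 * q + 1) * real (card V) + real r * q * (q + 1)
       - (\<Sum>j<r. (real (card {v \<in> V. f v = j}) - q) * (real (card {v \<in> V. f v = j}) - q - 1))"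
proof -
  let ?c = "\<lambda>j. real (card {v \<in> V. f v = j})"
  have "(\<Sum>u\<in>V. \<Sum>v\<in>V. of_bool (f u \<noteq> f v) :: real) = (\<Sum>u\<in>V. \<Sum>v\<in>V. 1 - of_bool (f v = f u))"
    by (intro sum.cong refl) (auto split: if_splits)
  also have "\<dots> = (real (card V))\<^sup>2 - (\<Sum>u\<in>V. ?c (f u))"
    using fin by (simp add: sum_subtractf power2_eq_square of_bool_def flip: sum.inter_filter)
  also have "(\<Sum>u\<in>V. ?c (f u)) = (\<Sum>j<r. \<Sum>u\<in>{v \<in> V. f v = j}. ?c (f u))"
    using fin f by (intro sum.group[symmetric]) auto
  also have "\<dots> = (\<Sum>j<r. (?c j)\<^sup>2)" by (simp add: power2_eq_square)
  finally have 1: "(\<Sum>u\<in>V. \<Sum>v\<in>V. of_bool (f u \<noteq> f v) :: real) = (real (card V))\<^sup>2 - (\<Sum>j<r. (?c j)\<^sup>2)" .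
  have 2: "(\<Sum>j<r. ?c j) = real (card V)"
    unfolding sum_fibre_cards[OF fin f, symmetric] by simp
  have "(\<Sum>j<r. (?c j - q) * (?c j - q - 1)) = (\<Sum>j<r. (?c j)\<^sup>2 - (2 * q + 1) * ?c j + q * (q + 1))"
    by (intro sum.cong refl) (simp add: power2_eq_square algebra_simps)
  also have "\<dots> = (\<Sum>j<r. (?c j)\<^sup>2) - (2 * q + 1) * real (card V) + real r * q * (q + 1)"
    by (simp add: sum.distrib sum_subtractf 2 flip: sum_distrib_left)
  finally show ?thesis using 1 by simp
qed

text \<open>Fixing the two sizes through \<open>card V div r\<close> determines how many classes
  have the larger size, so balanced partitions of equally large sets agree up to renaming
  colours.\<close>

definition balanced :: "'a set \<Rightarrow> nat \<Rightarrow> ('a \<Rightarrow> nat) \<Rightarrow> bool" where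
  "balanced V r f \<longleftrightarrow> (\<forall>v\<in>V. f v < r) \<and>
     (\<forall>j<r. card {v \<in> V. f v = j} \<in> {card V div r, Suc (card V div r)})"

lemma consecutive_product_nonneg:
  fixes c q :: nat
  shows "0 \<le> (real c - real q) * (real c - real q - 1)"
    and "(real c - real q) * (real c - real q - 1) = 0 \<longleftrightarrow> c \<in> {q, Suc q}"
proof -
  have "c \<le> q \<or> Suc q \<le> c" by auto
  then show "0 \<le> (real c - real q) * (real c - real q - 1)"
    by (auto intro: mult_nonneg_nonneg mult_nonpos_nonpos)
  show "(real c - real q) * (real c - real q - 1) = 0 \<longleftrightarrow> c \<in> {q, Suc q}"
    by auto
qed

text \<open>For integers the product (c - q)(c - q - 1) is nonnegative and vanishes only at c = q
  and c = q + 1. With q = \<open>card V div r\<close> the subtracted sum is therefore 0 for balanced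
  colourings and positive for all others.\<close>

lemma balanced_multipartite_maximal:
  fixes f g :: "'a \<Rightarrow> nat"
  assumes fin: "finite V" and f: "\<forall>v\<in>V. f v < r" and g: "balanced V r g" and nb: "\<not> balanced V r f"
  shows "(\<Sum>u\<in>V. \<Sum>v\<in>V. of_bool (f u \<noteq> f v) :: real) < (\<Sum>u\<in>V. \<Sum>v\<in>V. of_bool (g u \<noteq> g v))"
proof -
  define q where "q = card V div r"
  let ?p = "\<lambda>f j. (real (card {v \<in> V. f v = j}) - real q) * (real (card {v \<in> V. f v = j}) - real q - 1)"
  have "(\<Sum>j<r. ?p g j) = 0"
    using g by (intro sum.neutral ballI) (auto simp: balanced_def q_def)
  moreover obtain j where "j < r" "?p f j \<noteq> 0"
    using nb f consecutive_product_nonneg(2) unfolding balanced_def q_def by blast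
  then have "0 < (\<Sum>j<r. ?p f j)"
    using consecutive_product_nonneg(1) by (intro sum_pos2[of _ j]) (auto simp: less_le)
  ultimately show ?thesis
    using g multipartite_edge_count[OF fin f, of "real q"] multipartite_edge_count[OF fin, of g r "real q"]
    by (simp add: balanced_def)
qed

lemma balanced_mod:
  assumes r: "0 < r"
  shows "balanced {..<h} r (\<lambda>i. i mod r)"
proof -
  have "card {v \<in> {..<h}. v mod r = j} \<in> {h div r, Suc (h div r)}" if j: "j < r" for j
  proof -
    define T where "T = {t. t * r + j < h}"
    have "{v \<in> {..<h}. v mod r = j} = (\<lambda>t. t * r + j) ` T"
    proof
      show "{v \<in> {..<h}. v mod r = j} \<subseteq> (\<lambda>t. t * r + j) ` T"
      proof
        fix v assume v: "v \<in> {v \<in> {..<h}. v mod r = j}"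
        then have "v = (v div r) * r + j" by auto
        then show "v \<in> (\<lambda>t. t * r + j) ` T" using v by (auto simp: T_def intro!: image_eqI[of _ _ "v div r"])
      qed
    qed (use j in \<open>auto simp: T_def\<close>)
    moreover have "inj_on (\<lambda>t. t * r + j) T" using r by (auto simp: inj_on_def)
    ultimately have c: "card {v \<in> {..<h}. v mod r = j} = card T" by (simp add: card_image)
    \<comment> \<open>The residue class of \<open>j\<close> is enumerated by the quotients
      \<open>t\<close>; the incomplete last block contributes exactly when
      \<open>j < h mod r\<close>.\<close>
    have T: "t \<in> T \<longleftrightarrow> t < h div r \<or> (t = h div r \<and> j < h mod r)" for t
    proof -
      have h: "h = h div r * r + h mod r" by simp
      consider "t < h div r" | "t = h div r" | "t > h div r" by linarith
      then show ?thesis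
      proof cases
        case 1
        then have "Suc t * r \<le> h div r * r" by (intro mult_le_mono1) simp
        then have "t * r + j < h" using j h by (simp, linarith)
        then show ?thesis using 1 by (simp add: T_def)
      next
        case 2
        have "h div r * r + j < h \<longleftrightarrow> j < h mod r"
          by (metis h nat_add_left_cancel_less)
        then show ?thesis unfolding T_def mem_Collect_eq 2 by blast
      next
        case 3
        then have "Suc (h div r) * r \<le> t * r" by (intro mult_le_mono1) simp
        then have "h \<le> t * r" using h mod_less_divisor[OF r, of h] by (simp, linarith)
        then show ?thesis using 3 by (simp add: T_def)
      qed
    qed
    have "card T \<in> {h div r, Suc (h div r)}"
    proof (cases "j < h mod r")
      case True
      then have "T = {..h div r}" by (intro Set.set_eqI) (simp only: T atMost_iff le_less, simp)
      then show ?thesis by simp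
    next
      case False
      then have "T = {..<h div r}" by (intro Set.set_eqI) (simp only: T lessThan_iff, simp)
      then show ?thesis by simp
    qed
    then show ?thesis using c by simp
  qed
  then show ?thesis using r by (auto simp: balanced_def)
qed

text \<open>Counting gives \<open>r * q + card J = card V\<close>, where \<open>J\<close> collects
  the colours of the larger classes, and likewise for \<open>K\<close>. Hence a permutation
  \<open>p\<close> of the colours can send large classes to large ones and small to small.\<close>

lemma balanced_same_fibres:
  fixes f :: "'a \<Rightarrow> nat" and g :: "'b \<Rightarrow> nat"
  assumes V: "finite V" "balanced V r f" and W: "finite W" "balanced W r g" and c: "card V = card W"
  obtains p where "inj_on p {..<r}" "p ` {..<r} = {..<r}"
    "\<And>j. j < r \<Longrightarrow> card {v \<in> V. p (f v) = j} = card {w \<in> W. g w = j}"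
proof -
  define q where "q = card V div r"
  define J where "J = {j \<in> {..<r}. card {v \<in> V. f v = j} = Suc q}"
  define K where "K = {j \<in> {..<r}. card {w \<in> W. g w = j} = Suc q}"
  have cJ: "card {v \<in> V. f v = j} = q + of_bool (j \<in> J)" if "j < r" for j
    using that V(2) by (auto simp: balanced_def q_def J_def)
  have cK: "card {w \<in> W. g w = j} = q + of_bool (j \<in> K)" if "j < r" for j
    using that W(2) by (auto simp: balanced_def q_def K_def c)
  have "r * q + card J = (\<Sum>j<r. q + of_bool (j \<in> J))"
    by (simp add: sum.distrib J_def of_bool_def flip: sum.inter_filter)
  also have "\<dots> = card V" using sum_fibre_cards[of V f r] V cJ by (simp add: balanced_def)
  also have "\<dots> = (\<Sum>j<r. q + of_bool (j \<in> K))" using sum_fibre_cards[of W g r] W cK by (simp add: balanced_def c)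
  also have "\<dots> = r * q + card K"
    by (simp add: sum.distrib K_def of_bool_def flip: sum.inter_filter)
  finally have JK: "card J = card K" by simp
  have sub: "J \<subseteq> {..<r}" "K \<subseteq> {..<r}" by (auto simp: J_def K_def)
  obtain p1 where p1: "bij_betw p1 J K" using JK sub by (metis bij_betw_iff_card finite_lessThan finite_subset)
  have "card ({..<r} - J) = card ({..<r} - K)" using JK sub by (simp add: card_Diff_subset finite_subset)
  then obtain p2 where p2: "bij_betw p2 ({..<r} - J) ({..<r} - K)"
    by (metis bij_betw_iff_card finite_Diff finite_lessThan)
  define p where "p = (\<lambda>j. if j \<in> J then p1 j else p2 j)"
  have "bij_betw p (J \<union> ({..<r} - J)) (K \<union> ({..<r} - K))"
    unfolding p_def by (rule bij_betw_disjoint_Un[OF p1 p2]) auto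
  then have p: "bij_betw p {..<r} {..<r}" using sub by (simp add: Un_absorb1)
  have pJ: "p j \<in> K \<longleftrightarrow> j \<in> J" if "j < r" for j
    using that p1 p2 by (auto simp: p_def bij_betw_def)
  show thesis
  proof (rule that[of p])
    show "inj_on p {..<r}" "p ` {..<r} = {..<r}" using p by (auto simp: bij_betw_def)
    fix j assume j: "j < r"
    then obtain i where i: "i < r" "j = p i" using p unfolding bij_betw_def by blast
    have "{v \<in> V. p (f v) = j} = {v \<in> V. f v = i}"
      using V(2) i p by (auto simp: balanced_def bij_betw_def inj_on_eq_iff)
    then show "card {v \<in> V. p (f v) = j} = card {w \<in> W. g w = j}"
      using cJ[OF i(1)] cK[OF j] pJ[OF i(1)] i by simp
  qed
qed

subsection \<open>Isomorphism and the extremal graphs\<close>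

lemma isomorphic_sym:
  assumes "isomorphic G H"
  shows "isomorphic H G"
proof -
  from assms obtain f where f: "bij_betw f (verts G) (verts H)"
    and e: "\<forall>u\<in>verts G. \<forall>v\<in>verts G. {u, v} \<in> edges G \<longleftrightarrow> {f u, f v} \<in> edges H"
    unfolding isomorphic_def by blast
  let ?g = "inv_into (verts G) f"
  have g: "bij_betw ?g (verts H) (verts G)" by (rule bij_betw_inv_into[OF f])
  have fg: "f (?g u) = u" if "u \<in> verts H" for u
    using that f by (simp add: bij_betw_inv_into_right)
  have "{u, v} \<in> edges H \<longleftrightarrow> {?g u, ?g v} \<in> edges G" if "u \<in> verts H" "v \<in> verts H" for u v
    using that e[rule_format, of "?g u" "?g v"] fg[of u] fg[of v] bij_betw_apply[OF g] by simp
  with g show ?thesis unfolding isomorphic_def by blast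
qed

lemma isomorphic_trans:
  assumes "isomorphic G H" "isomorphic H K"
  shows "isomorphic G K"
proof -
  from assms(1) obtain f where f: "bij_betw f (verts G) (verts H)"
    and e: "\<forall>u\<in>verts G. \<forall>v\<in>verts G. {u, v} \<in> edges G \<longleftrightarrow> {f u, f v} \<in> edges H"
    unfolding isomorphic_def by blast
  from assms(2) obtain g where g: "bij_betw g (verts H) (verts K)"
    and e': "\<forall>u\<in>verts H. \<forall>v\<in>verts H. {u, v} \<in> edges H \<longleftrightarrow> {g u, g v} \<in> edges K"
    unfolding isomorphic_def by blast
  have "bij_betw (g \<circ> f) (verts G) (verts K)" using f g by (rule bij_betw_trans)
  moreover have "f u \<in> verts H" if "u \<in> verts G" for u using that f by (rule bij_betw_apply[rotated])
  ultimately show ?thesis using e e' unfolding isomorphic_def comp_def by metis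
qed

lemma isomorphic_card_verts: "isomorphic G H \<Longrightarrow> card (verts G) = card (verts H)"
  unfolding isomorphic_def using bij_betw_same_card by blast

lemma isomorphic_subgraph_transfer:
  assumes GG': "isomorphic G G'" and H: "subgraph H G"
  shows "\<exists>H'. subgraph H' G' \<and> isomorphic H H'"
proof -
  from GG' obtain f where f: "bij_betw f (verts G) (verts G')"
    and e: "\<forall>u\<in>verts G. \<forall>v\<in>verts G. {u, v} \<in> edges G \<longleftrightarrow> {f u, f v} \<in> edges G'"
    unfolding isomorphic_def by blast
  have HG: "verts H \<subseteq> verts G" "edges H \<subseteq> edges G" and sH: "simple_graph H"
    using H by (auto simp: subgraph_def)
  have inj: "inj_on f (verts H)" using f HG by (auto simp: bij_betw_def intro: inj_on_subset)
  define H' where "H' = Graph (f ` verts H) ((`) f ` edges H)"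
  have eH: "\<exists>u v. d = {u, v} \<and> u \<noteq> v \<and> u \<in> verts H \<and> v \<in> verts H" if "d \<in> edges H" for d
  proof -
    have "d \<subseteq> verts H" "card d = 2" using sH that by (auto simp: simple_graph_def)
    then show ?thesis by (auto simp: card_2_iff)
  qed
  have "subgraph H' G'"
    unfolding subgraph_def
  proof (intro conjI)
    show "verts H' \<subseteq> verts G'" using f HG by (auto simp: H'_def bij_betw_def)
    show "edges H' \<subseteq> edges G'"
    proof
      fix d' assume "d' \<in> edges H'"
      then obtain d where d: "d \<in> edges H" "d' = f ` d" by (auto simp: H'_def)
      then obtain u v where uv: "d = {u, v}" "u \<in> verts H" "v \<in> verts H" using eH by blast
      then have "{f u, f v} \<in> edges G'" using e HG d by blast
      then show "d' \<in> edges G'" using d uv by simp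
    qed
    have "card (f ` d) = 2" if "d \<in> edges H" for d
      using eH[OF that] inj by (auto simp: inj_on_eq_iff card_insert_if)
    then show "simple_graph H'" using sH by (auto simp: simple_graph_def H'_def)
  qed
  moreover have "isomorphic H H'"
    unfolding isomorphic_def
  proof (intro exI conjI ballI)
    show "bij_betw f (verts H) (verts H')" using inj by (simp add: bij_betw_def H'_def)
    fix u v assume uv: "u \<in> verts H" "v \<in> verts H"
    show "{u, v} \<in> edges H \<longleftrightarrow> {f u, f v} \<in> edges H'"
    proof
      assume "{f u, f v} \<in> edges H'"
      then obtain d where d: "d \<in> edges H" "f ` {u, v} = f ` d" by (auto simp: H'_def)
      moreover have "d \<subseteq> verts H" using sH d by (simp add: simple_graph_def)
      ultimately have "{u, v} = d" using uv inj by (metis empty_subsetI inj_on_image_eq_iff insert_subset)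
      then show "{u, v} \<in> edges H" using d by simp
    qed (auto simp: H'_def intro!: image_eqI[of _ _ "{u, v}"])
  qed
  ultimately show ?thesis by blast
qed

lemma free_of_isomorphic: "isomorphic G G' \<Longrightarrow> free_of \<F> G' \<Longrightarrow> free_of \<F> G"
  unfolding free_of_def using isomorphic_subgraph_transfer isomorphic_trans by blast

text \<open>Adjacency depends only on colours, so arbitrary bijections between corresponding classes
  glue to an isomorphism. This reduces uniqueness to comparing class sizes.\<close>

lemma isomorphic_if_equal_colour_classes:
  fixes c :: "'a \<Rightarrow> 'c" and d :: "'b \<Rightarrow> 'c"
  assumes fin: "finite (verts G)" "finite (verts H)"
    and cards: "\<And>j. card {v \<in> verts G. c v = j} = card {v \<in> verts H. d v = j}"
    and eG: "\<And>u v. u \<in> verts G \<Longrightarrow> v \<in> verts G \<Longrightarrow> {u, v} \<in> edges G \<longleftrightarrow> R (c u) (c v)"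
    and eH: "\<And>u v. u \<in> verts H \<Longrightarrow> v \<in> verts H \<Longrightarrow> {u, v} \<in> edges H \<longleftrightarrow> R (d u) (d v)"
  shows "isomorphic G H"
proof -
  have "\<exists>p. bij_betw p {v \<in> verts G. c v = j} {v \<in> verts H. d v = j}" for j
    using fin cards by (subst bij_betw_iff_card) auto
  then obtain p where p: "\<And>j. bij_betw (p j) {v \<in> verts G. c v = j} {v \<in> verts H. d v = j}" by metis
  define f where "f = (\<lambda>v. p (c v) v)"
  have f: "f v \<in> verts H" "d (f v) = c v" if "v \<in> verts G" for v
    using bij_betw_apply[OF p[of "c v"], of v] that by (auto simp: f_def)
  have "bij_betw f (verts G) (verts H)"
    unfolding bij_betw_def
  proof
    show "inj_on f (verts G)"
    proof (rule inj_onI)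
      fix u v assume uv: "u \<in> verts G" "v \<in> verts G" "f u = f v"
      then have "c u = c v" using f by metis
      then show "u = v" using uv p[of "c v"] by (auto simp: f_def bij_betw_def inj_on_def)
    qed
    show "f ` verts G = verts H"
    proof
      show "verts H \<subseteq> f ` verts G"
      proof
        fix w assume "w \<in> verts H"
        then have "w \<in> p (d w) ` {v \<in> verts G. c v = d w}" using p[of "d w"] by (simp add: bij_betw_def)
        then obtain v where "v \<in> verts G" "c v = d w" "w = p (d w) v" by blast
        then have "v \<in> verts G" "f v = w" by (simp_all add: f_def)
        then show "w \<in> f ` verts G" by blast
      qed
    qed (use f in auto)
  qed
  then show ?thesis unfolding isomorphic_def using f eG eH by (intro exI[of _ f]) auto
qed

text \<open>Colours below \<open>r\<close> are the parts of the Turan graph, \<open>r\<close> is the independent set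
  joined to it, and \<open>r + 1\<close>, \<open>r + 2\<close> are the ends of the additional edge (present iff \<open>b = 1\<close>).\<close>

definition colour_adj :: "nat \<Rightarrow> nat \<Rightarrow> nat \<Rightarrow> bool" where
  "colour_adj r i j \<longleftrightarrow> i \<noteq> j \<and> (i < r \<or> j < r \<or> r < i \<and> r < j)"

definition class_size :: "nat \<Rightarrow> nat \<Rightarrow> nat \<Rightarrow> nat \<Rightarrow> nat \<Rightarrow> nat" where
  "class_size b r h n j =
     (if j < r then card {i \<in> {..<h}. i mod r = j}
      else if j = r then n - h - 2 * b else if j \<le> r + 2 then b else 0)"

text \<open>One description for all four extremal graphs, free of any particular vertex type: it
  applies to an extremal \<open>G\<close>, to the candidates built on its vertex set and to the
  joins of the theorem.\<close>

definition is_target :: "nat \<Rightarrow> nat \<Rightarrow> nat \<Rightarrow> nat \<Rightarrow> 'a graph \<Rightarrow> bool" where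
  "is_target b r h n G \<longleftrightarrow> finite (verts G) \<and>
     (\<exists>c. (\<forall>j. card {v \<in> verts G. c v = j} = class_size b r h n j) \<and>
        (\<forall>u\<in>verts G. \<forall>v\<in>verts G. {u, v} \<in> edges G \<longleftrightarrow> colour_adj r (c u) (c v)))"

lemma is_target_isomorphic:
  assumes "is_target b r h n G" "is_target b r h n H"
  shows "isomorphic G H"
proof -
  from assms obtain c d where fin: "finite (verts G)" "finite (verts H)"
    and c: "\<forall>j. card {v \<in> verts G. c v = j} = class_size b r h n j"
      "\<forall>u\<in>verts G. \<forall>v\<in>verts G. {u, v} \<in> edges G \<longleftrightarrow> colour_adj r (c u) (c v)"
    and d: "\<forall>j. card {v \<in> verts H. d v = j} = class_size b r h n j"
      "\<forall>u\<in>verts H. \<forall>v\<in>verts H. {u, v} \<in> edges H \<longleftrightarrow> colour_adj r (d u) (d v)"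
    unfolding is_target_def by blast
  show ?thesis
    by (rule isomorphic_if_equal_colour_classes[OF fin, of c d "colour_adj r"]) (use c d in auto)
qed

text \<open>With at least as many parts as vertices every part has at most one vertex. Small and
  large \<open>s\<close> are thereby treated together.\<close>

lemma complete_graph_eq_turan:
  assumes "h \<le> r"
  shows "complete_graph h = turan_graph h r"
proof -
  have "i mod r = i" if "i < h" for i using that assms by simp
  then show ?thesis unfolding complete_graph_def turan_graph_def by (simp cong: conj_cong)
qed

lemma image_doubleton_mem_iff:
  assumes "inj f"
  shows "{f u, f v} \<in> (`) f ` A \<longleftrightarrow> {u, v} \<in> A"
proof
  assume "{f u, f v} \<in> (`) f ` A"
  then obtain B where "B \<in> A" "f ` {u, v} = f ` B" by auto
  then show "{u, v} \<in> A" using inj_image_eq_iff[OF assms] by metis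
qed (auto intro!: image_eqI[of _ _ "{u, v}"])

lemma graph_join_edges:
  "{x, y} \<in> edges (graph_join G H) \<longleftrightarrow>
     (case (x, y) of (Inl u, Inl v) \<Rightarrow> {u, v} \<in> edges G | (Inr u, Inr v) \<Rightarrow> {u, v} \<in> edges H
      | (Inl u, Inr v) \<Rightarrow> u \<in> verts G \<and> v \<in> verts H | (Inr v, Inl u) \<Rightarrow> u \<in> verts G \<and> v \<in> verts H)"
proof -
  have "{Inl u, Inr v} \<noteq> Inl ` A" "{Inl u, Inr v} \<noteq> Inr ` B"
    "{Inr v, Inl u} \<noteq> Inl ` A" "{Inr v, Inl u} \<noteq> Inr ` B" for u :: 'a and v :: 'b and A B
    by blast+
  then show ?thesis
    by (cases x; cases y) (auto simp: graph_join_def disjoint_union_def image_doubleton_mem_iff doubleton_eq_iff)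
qed

lemma disjoint_union_edges:
  "{x, y} \<in> edges (disjoint_union G H) \<longleftrightarrow>
     (case (x, y) of (Inl u, Inl v) \<Rightarrow> {u, v} \<in> edges G | (Inr u, Inr v) \<Rightarrow> {u, v} \<in> edges H | _ \<Rightarrow> False)"
proof -
  have "{Inl u, Inr v} \<noteq> Inl ` A" "{Inl u, Inr v} \<noteq> Inr ` B"
    "{Inr v, Inl u} \<noteq> Inl ` A" "{Inr v, Inl u} \<noteq> Inr ` B" for u :: 'a and v :: 'b and A B
    by blast+
  then show ?thesis
    by (cases x; cases y) (auto simp: disjoint_union_def image_doubleton_mem_iff)
qed

lemma turan_graph_edges: "{u, v} \<in> edges (turan_graph m r) \<longleftrightarrow> u < m \<and> v < m \<and> u mod r \<noteq> v mod r"
  by (auto simp: turan_graph_def doubleton_eq_iff)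

lemma is_target_turan_join:
  assumes "0 < r" "h \<le> n"
  shows "is_target 0 r h n (graph_join (turan_graph h r) (edgeless_graph (n - h)))"
proof -
  let ?G = "graph_join (turan_graph h r) (edgeless_graph (n - h))"
  define c where "c = (\<lambda>x::nat + nat. case x of Inl i \<Rightarrow> i mod r | Inr _ \<Rightarrow> r)"
  have V: "verts ?G = {..<h} <+> {..<n - h}"
    by (simp add: graph_join_def disjoint_union_def turan_graph_def edgeless_graph_def)
  have "card {v \<in> verts ?G. c v = j} = class_size 0 r h n j" for j
  proof -
    consider "j < r" | "j = r" | "j > r" by linarith
    then show ?thesis
    proof cases
      case 1
      then have "{v \<in> verts ?G. c v = j} = Inl ` {i \<in> {..<h}. i mod r = j}"
        by (auto simp: V c_def)
      then show ?thesis using 1 by (simp add: card_image class_size_def)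
    next
      case 2
      then have "{v \<in> verts ?G. c v = j} = Inr ` {..<n - h}"
        using assms by (auto simp: V c_def mod_less_divisor less_imp_neq)
      then show ?thesis using 2 by (simp add: card_image class_size_def)
    next
      case 3
      have "i mod r \<noteq> j" for i using mod_less_divisor[OF assms(1), of i] 3 by linarith
      then have "{v \<in> verts ?G. c v = j} = {}"
        using 3 by (auto simp: V c_def split: sum.splits)
      then show ?thesis by (simp only: card.empty) (use 3 in \<open>simp add: class_size_def\<close>)
    qed
  qed
  moreover have "{u, v} \<in> edges ?G \<longleftrightarrow> colour_adj r (c u) (c v)" if "u \<in> verts ?G" "v \<in> verts ?G" for u v
  proof -
    have m: "i mod r < r" "i mod r \<noteq> r" "r \<noteq> i mod r" for i
      using mod_less_divisor[OF assms(1), of i] by auto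
    have "verts (turan_graph h r) = {..<h}" by (simp add: turan_graph_def)
    then show ?thesis using that m unfolding graph_join_edges V
      by (auto simp: turan_graph_edges edgeless_graph_def c_def colour_adj_def split: sum.splits)
  qed
  moreover have "finite (verts ?G)" by (simp add: V)
  ultimately show ?thesis unfolding is_target_def by blast
qed

lemma is_target_complete_join:
  assumes "0 < r" "h \<le> r" "h + 2 \<le> n"
  shows "is_target 1 r h n
    (graph_join (complete_graph h) (disjoint_union (path_graph 2) (edgeless_graph (n - h - 2))))"
proof -
  define N where "N = n - h - 2"
  let ?G = "graph_join (turan_graph h r) (disjoint_union (path_graph 2) (edgeless_graph (N)))"
  \<comment> \<open>The two path vertices, numbered 0 and 1, get the private colours
    \<open>r + 1\<close> and \<open>r + 2\<close>.\<close>
  define c where "c = (\<lambda>x::nat + (nat + nat). case x of Inl i \<Rightarrow> i mod r | Inr (Inl i) \<Rightarrow> r + 1 + i | Inr (Inr _) \<Rightarrow> r)"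
  have V: "verts ?G = {..<h} <+> ({..<2} <+> {..<N})"
    by (simp add: graph_join_def disjoint_union_def turan_graph_def edgeless_graph_def path_graph_def)
  have m: "i mod r < r" for i using assms by simp
  have m': "i mod r \<noteq> j" "j \<noteq> i mod r" if "r \<le> j" for i j using m[of i] that by linarith+
  have "card {v \<in> verts ?G. c v = j} = class_size 1 r h n j" for j
  proof -
    consider "j < r" | "j = r" | "j = r + 1 \<or> j = r + 2" | "j > r + 2" by linarith
    then show ?thesis
    proof cases
      case 1
      then have "{v \<in> verts ?G. c v = j} = Inl ` {i \<in> {..<h}. i mod r = j}"
        by (auto simp: V c_def)
      then show ?thesis using 1 by (simp add: card_image class_size_def N_def)
    next
      case 2
      then have "{v \<in> verts ?G. c v = j} = (\<lambda>x. Inr (Inr x)) ` {..<N}"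
        by (auto simp: V c_def m')
      moreover have "inj_on (\<lambda>x. Inr (Inr x) :: nat + (nat + nat)) {..<N}" by (auto simp: inj_on_def)
      ultimately show ?thesis using 2 by (simp add: card_image class_size_def N_def)
    next
      case 3
      then have "{v \<in> verts ?G. c v = j} = {Inr (Inl (j - r - 1))}"
        by (auto simp: V c_def m')
      then have "card {v \<in> verts ?G. c v = j} = 1" by (simp only: is_singletonI flip: is_singleton_altdef)
      moreover have "class_size 1 r h n j = 1" using 3 by (auto simp: class_size_def)
      ultimately show ?thesis by simp
    next
      case 4
      have "c v \<noteq> j" if "v \<in> verts ?G" for v
      proof (cases v)
        case (Inl i)
        then show ?thesis using m[of i] 4 by (simp add: c_def)
      next
        case (Inr w)
        then show ?thesis using that 4 by (cases w) (auto simp: V c_def)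
      qed
      then have "{v \<in> verts ?G. c v = j} = {}" by blast
      then show ?thesis by (simp only: card.empty) (use 4 in \<open>simp add: class_size_def\<close>)
    qed
  qed
  moreover have "{u, v} \<in> edges ?G \<longleftrightarrow> colour_adj r (c u) (c v)" if "u \<in> verts ?G" "v \<in> verts ?G" for u v
  proof -
    have P: "{i, j} \<in> edges (path_graph 2) \<longleftrightarrow> i \<noteq> j" if "i < 2" "j < 2" for i j
      using that by (auto simp: path_graph_def doubleton_eq_iff)
    have P0: "{i} \<notin> edges (path_graph 2)" for i
      by (auto simp: path_graph_def doubleton_eq_iff)
    have vs: "verts (turan_graph h r) = {..<h}"
      "verts (disjoint_union (path_graph 2) (edgeless_graph (N))) = {..<2} <+> {..<N}"
      by (auto simp: turan_graph_def disjoint_union_def path_graph_def edgeless_graph_def)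
    show ?thesis
      using that m m' unfolding graph_join_edges V disjoint_union_edges vs
      by (auto simp: turan_graph_edges P P0 c_def colour_adj_def vs disjoint_union_edges edgeless_graph_def
          split: sum.splits)
  qed
  moreover have "finite (verts ?G)" by (simp add: V)
  ultimately have "is_target 1 r h n ?G" unfolding is_target_def by blast
  then show ?thesis by (simp add: complete_graph_eq_turan[OF assms(2)] N_def)
qed

text \<open>The candidate is placed on the vertex set of the graph it competes with, so that one
  function on \<open>V\<close> can serve as a vector for both graphs. \<open>X\<close> holds the
  edges outside the core.\<close>

definition core_graph :: "'a set \<Rightarrow> 'a set \<Rightarrow> ('a \<Rightarrow> nat) \<Rightarrow> 'a set set \<Rightarrow> 'a graph" where
  "core_graph V L f X = Graph V
     ({{u, v} |u v. u \<in> L \<and> v \<in> L \<and> f u \<noteq> f v} \<union> {{u, v} |u v. u \<in> L \<and> v \<in> V - L} \<union> X)"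

definition extra_edge :: "'a set \<Rightarrow> nat \<Rightarrow> 'a set set \<Rightarrow> bool" where
  "extra_edge W b X \<longleftrightarrow> (b = 0 \<and> X = {}) \<or>
     (b = 1 \<and> (\<exists>p q. p \<noteq> q \<and> p \<in> W \<and> q \<in> W \<and> X = {{p, q}}))"

lemma core_graph_edges:
  assumes "L \<subseteq> V" "extra_edge (V - L) b X" "u \<in> V" "v \<in> V"
  shows "{u, v} \<in> edges (core_graph V L f X) \<longleftrightarrow>
    (u \<in> L \<and> v \<in> L \<and> f u \<noteq> f v) \<or> (u \<in> L \<and> v \<notin> L) \<or> (u \<notin> L \<and> v \<in> L) \<or> {u, v} \<in> X"
  using assms by (auto simp: core_graph_def doubleton_eq_iff)

lemma core_graph_verts [simp]: "verts (core_graph V L f X) = V"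
  by (simp add: core_graph_def)

lemma extra_edge_outside:
  assumes "extra_edge W b X" "{u, v} \<in> X"
  shows "u \<in> W \<and> v \<in> W \<and> u \<noteq> v"
  using assms by (auto simp: extra_edge_def doubleton_eq_iff)

lemma core_graph_simple:
  assumes "finite V" "L \<subseteq> V" "extra_edge (V - L) b X"
  shows "simple_graph (core_graph V L f X)"
  using assms by (auto simp: simple_graph_def core_graph_def extra_edge_def card_insert_if)

text \<open>The colours of a balanced \<open>f\<close> are permuted by \<open>p\<close> so that each
  class has the size of the residue class modulo \<open>r\<close> with the same number.\<close>

lemma is_target_core_graph:
  assumes V: "finite V" "card V = n" and L: "L \<subseteq> V" "card L = h" and r: "0 < r" and f: "balanced L r f"
    and X: "extra_edge (V - L) b X"
  shows "is_target b r h n (core_graph V L f X)"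
proof -
  have finL: "finite L" using V L finite_subset by blast
  have "balanced {..<h} r (\<lambda>i. i mod r)" by (rule balanced_mod[OF r])
  then obtain p where p: "inj_on p {..<r}" "p ` {..<r} = {..<r}"
    and pc: "\<And>j. j < r \<Longrightarrow> card {v \<in> L. p (f v) = j} = card {w \<in> {..<h}. w mod r = j}"
    using balanced_same_fibres[OF finL f finite_lessThan, of h "\<lambda>i. i mod r"] L by auto
  have fr: "v \<in> L \<Longrightarrow> f v < r" for v using f by (simp add: balanced_def)
  then have pr: "v \<in> L \<Longrightarrow> p (f v) < r" for v using p by blast
  have pf: "p (f u) = p (f v) \<longleftrightarrow> f u = f v" if "u \<in> L" "v \<in> L" for u v
    using p(1) fr that by (auto simp: inj_on_eq_iff)
  \<comment> \<open>For \<open>b = 0\<close> the points \<open>a\<close> and \<open>a'\<close> are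
    arbitrary, which is why \<open>c\<close> tests \<open>b = 1\<close> before using them.\<close>
  obtain a a' where aa: "b = 0 \<and> X = {} \<or> b = 1 \<and> a \<noteq> a' \<and> a \<in> V - L \<and> a' \<in> V - L \<and> X = {{a, a'}}"
    using X unfolding extra_edge_def by blast
  define c where "c = (\<lambda>v. if v \<in> L then p (f v) else if b = 1 \<and> v = a then r + 1
     else if b = 1 \<and> v = a' then r + 2 else r)"
  have "card {v \<in> V. c v = j} = class_size b r h n j" for j
  proof -
    consider "j < r" | "j = r" | "j = r + 1" | "j = r + 2" | "j > r + 2" by linarith
    then show ?thesis
    proof cases
      case 1
      then have "{v \<in> V. c v = j} = {v \<in> L. p (f v) = j}" using L by (auto simp: c_def)
      then show ?thesis using pc 1 by (simp add: class_size_def)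
    next
      case 2
      then have "{v \<in> V. c v = j} = V - L - (if b = 1 then {a, a'} else {})"
        using pr aa by (auto simp: c_def split: if_splits)
      moreover have "card (V - L) = n - h" using V L finL by (simp add: card_Diff_subset)
      ultimately show ?thesis using 2 aa V by (auto simp: class_size_def card_Diff_subset)
    next
      case 3
      then have "{v \<in> V. c v = j} = (if b = 1 then {a} else {})"
        using pr aa by (fastforce simp: c_def split: if_splits)
      then show ?thesis using 3 aa by (auto simp: class_size_def)
    next
      case 4
      then have "{v \<in> V. c v = j} = (if b = 1 then {a'} else {})"
        using pr aa by (fastforce simp: c_def split: if_splits)
      then show ?thesis using 4 aa by (auto simp: class_size_def)
    next
      case 5
      then have "{v \<in> V. c v = j} = {}"
        using pr by (fastforce simp: c_def split: if_splits)
      then show ?thesis by (simp only: card.empty) (use 5 in \<open>simp add: class_size_def\<close>)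
    qed
  qed
  moreover have "{u, v} \<in> edges (core_graph V L f X) \<longleftrightarrow> colour_adj r (c u) (c v)"
    if "u \<in> V" "v \<in> V" for u v
  proof -
    have "{u, v} \<in> X \<longleftrightarrow> u \<notin> L \<and> v \<notin> L \<and> c u \<noteq> c v \<and> r < c u \<and> r < c v"
      using aa by (auto simp: c_def doubleton_eq_iff split: if_splits)
    moreover have "r \<le> c u" if "u \<notin> L" for u using that by (simp add: c_def)
    moreover have "c u < r" if "u \<in> L" for u using that pr by (simp add: c_def)
    moreover have "c u = c v \<longleftrightarrow> f u = f v" if "u \<in> L" "v \<in> L" using pf that by (simp add: c_def)
    ultimately show ?thesis
      unfolding core_graph_edges[OF L(1) X that] colour_adj_def
      by (metis leD le_less_trans less_irrefl)
  qed
  ultimately show ?thesis unfolding is_target_def using V by auto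
qed

section \<open>Admissibility of the candidates\<close>

lemma clique_from_complete_subgraph:
  assumes "subgraph H G" "isomorphic (complete_graph m) H"
  obtains C where "C \<subseteq> verts G" "card C = m" "finite C"
    "\<And>u v. u \<in> C \<Longrightarrow> v \<in> C \<Longrightarrow> u \<noteq> v \<Longrightarrow> {u, v} \<in> edges G"
proof -
  from assms(2) obtain f where f: "bij_betw f {..<m} (verts H)"
    and e: "\<forall>u\<in>{..<m}. \<forall>v\<in>{..<m}. {u, v} \<in> edges (complete_graph m) \<longleftrightarrow> {f u, f v} \<in> edges H"
    unfolding isomorphic_def by (auto simp: complete_graph_def)
  show thesis
  proof (rule that[of "verts H"])
    show "verts H \<subseteq> verts G" "finite (verts H)" using assms by (auto simp: subgraph_def simple_graph_def)
    show "card (verts H) = m" using bij_betw_same_card[OF f] by simp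
    fix x y assume xy: "x \<in> verts H" "y \<in> verts H" "x \<noteq> y"
    then obtain u v where uv: "u < m" "v < m" "x = f u" "y = f v"
      using f unfolding bij_betw_def by blast
    then have "{u, v} \<in> edges (complete_graph m)" using xy by (auto simp: complete_graph_def)
    then have "{x, y} \<in> edges H" using e uv by blast
    then show "{x, y} \<in> edges G" using assms by (auto simp: subgraph_def)
  qed
qed

text \<open>Forests are excluded by counting edges that meet \<open>L\<close>. Without an extra
  edge, \<open>f\<close> on \<open>L\<close> and the colour \<open>r\<close> outside give a proper
  colouring with \<open>r + 1\<close> colours, so no clique has \<open>r + 2\<close> vertices. With
  an extra edge a clique has at most two vertices outside \<open>L\<close>, and
  \<open>card L < r\<close> finishes.\<close>

lemma core_graph_free:
  assumes V: "finite V" and L: "L \<subseteq> V" and f: "\<forall>v\<in>L. f v < r"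
    and X: "extra_edge (V - L) b X" and s: "2 * card L + b < s" and b: "b = 1 \<Longrightarrow> card L < r"
  shows "free_of ({complete_graph (r + 2)} \<union> linear_forests s) (core_graph V L f X)"
  unfolding free_of_def
proof
  let ?G = "core_graph V L f X"
  have finL: "finite L" using V L finite_subset by blast
  note E = core_graph_edges[OF L X, of _ _ f]
  fix F assume "F \<in> {complete_graph (r + 2)} \<union> linear_forests s"
  then consider "F = complete_graph (r + 2)" | "F \<in> linear_forests s" by blast
  then show "\<not> (\<exists>H. subgraph H ?G \<and> isomorphic F H)"
  proof cases
    case 1
    show ?thesis
    proof
      assume "\<exists>H. subgraph H ?G \<and> isomorphic F H"
      then obtain C where C: "C \<subseteq> V" "card C = r + 2" "finite C"
        and cl: "\<And>u v. u \<in> C \<Longrightarrow> v \<in> C \<Longrightarrow> u \<noteq> v \<Longrightarrow> {u, v} \<in> edges ?G"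
        unfolding 1 using clique_from_complete_subgraph[of _ ?G "r + 2"] by auto
      have CV: "u \<in> C \<Longrightarrow> u \<in> V" for u using C by blast
      show False
      proof (cases "b = 1")
        case False
        then have X0: "X = {}" using X by (simp add: extra_edge_def)
        let ?c = "\<lambda>v. if v \<in> L then f v else r"
        have "inj_on ?c C"
        proof (rule inj_onI)
          fix u v assume uv: "u \<in> C" "v \<in> C" "?c u = ?c v"
          have *: "f u < r" if "u \<in> L" for u using f that by blast
          show "u = v"
          proof (rule ccontr)
            assume "u \<noteq> v"
            with cl[OF uv(1,2)] E[OF CV CV, OF uv(1,2)] uv(3) *[of u] *[of v] X0
            show False by (auto split: if_splits)
          qed
        qed
        moreover have "?c ` C \<subseteq> {..r}" using f by (auto simp: less_imp_le)
        ultimately have "card C \<le> card {..r}" by (metis card_inj_on_le finite_atMost)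
        then show False using C by simp
      next
        case True
        then obtain p q where X1: "X = {{p, q}}" using X by (auto simp: extra_edge_def)
        have "C - L \<subseteq> {p, q}" if "2 \<le> card (C - L)"
        proof
          fix u assume u: "u \<in> C - L"
          have "card (C - L - {u}) \<noteq> 0" using that u C by (simp add: card_Diff_singleton)
          then obtain v where v: "v \<in> C - L" "v \<noteq> u" by (metis Diff_iff card.empty equals0I insertI1)
          then have "{u, v} \<in> X" using cl[of u v] E[of u v] u CV by auto
          then show "u \<in> {p, q}" using X1 by (auto simp: doubleton_eq_iff)
        qed
        then have "2 \<le> card (C - L) \<Longrightarrow> card (C - L) \<le> card {p, q}" by (intro card_mono) auto
        moreover have "card {p, q} \<le> 2" by (simp add: card_insert_if)
        ultimately have "card (C - L) \<le> 2" by linarith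
        moreover have "card C \<le> card (C \<inter> L) + card (C - L)"
          using card_Un_le[of "C \<inter> L" "C - L"] by (simp add: Int_Diff_Un)
        moreover have "card (C \<inter> L) \<le> card L" using finL by (intro card_mono) auto
        ultimately show False using b[OF True] C by linarith
      qed
    qed
  next
    case 2
    have "{e \<in> edges ?G. e \<inter> L = {}} \<subseteq> X" by (auto simp: core_graph_def)
    moreover have "finite X" "card X \<le> b" using X by (auto simp: extra_edge_def)
    ultimately have "card {e \<in> edges ?G. e \<inter> L = {}} \<le> b" using card_mono order_trans by meson
    from no_linear_forest[OF core_graph_simple[OF V L X] finL this s 2] show ?thesis .
  qed
qed

subsection \<open>Perron vectors of near-extremal graphs\<close>

lemma perron_vector_max_1:
  fixes G :: "'a::linorder graph"
  assumes "finite (verts G)" "verts G \<noteq> {}"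
  obtains x v where "\<And>u. 0 \<le> x u" "\<And>u. u \<in> verts G \<Longrightarrow> x u \<le> 1" "v \<in> verts G" "x v = 1"
    "\<And>u. u \<in> verts G \<Longrightarrow> (\<Sum>v\<in>verts G. adj G u v * x v) = graph_spectral_radius G * x u"
proof -
  obtain y where y: "\<And>u. 0 \<le> y u" "\<exists>u\<in>verts G. y u \<noteq> 0"
    "\<And>u. u \<in> verts G \<Longrightarrow> (\<Sum>v\<in>verts G. adj G u v * y v) = graph_spectral_radius G * y u"
    using graph_spectral_radius_perron[OF assms] by blast
  define c where "c = Max (y ` verts G)"
  have le: "y u \<le> c" if "u \<in> verts G" for u using that assms by (simp add: c_def)
  obtain w where w: "w \<in> verts G" "y w \<noteq> 0" using y by blast
  have c: "c > 0" using le[OF w(1)] y(1)[of w] w(2) by linarith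
  have "c \<in> y ` verts G" unfolding c_def using assms by (intro Max_in) auto
  then obtain v where v: "v \<in> verts G" "y v = c" by auto
  show thesis
  proof (rule that[of "\<lambda>u. y u / c" v])
    show "(\<Sum>v\<in>verts G. adj G u v * (y v / c)) = graph_spectral_radius G * (y u / c)" if "u \<in> verts G" for u
      using y(3)[OF that] by (simp flip: sum_divide_distrib)
  qed (use y c le v in auto)
qed

text \<open>The estimates come from expanding \<open>\<rho>\<^sup>2\<close> at a vertex with entry \<open>1\<close> as a weighted count of
  walks of length two; here \<open>L\<close> is the set of vertices of degree at least \<open>4 * h + 4\<close>.\<close>

lemma perron_vector_near_constant_on_core:
  fixes G :: "'a::linorder graph"
  assumes G: "simple_graph G" and n: "card (verts G) = n" and h: "1 \<le> h"
    and big: "36288 * (h + 1) ^ 8 \<le> n" and s: "s \<le> 2 * h + 2"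
    and free: "\<And>zs. distinct zs \<Longrightarrow> set zs \<subseteq> verts G \<Longrightarrow> links G zs < s"
    and rho0: "0 \<le> graph_spectral_radius G"
    and rho: "real h * (real n - real h) \<le> (graph_spectral_radius G)\<^sup>2"
  obtains L x \<delta> where "L \<subseteq> verts G" "card L = h" "\<And>u. 0 \<le> x u"
    "\<And>v. v \<in> L \<Longrightarrow> x v \<le> 1" "\<And>v. v \<in> L \<Longrightarrow> 1 - \<delta> \<le> x v"
    "0 \<le> \<delta>" "\<delta> * (real h)\<^sup>2 \<le> 1 / 8" "\<delta> \<le> 1 / 8" "real h < graph_spectral_radius G"
    "\<And>u. u \<in> verts G \<Longrightarrow> (\<Sum>v\<in>verts G. adj G u v * x v) = graph_spectral_radius G * x u"
    "(\<Sum>u\<in>verts G - L. \<Sum>v\<in>verts G - L. adj G u v * x v) \<le> 1 / 4"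
    "\<exists>u\<in>verts G - L. \<forall>v\<in>L. {u, v} \<in> edges G"
proof -
  define \<rho> where "\<rho> = graph_spectral_radius G"
  define V where "V = verts G"
  define L where "L = {v \<in> V. 4 * h + 4 \<le> card {w. {v, w} \<in> edges G}}"
  define W where "W = V - L"
  define m where "m = real h + 1"
  have fin: "finite V" "finite L" "finite W" using G by (auto simp: V_def L_def W_def simple_graph_def)
  have LW: "V = L \<union> W" "L \<inter> W = {}" by (auto simp: L_def W_def)
  have m2: "2 \<le> m" using h by (simp add: m_def)
  have m0: "0 < m" using m2 by linarith
  have mp: "1 \<le> m ^ j" for j using m2 by (intro one_le_power) simp
  have nbig: "36288 * m ^ 8 \<le> real n"
  proof -
    have "real (36288 * (h + 1) ^ 8) \<le> real n" using big by (simp only: of_nat_le_iff)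
    then show ?thesis by (simp add: m_def add.commute)
  qed
  have hm: "real h \<le> m" "real h = m - 1" by (auto simp: m_def)
  have cL: "card L \<le> h"
    unfolding L_def V_def by (rule few_vertices_of_large_degree[OF G free s])
  have Vne: "V \<noteq> {}" using nbig mp[of 8] n by (auto simp: V_def)
  have degW: "(\<Sum>w\<in>V. adj G u w) \<le> 4 * m" if "u \<in> W" for u
  proof -
    have "card {w. {u, w} \<in> edges G} \<le> 4 * h + 4" using that by (auto simp: W_def L_def)
    then have "real (card {w. {u, w} \<in> edges G}) \<le> real (4 * h + 4)" by (simp only: of_nat_le_iff)
    then show ?thesis unfolding V_def degree_eq_card[OF G] by (simp add: m_def)
  qed
  \<comment> \<open>Here \<open>s\<close> \<le> \<open>2 * m\<close> and degrees off the core are at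
    most \<open>4 * m\<close>; the product \<open>4 * (2 * m) * (4 * m)\<close> is the
    bound.\<close>
  have EW: "(\<Sum>u\<in>W. \<Sum>v\<in>W. adj G u v) \<le> 32 * m\<^sup>2"
  proof -
    have "(\<Sum>u\<in>W. \<Sum>v\<in>W. adj G u v) \<le> 4 * real s * (4 * m)"
      by (rule few_edges_if_small_degree[OF G _ free]) (use degW m2 in \<open>auto simp: W_def V_def\<close>)
    also have "\<dots> \<le> 4 * (2 * m) * (4 * m)"
      using s m2 by (intro mult_right_mono mult_left_mono) (auto simp: m_def)
    finally show ?thesis by (simp add: power2_eq_square)
  qed
  have rho_nn: "0 \<le> \<rho>" using rho0 by (simp add: \<rho>_def)
  have rho_sq: "real h * (real n - real h) \<le> \<rho>\<^sup>2" using rho by (simp add: \<rho>_def)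
  have n_ge_h: "real h + 1 \<le> real n"
  proof -
    have "m ^ 1 \<le> m ^ 8" using m2 by (intro power_increasing) auto
    then show ?thesis using nbig mp[of 8] by (simp add: m_def)
  qed
  \<comment> \<open>\<open>190 ^ 2 = 36100\<close>; the surplus \<open>188 * m ^ 8\<close> pays for
    the 1 lost in \<open>n - 1\<close> \<le> \<open>h * (n - h)\<close>, which is (h - 1)(n - h - 1)
    \<ge> 0 rearranged.\<close>
  have rho_big: "190 * m ^ 4 \<le> \<rho>"
  proof (rule power2_le_imp_le)
    have "(190 * m ^ 4)\<^sup>2 = 36100 * m ^ 8" by (simp add: power_mult_distrib flip: power_mult)
    also have "\<dots> \<le> 36288 * m ^ 8 - 1" using mp[of 8] by linarith
    also have "\<dots> \<le> real n - 1" using nbig by simp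
    also have "\<dots> \<le> real h * (real n - real h)"
    proof -
      have "0 \<le> (real h - 1) * (real n - real h - 1)" using h n_ge_h by (intro mult_nonneg_nonneg) auto
      then show ?thesis by (simp add: algebra_simps)
    qed
    finally show "(190 * m ^ 4)\<^sup>2 \<le> \<rho>\<^sup>2" using rho_sq by linarith
  qed (rule rho_nn)
  have pos: "0 < \<rho>" using rho_big mp[of 4] by linarith
  have m14: "m \<le> m ^ 4" using power_increasing[of 1 4 m] m2 by simp
  obtain x v0 where x0: "\<And>u. 0 \<le> x u" and x1: "\<And>u. u \<in> V \<Longrightarrow> x u \<le> 1" and v0: "v0 \<in> V" "x v0 = 1"
    and ev: "\<And>u. u \<in> V \<Longrightarrow> (\<Sum>v\<in>V. adj G u v * x v) = \<rho> * x u"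
    using perron_vector_max_1[of G] fin Vne unfolding V_def \<rho>_def by metis
  define S where "S = (\<Sum>v\<in>L. x v)"
  define sL where "sL = (\<lambda>u. \<Sum>v\<in>L. adj G u v * x v)"
  define rW where "rW = (\<lambda>u. \<Sum>v\<in>W. adj G u v * x v)"
  have ev2: "sL u + rW u = \<rho> * x u" if "u \<in> V" for u
    using ev[OF that] unfolding sL_def rW_def LW(1) sum.union_disjoint[OF fin(2,3) LW(2)] .
  have adj1: "adj G u v \<le> 1" for u v by (simp add: adj_def)
  have xL1: "x v \<le> 1" if "v \<in> L" for v using x1 that by (simp add: LW)
  have S_le: "S \<le> real (card L)"
    unfolding S_def using sum_mono[of L x "\<lambda>_. 1"] xL1 by simp
  have sL_le: "sL u \<le> S" for u
    unfolding sL_def S_def using x0 adj1 by (intro sum_mono) (simp add: mult_left_le_one_le adj_nonneg)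
  have Sh: "S \<le> real h" using S_le cL by linarith
  \<comment> \<open>At a vertex of \<open>W\<close> with the largest entry M the eigenvalue equation
    gives \<rho> M \<le> h + 4mM. Since 8mM \<le> \<rho> M, half of \<rho> M absorbs the last term,
    so \<rho> M \<le> 2m; dividing by \<open>190 * m ^ 4\<close> yields this \<mu>.\<close>
  define \<mu> where "\<mu> = 1 / (95 * m ^ 3)"
  have mu: "0 < \<mu>" "\<mu> < 1" using mp[of 3] m0 by (auto simp: \<mu>_def divide_less_eq)
  have xW: "x u \<le> \<mu>" if "u \<in> W" for u
  proof -
    define M where "M = Max (x ` W)"
    have MW: "x u \<le> M" if "u \<in> W" for u using that fin by (simp add: M_def)
    have "M \<in> x ` W" unfolding M_def using that fin by (intro Max_in) auto
    then obtain w where w: "w \<in> W" "x w = M" by auto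
    have M0: "0 \<le> M" using w x0[of w] by simp
    have "rW w \<le> (\<Sum>v\<in>W. adj G w v * M)"
      unfolding rW_def using MW by (intro sum_mono mult_left_mono) (auto simp: adj_nonneg)
    also have "\<dots> = (\<Sum>v\<in>W. adj G w v) * M" by (simp add: sum_distrib_right)
    also have "\<dots> \<le> (4 * m) * M"
    proof (rule mult_right_mono[OF _ M0])
      have "(\<Sum>v\<in>W. adj G w v) \<le> (\<Sum>v\<in>V. adj G w v)"
        using fin LW by (intro sum_mono2) (auto simp: adj_nonneg)
      then show "(\<Sum>v\<in>W. adj G w v) \<le> 4 * m" using degW[OF w(1)] by linarith
    qed
    finally have "\<rho> * M \<le> real h + 4 * m * M"
      using ev2[of w] w sL_le[of w] Sh LW by simp
    moreover have "8 * m * M \<le> \<rho> * M"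
      using rho_big m14 m2 M0 by (intro mult_right_mono) auto
    ultimately have "\<rho> * M \<le> 2 * m" using hm by linarith
    moreover have "190 * m ^ 4 * M \<le> \<rho> * M" using rho_big M0 by (rule mult_right_mono)
    ultimately have "190 * m ^ 4 * M \<le> 2 * m" by linarith
    then have "2 * m * (95 * m ^ 3 * M) \<le> 2 * m * 1" by (simp add: power_numeral_reduce algebra_simps)
    then have "95 * m ^ 3 * M \<le> 1" using m2 by (simp only: mult_le_cancel_left_pos)
    then have "M \<le> \<mu>" using m0 by (simp add: \<mu>_def field_simps)
    then show ?thesis using MW[OF that] by linarith
  qed
  have rsum: "(\<Sum>u\<in>W. rW u) \<le> 1 / 4"
  proof -
    have "(\<Sum>u\<in>W. rW u) \<le> (\<Sum>u\<in>W. \<Sum>v\<in>W. adj G u v * \<mu>)"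
      unfolding rW_def using xW by (intro sum_mono mult_left_mono) (auto simp: adj_nonneg)
    also have "\<dots> = (\<Sum>u\<in>W. \<Sum>v\<in>W. adj G u v) * \<mu>" by (simp add: sum_distrib_right)
    also have "\<dots> \<le> 32 * m\<^sup>2 * \<mu>" using EW mu by (intro mult_right_mono) auto
    also have "\<dots> = 32 / (95 * m)" using m2 by (simp add: \<mu>_def field_simps power2_eq_square power3_eq_cube)
    also have "\<dots> \<le> 1 / 4" using m2 by (simp add: field_simps)
    finally show ?thesis .
  qed
  have v0L: "v0 \<in> L" using xW[of v0] mu v0 LW by fastforce
  \<comment> \<open>The eigenvalue equation at \<open>v0\<close> is multiplied by \<rho> and
    expanded once more at the vertices of \<open>W\<close> only. The core neighbours of
    \<open>v0\<close> are bounded crudely by \<open>h\<close>, costing \<open>h\<close> times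
    \<rho>, which is of lower order than \<open>n\<close>.\<close>
  have rho_up: "\<rho>\<^sup>2 \<le> real h * \<rho> + (\<Sum>u\<in>W. sL u) + 1 / 4"
  proof -
    have "\<rho> = sL v0 + rW v0" using ev2[OF v0(1)] v0 by simp
    also have "\<dots> \<le> real h + (\<Sum>u\<in>W. x u)"
    proof -
      have "rW v0 \<le> (\<Sum>u\<in>W. x u)" unfolding rW_def using x0 adj1
        by (intro sum_mono) (simp add: mult_left_le_one_le adj_nonneg)
      then show ?thesis using sL_le[of v0] Sh by linarith
    qed
    finally have "\<rho> * \<rho> \<le> \<rho> * (real h + (\<Sum>u\<in>W. x u))" using pos by (intro mult_left_mono) auto
    also have "\<dots> = real h * \<rho> + (\<Sum>u\<in>W. \<rho> * x u)" by (simp add: algebra_simps sum_distrib_left)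
    also have "(\<Sum>u\<in>W. \<rho> * x u) = (\<Sum>u\<in>W. sL u + rW u)" using ev2 LW by (intro sum.cong) auto
    also have "\<dots> = (\<Sum>u\<in>W. sL u) + (\<Sum>u\<in>W. rW u)" by (rule sum.distrib)
    finally show ?thesis using rsum by (simp add: power2_eq_square)
  qed
  have cW: "real (card W) \<le> real n" using card_mono[of V W] fin n by (auto simp: V_def W_def)
  \<comment> \<open>All lower-order terms together are at most \<open>4 * n / (190 * m ^ 2)\<close>,
    and 4/190 < 1/47.\<close>
  define \<delta> where "\<delta> = 1 / (47 * m\<^sup>2)"
  have key: "(real h)\<^sup>2 + real h * \<rho> + 1 / 4 \<le> real n * \<delta>"
  proof -
    have "(\<Sum>u\<in>W. sL u) \<le> (\<Sum>u\<in>W. real h)" using sL_le Sh order_trans by (intro sum_mono) blast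
    also have "\<dots> = real (card W) * real h" by simp
    also have "\<dots> \<le> real n * real h" using cW by (intro mult_right_mono) auto
    finally have 1: "\<rho>\<^sup>2 \<le> real h * \<rho> + real n * real h + 1 / 4" using rho_up by linarith
    have "2 * real h \<le> \<rho>" using rho_big m14 hm m2 by linarith
    then have "2 * real h * \<rho> \<le> \<rho> * \<rho>" using pos by (intro mult_right_mono) auto
    then have "\<rho>\<^sup>2 \<le> 2 * (real n * real h) + 1 / 2" using 1 by (simp add: power2_eq_square)
    moreover have "1 \<le> real n * real h" using n_ge_h h mult_mono[of 1 "real n" 1 "real h"] by simp
    ultimately have 2: "\<rho>\<^sup>2 \<le> 3 * (real n * real h)" by linarith
    have "190 * m ^ 4 * \<rho> \<le> \<rho>\<^sup>2" using mult_right_mono[OF rho_big rho_nn] by (simp add: power2_eq_square)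
    also have "\<dots> \<le> 3 * (real n * m)" using 2 hm mult_left_mono[of "real h" m "real n"] by simp
    finally have "m * (190 * m ^ 3 * \<rho>) \<le> m * (3 * real n)" by (simp add: power_numeral_reduce algebra_simps)
    then have "190 * m ^ 3 * \<rho> \<le> 3 * real n" using m2 by (simp only: mult_le_cancel_left_pos)
    then have "190 * m\<^sup>2 * (m * \<rho>) \<le> 3 * real n" by (simp add: power_numeral_reduce algebra_simps)
    moreover have "real h * \<rho> \<le> m * \<rho>" using hm pos by (intro mult_right_mono) auto
    then have "190 * m\<^sup>2 * (real h * \<rho>) \<le> 190 * m\<^sup>2 * (m * \<rho>)" by (intro mult_left_mono) auto
    ultimately have 3: "190 * m\<^sup>2 * (real h * \<rho>) \<le> 3 * real n" by linarith
    have "(real h)\<^sup>2 + 1 / 4 \<le> 2 * m\<^sup>2" using power_mono[OF hm(1), of 2] mp[of 2] by linarith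
    then have "190 * m\<^sup>2 * ((real h)\<^sup>2 + 1 / 4) \<le> 190 * m\<^sup>2 * (2 * m\<^sup>2)" by (intro mult_left_mono) auto
    also have "\<dots> = 380 * m ^ 4" by (simp add: power_numeral_reduce)
    also have "\<dots> \<le> 36288 * m ^ 8"
    proof -
      have "m ^ 4 \<le> m ^ 8" using m2 by (intro power_increasing) auto
      then show ?thesis using mp[of 8] by linarith
    qed
    finally have "190 * m\<^sup>2 * ((real h)\<^sup>2 + 1 / 4) \<le> real n" using nbig by linarith
    with 3 have "190 * m\<^sup>2 * ((real h)\<^sup>2 + real h * \<rho> + 1 / 4) \<le> 4 * real n" by (simp add: algebra_simps)
    then have "(real h)\<^sup>2 + real h * \<rho> + 1 / 4 \<le> 4 * real n / (190 * m\<^sup>2)"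
      using m0 by (simp add: field_simps)
    also have "\<dots> \<le> real n * \<delta>" using m0 by (simp add: \<delta>_def field_simps)
    finally show ?thesis .
  qed
  have npos: "0 < real n" using n_ge_h by linarith
  have d0: "0 \<le> \<delta>" by (simp add: \<delta>_def)
  have "1 * 4 \<le> m\<^sup>2" using power_mono[OF m2, of 2] by simp
  then have d8: "\<delta> \<le> 1 / 8" using m0 by (simp add: \<delta>_def field_simps)
  have dh: "\<delta> * (real h)\<^sup>2 \<le> 1 / 8"
  proof -
    have "\<delta> * (real h)\<^sup>2 \<le> \<delta> * m\<^sup>2" using hm d0 by (intro mult_left_mono power_mono) auto
    also have "\<dots> \<le> 1 / 8" using m2 by (simp add: \<delta>_def)
    finally show ?thesis .
  qed
  \<comment> \<open>Upper and lower bounds on the square of \<rho> meet: the total core weight seen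
    from \<open>W\<close>, which could be at most about \<open>n * h\<close>, falls short by at most
    \<open>n\<close> times \<delta>. The size of \<open>L\<close>, its entries and a fully joined
    vertex are all read off from this.\<close>
  have low: "real n * real h \<le> real n * \<delta> + (\<Sum>u\<in>W. sL u)"
    using rho_sq rho_up key by (simp add: algebra_simps power2_eq_square)
  have S_ge: "real h - \<delta> \<le> S"
  proof -
    have "(\<Sum>u\<in>W. sL u) \<le> (\<Sum>u\<in>W. S)" using sL_le by (intro sum_mono)
    also have "\<dots> = real (card W) * S" by simp
    also have "\<dots> \<le> real n * S" using cW x0 by (intro mult_right_mono) (auto simp: S_def intro: sum_nonneg)
    finally have "real n * real h \<le> real n * (\<delta> + S)" using low by (simp add: algebra_simps)
    then have "real h \<le> \<delta> + S" using npos by (simp only: mult_le_cancel_left_pos)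
    then show ?thesis by linarith
  qed
  have cLh: "card L = h"
  proof -
    have "real h - 1 < real (card L)" using S_ge S_le d8 by linarith
    then show ?thesis using cL by linarith
  qed
  have xL: "1 - \<delta> \<le> x v" if v: "v \<in> L" for v
  proof -
    have "S = x v + (\<Sum>w\<in>L - {v}. x w)" unfolding S_def using v fin by (simp add: sum.remove)
    also have "(\<Sum>w\<in>L - {v}. x w) \<le> real (card (L - {v}))"
      using sum_mono[of "L - {v}" x "\<lambda>_. 1"] xL1 by simp
    also have "card (L - {v}) = h - 1" using v fin cLh by simp
    finally show ?thesis using S_ge h by (simp add: of_nat_diff)
  qed
  \<comment> \<open>If every vertex of \<open>W\<close> missed some core vertex, each would see core
    weight at most h - 1 + \<delta>, and \<open>low\<close> would give 1 \<le> 2\<delta>.\<close>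
  have full: "\<exists>u\<in>W. \<forall>v\<in>L. {u, v} \<in> edges G"
  proof (rule ccontr)
    assume no: "\<not> ?thesis"
    have "sL u \<le> real h - 1 + \<delta>" if u: "u \<in> W" for u
    proof -
      obtain v where v: "v \<in> L" "{u, v} \<notin> edges G" using no u by blast
      have "sL u = (\<Sum>w\<in>L - {v}. adj G u w * x w)" unfolding sL_def using v fin by (simp add: sum.remove adj_def)
      also have "\<dots> \<le> (\<Sum>w\<in>L - {v}. x w)"
        using x0 adj1 by (intro sum_mono) (simp add: mult_left_le_one_le adj_nonneg)
      also have "\<dots> = S - x v" unfolding S_def using v fin by (simp add: sum.remove)
      finally show ?thesis using xL[OF v(1)] Sh by linarith
    qed
    then have "(\<Sum>u\<in>W. sL u) \<le> (\<Sum>u\<in>W. real h - 1 + \<delta>)" by (intro sum_mono)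
    also have "\<dots> = real (card W) * (real h - 1 + \<delta>)" by simp
    also have "\<dots> \<le> real n * (real h - 1 + \<delta>)" using cW h d0 by (intro mult_right_mono) auto
    finally have "real n * real h \<le> real n * (\<delta> + (real h - 1 + \<delta>))" using low by (simp add: algebra_simps)
    then have "real h \<le> \<delta> + (real h - 1 + \<delta>)" using npos by (simp only: mult_le_cancel_left_pos)
    then show False using d8 by linarith
  qed
  have hrho: "real h < \<rho>" using rho_big m14 hm m2 by linarith
  show thesis
    by (rule that[of L x \<delta>])
      (use cLh x0 xL1 xL d0 dh d8 hrho ev rsum full in \<open>auto simp: L_def V_def W_def \<rho>_def rW_def\<close>)
qed

subsection \<open>Comparison with the extremal graphs\<close>

lemma sum_split_square:
  fixes p :: "'a \<Rightarrow> 'a \<Rightarrow> real"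
  assumes "finite V" "L \<subseteq> V"
  shows "(\<Sum>u\<in>V. \<Sum>v\<in>V. p u v) = (\<Sum>u\<in>L. \<Sum>v\<in>L. p u v) + (\<Sum>u\<in>L. \<Sum>v\<in>V - L. p u v)
    + ((\<Sum>u\<in>V - L. \<Sum>v\<in>L. p u v) + (\<Sum>u\<in>V - L. \<Sum>v\<in>V - L. p u v))"
proof -
  have split: "(\<Sum>u\<in>V. q u) = (\<Sum>u\<in>L. q u) + (\<Sum>u\<in>V - L. q u)" for q :: "'a \<Rightarrow> real"
    using sum.subset_diff[OF assms(2,1), of q] by simp
  show ?thesis unfolding split sum.distrib by simp
qed

text \<open>An inequality suffices: of the two ordered pairs belonging to the extra edge only one is
  counted, since any positive contribution decides the comparison.\<close>

lemma core_graph_quadratic_form: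
  fixes x :: "'a \<Rightarrow> real" and \<beta> :: real
  assumes V: "finite V" and L: "L \<subseteq> V" and X: "extra_edge (V - L) b X"
  defines "y \<equiv> \<lambda>u. if u \<in> L then x u else \<beta>"
  shows "(\<Sum>u\<in>L. \<Sum>v\<in>L. of_bool (f u \<noteq> f v) * x u * x v)
      + 2 * real (card (V - L)) * (\<Sum>u\<in>L. x u) * \<beta> + real b * \<beta>\<^sup>2
    \<le> (\<Sum>u\<in>V. \<Sum>v\<in>V. adj (core_graph V L f X) u v * y u * y v)"
proof -
  let ?a = "adj (core_graph V L f X)"
  note E = core_graph_edges[OF L X, of _ _ f]
  have Xo: "u \<notin> L \<and> v \<notin> L" if "{u, v} \<in> X" for u v using extra_edge_outside[OF X that] by blast
  have LL: "?a u v = of_bool (f u \<noteq> f v)" if "u \<in> L" "v \<in> L" for u v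
    using that E[of u v] L Xo[of u v] by (auto simp: adj_def)
  have LW: "?a u v = 1" "?a v u = 1" if "u \<in> L" "v \<in> V - L" for u v
    using that E[of u v] E[of v u] L by (auto simp: adj_def)
  have "(\<Sum>u\<in>L. \<Sum>v\<in>L. ?a u v * y u * y v) = (\<Sum>u\<in>L. \<Sum>v\<in>L. of_bool (f u \<noteq> f v) * x u * x v)"
    by (intro sum.cong refl) (simp add: LL y_def)
  moreover have "(\<Sum>u\<in>L. \<Sum>v\<in>V - L. ?a u v * y u * y v) = (\<Sum>u\<in>L. \<Sum>v\<in>V - L. x u * \<beta>)"
    by (intro sum.cong refl) (simp add: LW y_def)
  moreover have "(\<Sum>u\<in>V - L. \<Sum>v\<in>L. ?a u v * y u * y v) = (\<Sum>u\<in>V - L. \<Sum>v\<in>L. x v * \<beta>)"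
    by (intro sum.cong refl) (simp add: LW y_def)
  moreover have "real b * \<beta>\<^sup>2 \<le> (\<Sum>u\<in>V - L. \<Sum>v\<in>V - L. ?a u v * y u * y v)"
  proof -
    have *: "(\<Sum>u\<in>V - L. \<Sum>v\<in>V - L. ?a u v * y u * y v) = (\<Sum>u\<in>V - L. \<Sum>v\<in>V - L. ?a u v * \<beta>\<^sup>2)"
      by (intro sum.cong refl) (simp add: y_def power2_eq_square)
    have nn: "0 \<le> ?a u v * \<beta>\<^sup>2" for u v by (simp add: adj_nonneg)
    show ?thesis
    proof (cases "b = 0")
      case True
      then show ?thesis unfolding * using nn by (simp add: sum_nonneg)
    next
      case False
      then obtain p q where pq: "b = 1" "p \<in> V - L" "q \<in> V - L" "{p, q} \<in> X"
        using X by (auto simp: extra_edge_def)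
      then have "?a p q = 1" using E[of p q] by (simp add: adj_def)
      then have "real b * \<beta>\<^sup>2 = ?a p q * \<beta>\<^sup>2" using pq by simp
      also have "\<dots> \<le> (\<Sum>v\<in>V - L. ?a p v * \<beta>\<^sup>2)" using pq V nn by (intro member_le_sum) auto
      also have "\<dots> \<le> (\<Sum>u\<in>V - L. \<Sum>v\<in>V - L. ?a u v * \<beta>\<^sup>2)"
        using pq V nn by (intro member_le_sum[of p "V - L" "\<lambda>u. \<Sum>v\<in>V - L. ?a u v * \<beta>\<^sup>2"]) (auto intro: sum_nonneg)
      finally show ?thesis unfolding * .
    qed
  qed
  ultimately show ?thesis
    unfolding sum_split_square[OF V L] by (simp flip: sum_distrib_left sum_distrib_right)
qed

text \<open>The candidate contains the complete bipartite graph between \<open>L\<close> and its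
  complement. The test vector is the Perron vector of that graph; further edges only increase the
  form.\<close>

lemma core_graph_spectral_radius_ge:
  fixes V :: "'a::linorder set"
  assumes V: "finite V" and L: "L \<subseteq> V" "L \<noteq> {}" "L \<noteq> V" and X: "extra_edge (V - L) b X"
  shows "sqrt (real (card L) * real (card (V - L))) \<le> graph_spectral_radius (core_graph V L f X)"
proof -
  define h where "h = real (card L)"
  define w where "w = real (card (V - L))"
  have pos: "0 < h" "0 < w" using V L by (auto simp: h_def w_def card_gt_0_iff finite_subset)
  let ?y = "\<lambda>u. if u \<in> L then sqrt w else sqrt h"
  let ?\<rho> = "graph_spectral_radius (core_graph V L f X)"
  have "2 * h * w * sqrt (h * w) = 2 * w * (\<Sum>u\<in>L. sqrt w) * sqrt h"
    by (simp add: h_def real_sqrt_mult)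
  also have "\<dots> \<le> (\<Sum>u\<in>L. \<Sum>v\<in>L. of_bool (f u \<noteq> f v) * sqrt w * sqrt w)
      + 2 * w * (\<Sum>u\<in>L. sqrt w) * sqrt h + real b * (sqrt h)\<^sup>2"
    using pos by (simp add: sum_nonneg)
  also have "\<dots> \<le> (\<Sum>u\<in>V. \<Sum>v\<in>V. adj (core_graph V L f X) u v * ?y u * ?y v)"
    using core_graph_quadratic_form[OF V L(1) X, of f "\<lambda>_. sqrt w" "sqrt h"] by (simp add: w_def)
  also have "\<dots> \<le> ?\<rho> * (\<Sum>u\<in>V. (?y u)\<^sup>2)"
    using graph_spectral_radius_rayleigh[of "core_graph V L f X" ?y] V L by auto
  also have "(\<Sum>u\<in>V. (?y u)\<^sup>2) = (\<Sum>u\<in>L. w) + (\<Sum>u\<in>V - L. h)"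
  proof -
    have "(\<Sum>u\<in>V. (?y u)\<^sup>2) = (\<Sum>u\<in>V - L. (?y u)\<^sup>2) + (\<Sum>u\<in>L. (?y u)\<^sup>2)"
      by (rule sum.subset_diff[OF L(1) V])
    also have "(\<Sum>u\<in>V - L. (?y u)\<^sup>2) = (\<Sum>u\<in>V - L. h)" using pos by (intro sum.cong) auto
    also have "(\<Sum>u\<in>L. (?y u)\<^sup>2) = (\<Sum>u\<in>L. w)" using pos by (intro sum.cong) auto
    finally show ?thesis by simp
  qed
  also have "\<dots> = 2 * h * w" by (simp add: h_def w_def)
  finally have "(2 * h * w) * sqrt (h * w) \<le> (2 * h * w) * ?\<rho>" by (simp add: mult.commute)
  then show ?thesis using pos unfolding h_def[symmetric] w_def[symmetric]
    by (simp only: mult_le_cancel_left_pos mult_pos_pos zero_less_numeral)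
qed

text \<open>The test vector agrees with the Perron vector on \<open>L\<close> and equals \<open>S / \<rho>\<close> elsewhere, which is
  the value the eigenvalue equation would give at a vertex whose neighbourhood is exactly \<open>L\<close>.\<close>

lemma core_graph_spectral_gap:
  fixes G :: "'a::linorder graph"
  assumes G: "simple_graph G" and ne: "verts G \<noteq> {}" and L: "L \<subseteq> verts G"
    and pos: "0 < graph_spectral_radius G"
    and ev: "\<And>u. u \<in> verts G \<Longrightarrow> (\<Sum>v\<in>verts G. adj G u v * x v) = graph_spectral_radius G * x u"
    and X: "extra_edge (verts G - L) b X"
  defines "\<rho> \<equiv> graph_spectral_radius G" and "S \<equiv> \<Sum>v\<in>L. x v"
    and "sL \<equiv> \<lambda>u. \<Sum>v\<in>L. adj G u v * x v" and "rW \<equiv> \<lambda>u. \<Sum>v\<in>verts G - L. adj G u v * x v"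
  assumes gap: "0 < (\<Sum>u\<in>L. \<Sum>v\<in>L. (of_bool (f u \<noteq> f v) - adj G u v) * x u * x v)
     + (\<Sum>u\<in>verts G - L. S\<^sup>2 - (sL u)\<^sup>2 - sL u * rW u) / \<rho> + real b * (S / \<rho>)\<^sup>2"
  shows "\<rho> < graph_spectral_radius (core_graph (verts G) L f X)"
proof -
  define V where "V = verts G"
  define W where "W = V - L"
  define \<beta> where "\<beta> = S / \<rho>"
  have V: "finite V" using G by (simp add: V_def simple_graph_def)
  have LV: "L \<subseteq> V" using L by (simp add: V_def)
  have X': "extra_edge (V - L) b X" using X by (simp add: V_def)
  have rp: "\<rho> > 0" using pos by (simp add: \<rho>_def)
  let ?y = "\<lambda>u. if u \<in> L then x u else \<beta>"
  let ?T = "\<Sum>u\<in>L. \<Sum>v\<in>L. of_bool (f u \<noteq> f v) * x u * x v"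
  let ?A = "\<Sum>u\<in>L. \<Sum>v\<in>L. adj G u v * x u * x v"
  have ev2: "sL u + rW u = \<rho> * x u" if "u \<in> V" for u
    using ev[of u] that sum.subset_diff[OF L, of "\<lambda>v. adj G u v * x v"] V
    by (simp add: sL_def rW_def \<rho>_def V_def)
  have N: "(\<Sum>u\<in>V. (?y u)\<^sup>2) = (\<Sum>u\<in>L. (x u)\<^sup>2) + real (card W) * \<beta>\<^sup>2"
  proof -
    have "(\<Sum>u\<in>V. (?y u)\<^sup>2) = (\<Sum>u\<in>V - L. (?y u)\<^sup>2) + (\<Sum>u\<in>L. (?y u)\<^sup>2)"
      by (rule sum.subset_diff[OF LV V])
    also have "(\<Sum>u\<in>V - L. (?y u)\<^sup>2) = (\<Sum>u\<in>V - L. \<beta>\<^sup>2)" by (intro sum.cong) auto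
    also have "(\<Sum>u\<in>L. (?y u)\<^sup>2) = (\<Sum>u\<in>L. (x u)\<^sup>2)" by (intro sum.cong) auto
    finally show ?thesis by (simp add: W_def)
  qed
  have "\<rho> * (\<Sum>u\<in>L. (x u)\<^sup>2) = (\<Sum>u\<in>L. x u * (sL u + rW u))"
    unfolding sum_distrib_left using LV by (intro sum.cong refl) (auto simp: ev2 power2_eq_square)
  also have "\<dots> = (\<Sum>u\<in>L. x u * sL u) + (\<Sum>u\<in>L. x u * rW u)" by (simp add: distrib_left sum.distrib)
  also have "(\<Sum>u\<in>L. x u * sL u) = ?A" by (simp add: sL_def sum_distrib_left mult_ac)
  also have "(\<Sum>u\<in>L. x u * rW u) = (\<Sum>u\<in>L. \<Sum>v\<in>W. adj G u v * x u * x v)"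
    by (simp add: rW_def sum_distrib_left mult_ac W_def V_def)
  also have "\<dots> = (\<Sum>v\<in>W. \<Sum>u\<in>L. adj G v u * x u * x v)"
    by (subst sum.swap) (simp add: adj_sym)
  also have "\<dots> = (\<Sum>v\<in>W. x v * sL v)" by (simp add: sL_def sum_distrib_left mult_ac)
  finally have NL: "\<rho> * (\<Sum>u\<in>L. (x u)\<^sup>2) = ?A + (\<Sum>v\<in>W. x v * sL v)" .
  \<comment> \<open>The old entries outside \<open>L\<close> are eliminated through the eigenvalue
    equation, leaving only quantities that appear in \<open>gap\<close>.\<close>
  have xs: "(\<Sum>v\<in>W. x v * sL v) = (\<Sum>v\<in>W. (sL v)\<^sup>2 + sL v * rW v) / \<rho>"
  proof -
    have "x v = (sL v + rW v) / \<rho>" if "v \<in> W" for v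
      using that ev2[of v] rp by (simp add: W_def field_simps)
    then have "(\<Sum>v\<in>W. x v * sL v) = (\<Sum>v\<in>W. ((sL v)\<^sup>2 + sL v * rW v) / \<rho>)"
      by (intro sum.cong refl) (simp add: power2_eq_square algebra_simps add_divide_distrib)
    then show ?thesis by (simp only: sum_divide_distrib)
  qed
  have TA: "(\<Sum>u\<in>L. \<Sum>v\<in>L. (of_bool (f u \<noteq> f v) - adj G u v) * x u * x v) = ?T - ?A"
    by (simp add: left_diff_distrib sum_subtractf)
  have YS: "(\<Sum>u\<in>verts G - L. S\<^sup>2 - (sL u)\<^sup>2 - sL u * rW u)
      = real (card W) * S\<^sup>2 - (\<Sum>v\<in>W. (sL v)\<^sup>2 + sL v * rW v)"
    by (simp add: W_def V_def sum_subtractf sum.distrib)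
  \<comment> \<open>The choice of \<beta> balances the two contributions: the edges between
    \<open>L\<close> and \<open>W\<close> give twice c = \<open>card W\<close> times S^2 / \<rho>,
    the norm outside \<open>L\<close> costs c once, and the remaining c is set against what
    \<open>G\<close> had between \<open>L\<close> and \<open>W\<close>.\<close>
  have bS: "\<rho> * (real (card W) * \<beta>\<^sup>2) = real (card W) * S\<^sup>2 / \<rho>"
    "2 * real (card W) * S * \<beta> = 2 * (real (card W) * S\<^sup>2 / \<rho>)"
    using rp by (auto simp: \<beta>_def power2_eq_square field_simps)
  have rearrange: "0 < t - a + (c - d) + e \<Longrightarrow> a + d + c < t + 2 * c + e" for t a c d e :: real
    by linarith
  have "\<rho> * (\<Sum>u\<in>V. (?y u)\<^sup>2) < ?T + 2 * real (card W) * S * \<beta> + real b * \<beta>\<^sup>2"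
    unfolding N distrib_left NL xs bS
    by (rule rearrange) (use gap in \<open>simp only: TA YS \<beta>_def diff_divide_distrib\<close>)
  also have "\<dots> \<le> (\<Sum>u\<in>V. \<Sum>v\<in>V. adj (core_graph V L f X) u v * ?y u * ?y v)"
    using core_graph_quadratic_form[OF V LV X', of f x \<beta>] by (simp add: W_def S_def)
  also have "\<dots> \<le> graph_spectral_radius (core_graph V L f X) * (\<Sum>u\<in>V. (?y u)\<^sup>2)"
    using graph_spectral_radius_rayleigh[of "core_graph V L f X" ?y] V ne by (auto simp: V_def)
  finally have "\<rho> * (\<Sum>u\<in>V. (?y u)\<^sup>2) < graph_spectral_radius (core_graph V L f X) * (\<Sum>u\<in>V. (?y u)\<^sup>2)" .
  moreover have "0 \<le> (\<Sum>u\<in>V. (?y u)\<^sup>2)" by (intro sum_nonneg) auto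
  ultimately show ?thesis unfolding V_def[symmetric] by (rule mult_right_less_imp_less)
qed

lemma ex_balanced:
  assumes "finite L" "0 < r"
  shows "\<exists>g. balanced L r g"
proof -
  obtain p where p: "bij_betw p L {..<card L}"
    using assms by (metis bij_betw_iff_card card_lessThan finite_lessThan)
  have "card {v \<in> L. p v mod r = j} = card {i \<in> {..<card L}. i mod r = j}" for j
  proof (rule bij_betw_same_card)
    have "bij_betw p {v \<in> L. p v mod r = j} (p ` {v \<in> L. p v mod r = j})"
      using p by (intro inj_on_imp_bij_betw) (auto simp: bij_betw_def intro: inj_on_subset)
    moreover have "p ` {v \<in> L. p v mod r = j} = {i \<in> {..<card L}. i mod r = j}"
      using p by (auto simp: bij_betw_def)
    ultimately show "bij_betw p {v \<in> L. p v mod r = j} {i \<in> {..<card L}. i mod r = j}" by simp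
  qed
  then have "balanced L r (\<lambda>v. p v mod r)"
    using balanced_mod[OF assms(2), of "card L"] assms by (simp add: balanced_def)
  then show ?thesis by blast
qed

lemma ex_extra_edge:
  assumes "2 \<le> card W" "b \<le> 1"
  shows "\<exists>X. extra_edge W b X"
proof -
  obtain W2 where "W2 \<subseteq> W" "card W2 = 2" using assms by (meson obtain_subset_with_card_n)
  then obtain p q where "p \<noteq> q" "p \<in> W" "q \<in> W" by (auto simp: card_2_iff)
  then show ?thesis using assms(2) by (cases "b = 0") (auto simp: extra_edge_def)
qed

subsection \<open>Existence and uniqueness of extremal graphs\<close>

text \<open>The Perron vector of \<open>G\<close>, carried along the isomorphism, is a test vector
  for \<open>H\<close>. This avoids comparing matrices whose rows are ordered by unrelated linear
  orders.\<close>

lemma isomorphic_spectral_radius_le: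
  fixes G :: "'a::linorder graph" and H :: "'b::linorder graph"
  assumes iso: "isomorphic G H" and G: "simple_graph G" "verts G \<noteq> {}" and H: "simple_graph H"
  shows "graph_spectral_radius G \<le> graph_spectral_radius H"
proof -
  from iso obtain f where f: "bij_betw f (verts G) (verts H)"
    and e: "\<forall>u\<in>verts G. \<forall>v\<in>verts G. {u, v} \<in> edges G \<longleftrightarrow> {f u, f v} \<in> edges H"
    unfolding isomorphic_def by blast
  have fin: "finite (verts G)" "finite (verts H)" using G H by (auto simp: simple_graph_def)
  have neH: "verts H \<noteq> {}" using f G by (auto simp: bij_betw_def)
  obtain x where x: "\<exists>u\<in>verts G. x u \<noteq> 0"
    and ev: "\<And>u. u \<in> verts G \<Longrightarrow> (\<Sum>v\<in>verts G. adj G u v * x v) = graph_spectral_radius G * x u"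
    using graph_spectral_radius_perron[OF fin(1) G(2)] by metis
  define y where "y = (\<lambda>w. x (inv_into (verts G) f w))"
  have y: "y (f u) = x u" if "u \<in> verts G" for u
    using that f by (simp add: y_def bij_betw_inv_into_left)
  have reidx: "(\<Sum>w\<in>verts H. q w) = (\<Sum>u\<in>verts G. q (f u))" for q :: "'b \<Rightarrow> real"
    by (rule sum.reindex_bij_betw[OF f, symmetric])
  have "(\<Sum>u\<in>verts H. \<Sum>v\<in>verts H. adj H u v * y u * y v)
      = (\<Sum>u\<in>verts G. x u * (\<Sum>v\<in>verts G. adj G u v * x v))"
    unfolding reidx sum_distrib_left using e by (intro sum.cong refl) (simp add: y adj_def)
  also have "\<dots> = (\<Sum>u\<in>verts G. x u * (graph_spectral_radius G * x u))"
    by (intro sum.cong refl) (simp add: ev)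
  also have "\<dots> = graph_spectral_radius G * (\<Sum>u\<in>verts G. (x u)\<^sup>2)"
    by (simp add: sum_distrib_left power2_eq_square mult_ac)
  finally have "graph_spectral_radius G * (\<Sum>u\<in>verts G. (x u)\<^sup>2)
      \<le> graph_spectral_radius H * (\<Sum>u\<in>verts H. (y u)\<^sup>2)"
    using graph_spectral_radius_rayleigh[OF fin(2) neH, of y] by simp
  also have "(\<Sum>u\<in>verts H. (y u)\<^sup>2) = (\<Sum>u\<in>verts G. (x u)\<^sup>2)"
    unfolding reidx by (intro sum.cong refl) (simp add: y)
  finally have *: "graph_spectral_radius G * (\<Sum>u\<in>verts G. (x u)\<^sup>2)
      \<le> graph_spectral_radius H * (\<Sum>u\<in>verts G. (x u)\<^sup>2)" .
  obtain u where u: "u \<in> verts G" "x u \<noteq> 0" using x by blast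
  have "0 < (\<Sum>u\<in>verts G. (x u)\<^sup>2)"
    using u fin by (intro sum_pos2[of _ u]) auto
  with * show ?thesis by simp
qed

text \<open>A vertex type such as \<open>nat\<close> carries infinitely many graphs of order
  \<open>n\<close>, but only finitely many 0/1 matrices, so the spectral radii take finitely many
  values and a maximum exists.\<close>

lemma finite_adjacency_matrices:
  "finite (adjacency_matrix ` {G :: 'a::linorder graph. card (verts G) = n})"
proof (rule finite_subset)
  let ?m = "\<lambda>P. mat n n (\<lambda>ij. if ij \<in> P then 1 else 0 :: real)"
  show "finite (?m ` Pow ({..<n} \<times> {..<n}))" by simp
  show "adjacency_matrix ` {G :: 'a graph. card (verts G) = n} \<subseteq> ?m ` Pow ({..<n} \<times> {..<n})"
  proof
    fix A assume "A \<in> adjacency_matrix ` {G :: 'a graph. card (verts G) = n}"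
    then obtain G :: "'a graph" where G: "A = adjacency_matrix G" "card (verts G) = n" by blast
    define vs where "vs = sorted_list_of_set (verts G)"
    have "A = ?m {(i, j). i < n \<and> j < n \<and> {vs ! i, vs ! j} \<in> edges G}"
      by (rule eq_matI) (auto simp: G adjacency_matrix_def Let_def vs_def)
    then show "A \<in> ?m ` Pow ({..<n} \<times> {..<n})" by blast
  qed
qed

lemma Ex_sp_nonempty:
  fixes G :: "'a::linorder graph"
  assumes "simple_graph G" "card (verts G) = n" "free_of \<F> G"
  shows "(Ex_sp n \<F> :: 'a graph set) \<noteq> {}"
proof -
  define A where "A = {G :: 'a graph. simple_graph G \<and> card (verts G) = n \<and> free_of \<F> G}"
  have "graph_spectral_radius ` A \<subseteq> (\<lambda>M. Max (spectrum M)) ` adjacency_matrix ` {G :: 'a graph. card (verts G) = n}"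
    by (auto simp: graph_spectral_radius_def A_def)
  then have fin: "finite (graph_spectral_radius ` A)"
    using finite_adjacency_matrices finite_subset by blast
  have "graph_spectral_radius ` A \<noteq> {}" using assms by (auto simp: A_def)
  from Max_in[OF fin this] obtain G0 where G0: "G0 \<in> A" "graph_spectral_radius G0 = Max (graph_spectral_radius ` A)"
    by (metis imageE)
  have "graph_spectral_radius H \<le> graph_spectral_radius G0" if "H \<in> A" for H
    unfolding G0(2) using that fin by simp
  then have "G0 \<in> Ex_sp n \<F>" using G0(1) by (simp add: Ex_sp_def A_def)
  then show ?thesis by blast
qed

text \<open>All edges meeting \<open>L\<close> are prescribed, so only the edges avoiding
  \<open>L\<close> are open: there is at most one, and \<open>nz\<close> supplies it if
  \<open>b = 1\<close>. It cannot occur when \<open>h\<close> \<ge> \<open>r\<close>, since then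
  every colour is used in \<open>L\<close> and one vertex per colour together with the two endpoints
  is a clique on \<open>r + 2\<close> vertices.\<close>

lemma is_target_if_joined:
  assumes G: "simple_graph G" and n: "card (verts G) = n" and L: "L \<subseteq> verts G" "card L = h"
    and r: "0 < r" and f: "balanced L r f"
    and inside: "\<And>u v. u \<in> L \<Longrightarrow> v \<in> L \<Longrightarrow> {u, v} \<in> edges G \<longleftrightarrow> f u \<noteq> f v"
    and join: "\<And>u v. u \<in> L \<Longrightarrow> v \<in> verts G - L \<Longrightarrow> {u, v} \<in> edges G"
    and free: "\<And>zs. distinct zs \<Longrightarrow> set zs \<subseteq> verts G \<Longrightarrow> links G zs < s"
    and clique: "\<And>C. C \<subseteq> verts G \<Longrightarrow> (\<And>u v. u \<in> C \<Longrightarrow> v \<in> C \<Longrightarrow> u \<noteq> v \<Longrightarrow> {u, v} \<in> edges G) \<Longrightarrow> card C \<le> r + 1"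
    and s: "s = 2 * h + 1 \<or> s = 2 * h + 2" and b: "b = (if s = 2 * h + 2 \<and> h < r then 1 else 0)"
    and big: "3 * h + 5 < n"
    and nz: "b = 1 \<Longrightarrow> \<exists>e\<in>edges G. e \<inter> L = {}"
  shows "is_target b r h n G"
proof -
  define X where "X = {e \<in> edges G. e \<inter> L = {}}"
  have fin: "finite (verts G)" "finite L" using G L by (auto simp: simple_graph_def intro: finite_subset)
  have big': "2 * card L + 5 < card (verts G - L)"
    using big n L fin by (simp add: card_Diff_subset)
  note out = edges_outside_joined_vertices[OF G L(1) join free big']
  have pair: "\<exists>u v. e = {u, v} \<and> u \<noteq> v \<and> u \<in> verts G \<and> v \<in> verts G" if "e \<in> edges G" for e
  proof -
    have "e \<subseteq> verts G" "card e = 2" using that G by (auto simp: simple_graph_def)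
    then show ?thesis by (auto simp: card_2_iff)
  qed
  have X: "extra_edge (verts G - L) b X"
  proof (cases "X = {}")
    case True
    then have "b \<noteq> 1" using nz by (auto simp: X_def)
    then show ?thesis using True b by (auto simp: extra_edge_def split: if_splits)
  next
    case False
    then have s': "s = 2 * h + 2" using out(1) s L by (auto simp: X_def)
    obtain e where e: "e \<in> X" using False by blast
    then obtain p q where pq: "e = {p, q}" "p \<noteq> q" "p \<in> verts G - L" "q \<in> verts G - L"
      using pair[of e] by (auto simp: X_def)
    have X1: "X = {{p, q}}" using out(2)[of e] e pq s' L by (auto simp: X_def)
    have "h < r"
    proof (rule ccontr)
      assume "\<not> h < r"
      have "\<exists>v\<in>L. f v = j" if "j < r" for j
      proof -
        have "1 \<le> h div r" using \<open>\<not> h < r\<close> r by (simp add: Suc_le_eq div_greater_zero_iff)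
        moreover have "card {v \<in> L. f v = j} \<in> {h div r, Suc (h div r)}" using f that L by (simp add: balanced_def)
        ultimately have "card {v \<in> L. f v = j} \<noteq> 0" by auto
        then show ?thesis by (metis (mono_tags, lifting) card.empty empty_Collect_eq)
      qed
      then obtain c where c: "\<And>j. j < r \<Longrightarrow> c j \<in> L \<and> f (c j) = j" by metis
      define C where "C = insert p (insert q (c ` {..<r}))"
      have cL: "c ` {..<r} \<subseteq> L" using c by blast
      have inj: "inj_on c {..<r}" using c by (metis inj_onI lessThan_iff)
      have "card C = r + 2"
        using pq cL inj by (auto simp: C_def card_insert_if card_image)
      moreover have "card C \<le> r + 1"
      proof (rule clique)
        show "C \<subseteq> verts G" using pq cL L by (auto simp: C_def)
        have pqE: "{p, q} \<in> edges G" using e pq by (simp add: X_def)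
        have cp: "{c i, p} \<in> edges G" "{c i, q} \<in> edges G" if "i < r" for i
          using join[of "c i"] c[OF that] pq by auto
        have cc: "{c i, c j} \<in> edges G" if "i < r" "j < r" "c i \<noteq> c j" for i j
          using inside[of "c i" "c j"] c[OF that(1)] c[OF that(2)] that by auto
        show "{u, v} \<in> edges G" if "u \<in> C" "v \<in> C" "u \<noteq> v" for u v
          using that pqE cp cc by (auto simp: C_def insert_commute)
      qed
      ultimately show False by simp
    qed
    then show ?thesis using s' b pq X1 by (auto simp: extra_edge_def)
  qed
  have "edges G = edges (core_graph (verts G) L f X)"
  proof (rule Set.set_eqI)
    fix e
    have ext: "{u, v} \<in> edges G \<longleftrightarrow> {u, v} \<in> edges (core_graph (verts G) L f X)"
      if "u \<in> verts G" "v \<in> verts G" for u v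
      unfolding core_graph_edges[OF L(1) X that] using that inside[of u v] join[of u v] join[of v u] extra_edge_outside[OF X, of u v]
      by (auto simp: X_def insert_commute)
    have pair': "\<exists>u v. e = {u, v} \<and> u \<in> verts G \<and> v \<in> verts G" if "e \<in> edges (core_graph (verts G) L f X)"
    proof -
      have "e \<subseteq> verts G" "card e = 2"
        using core_graph_simple[OF fin(1) L(1) X, of f] that by (auto simp: simple_graph_def)
      then show ?thesis by (auto simp: card_2_iff)
    qed
    show "e \<in> edges G \<longleftrightarrow> e \<in> edges (core_graph (verts G) L f X)"
      using pair[of e] pair' ext by blast
  qed
  then have "G = core_graph (verts G) L f X" by (intro graph.expand) simp
  then show ?thesis using is_target_core_graph[OF fin(1) n L r f X] by simp
qed

lemma extremal_is_target:
  fixes G :: "'a::linorder graph"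
  assumes r: "0 < r" and s: "s = 2 * h + 1 \<or> s = 2 * h + 2" "2 \<le> s"
    and b: "b = (if s = 2 * h + 2 \<and> h < r then 1 else 0)"
    and big: "36288 * (h + 1) ^ 8 \<le> n"
    and ext: "G \<in> Ex_sp n ({complete_graph (r + 2)} \<union> linear_forests s)"
  shows "is_target b r h n G"
proof -
  define V where "V = verts G"
  define \<rho> where "\<rho> = graph_spectral_radius G"
  let ?\<F> = "{complete_graph (r + 2)} \<union> linear_forests s"
  have G: "simple_graph G" and n: "card V = n" and fr: "free_of ?\<F> G"
    and max: "\<And>H :: 'a graph. simple_graph H \<Longrightarrow> card (verts H) = n \<Longrightarrow> free_of ?\<F> H \<Longrightarrow> graph_spectral_radius H \<le> \<rho>"
    using ext by (auto simp: Ex_sp_def V_def \<rho>_def)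
  have fin: "finite V" using G by (simp add: V_def simple_graph_def)
  have nh: "36288 * (h + 1) \<le> n"
  proof -
    have "(h + 1) ^ 1 \<le> (h + 1) ^ 8" by (intro power_increasing) auto
    then show ?thesis using big by simp
  qed
  have Vne: "V \<noteq> {}" using nh n by auto
  have free: "links G zs < s" if "distinct zs" "set zs \<subseteq> verts G" for zs
  proof (rule ccontr)
    assume "\<not> links G zs < s"
    then show False using linear_forest_in_graph[OF G that, of s] fr by (auto simp: free_of_def)
  qed
  have clique: "card C \<le> r + 1"
    if C: "C \<subseteq> V" "\<And>u v. u \<in> C \<Longrightarrow> v \<in> C \<Longrightarrow> u \<noteq> v \<Longrightarrow> {u, v} \<in> edges G" for C
  proof (rule ccontr)
    assume "\<not> card C \<le> r + 1"
    then have "r + 2 \<le> card C" by simp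
    then obtain C' where C': "C' \<subseteq> C" "card C' = r + 2" "finite C'" by (rule obtain_subset_with_card_n)
    have "\<exists>H. subgraph H G \<and> isomorphic (complete_graph (r + 2)) H"
      by (rule clique_in_graph[of C']) (use C C' in \<open>auto simp: V_def\<close>)
    then show False using fr by (auto simp: free_of_def)
  qed
  have b1: "b \<le> 1" and b2: "2 * h + b < s" and b3: "b = 1 \<Longrightarrow> h < r"
    using s b by (cases "s = 2 * h + 2 \<and> h < r"; force)+
  \<comment> \<open>Every candidate on \<open>V\<close>, balanced or not, is admissible and hence
    bounded by the extremal \<open>G\<close>; each later contradiction comes from a candidate
    exceeding \<rho>.\<close>
  have core_le: "graph_spectral_radius (core_graph V L f X) \<le> \<rho>"
    if "L \<subseteq> V" "card L = h" "\<forall>v\<in>L. f v < r" "extra_edge (V - L) b X" for L f X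
  proof (rule max)
    show "simple_graph (core_graph V L f X)" by (rule core_graph_simple[OF fin that(1,4)])
    show "card (verts (core_graph V L f X)) = n" by (simp add: n)
    show "free_of ?\<F> (core_graph V L f X)"
      by (rule core_graph_free[OF fin that(1,3,4)]) (use that(2) b2 b3 in simp_all)
  qed
  have cVL: "2 \<le> card (V - L)" if "L \<subseteq> V" "card L = h" for L
    using that nh n fin by (simp add: card_Diff_subset finite_subset)
  show ?thesis
  \<comment> \<open>\<open>h = 0\<close> means \<open>s = 2\<close>: the core is empty and at most
    one edge is allowed. Only the edgeless graph must be ruled out, by comparing spectral radius 0
    with the constant test vector on a single edge.\<close>
  proof (cases "h = 0")
    case True
    then have bb: "b = 1" using s b r by auto
    have nz: "\<exists>e\<in>edges G. e \<inter> {} = {}"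
    proof (rule ccontr)
      assume "\<not> ?thesis"
      then have E: "edges G = {}" by auto
      obtain x where x: "\<exists>u\<in>V. x u \<noteq> 0"
        "\<And>u. u \<in> V \<Longrightarrow> (\<Sum>v\<in>V. adj G u v * x v) = \<rho> * x u"
        using graph_spectral_radius_perron[of G] fin Vne unfolding V_def \<rho>_def by metis
      then have "\<rho> = 0" by (auto simp: adj_def E)
      obtain X where X: "extra_edge (V - {}) b X" using ex_extra_edge[of "V - {}" b] cVL[of "{}"] b1 True by auto
      let ?H = "core_graph V {} (\<lambda>_. 0) X"
      have "1 \<le> (\<Sum>u\<in>V. \<Sum>v\<in>V. adj ?H u v * 1 * 1)"
        using core_graph_quadratic_form[OF fin _ X, of "\<lambda>_. 0" x 1] bb by simp
      also have "\<dots> \<le> graph_spectral_radius ?H * (\<Sum>u\<in>V. 1\<^sup>2)"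
        using graph_spectral_radius_rayleigh[of ?H "\<lambda>_. 1"] fin Vne by simp
      also have "\<dots> \<le> \<rho> * (\<Sum>u\<in>V. 1\<^sup>2)"
        using core_le[of "{}" "\<lambda>_. 0" X] X True by (intro mult_right_mono) auto
      finally show False using \<open>\<rho> = 0\<close> by simp
    qed
    show ?thesis
      by (rule is_target_if_joined[where L = "{}" and f = "\<lambda>_. 0", OF G _ _ _ r _ _ _ free clique s(1) b])
        (use n True nh nz in \<open>auto simp: V_def balanced_def\<close>)
  next
    case False
    then have h: "1 \<le> h" by simp
    have "h \<le> card V" using n nh by simp
    then obtain L0 where L0: "L0 \<subseteq> V" "card L0 = h" "finite L0" by (rule obtain_subset_with_card_n)
    obtain X0 where X0: "extra_edge (V - L0) b X0" using ex_extra_edge[OF cVL[OF L0(1,2)] b1] by blast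
    \<comment> \<open>The lower bound on \<rho> comes from a candidate with an arbitrary core of
      \<open>h\<close> vertices; the constant colouring leaves this core independent.\<close>
    have "sqrt (real h * real (card (V - L0))) \<le> graph_spectral_radius (core_graph V L0 (\<lambda>_. 0) X0)"
      using core_graph_spectral_radius_ge[OF fin L0(1) _ _ X0, of "\<lambda>_. 0"] L0 h cVL[OF L0(1,2)] by fastforce
    also have "\<dots> \<le> \<rho>" by (rule core_le[OF L0(1,2) _ X0]) (use r in auto)
    also have "real (card (V - L0)) = real n - real h"
      using L0 n nh fin by (simp add: card_Diff_subset of_nat_diff)
    finally have sq: "sqrt (real h * (real n - real h)) \<le> \<rho>" .
    have nn: "0 \<le> real h * (real n - real h)" using nh by simp
    have rho0: "0 \<le> \<rho>" using order_trans[OF _ sq] nn by simp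
    have rho2: "real h * (real n - real h) \<le> \<rho>\<^sup>2" using power_mono[OF sq, of 2] nn by simp
    obtain L x \<delta> where L: "L \<subseteq> V" "card L = h" and x0: "\<And>u. 0 \<le> x u"
      and x1: "\<And>v. v \<in> L \<Longrightarrow> x v \<le> 1" and xd: "\<And>v. v \<in> L \<Longrightarrow> 1 - \<delta> \<le> x v"
      and d: "0 \<le> \<delta>" "\<delta> * (real h)\<^sup>2 \<le> 1 / 8" "\<delta> \<le> 1 / 8" and hr: "real h < \<rho>"
      and ev: "\<And>u. u \<in> V \<Longrightarrow> (\<Sum>v\<in>V. adj G u v * x v) = \<rho> * x u"
      and rs: "(\<Sum>u\<in>V - L. \<Sum>v\<in>V - L. adj G u v * x v) \<le> 1 / 4"
      and full: "\<exists>u\<in>V - L. \<forall>v\<in>L. {u, v} \<in> edges G"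
    proof (rule perron_vector_near_constant_on_core[OF G n[unfolded V_def] h big])
      show "s \<le> 2 * h + 2" using s by auto
      show "links G zs < s" if "distinct zs" "set zs \<subseteq> verts G" for zs using free[OF that] .
      show "0 \<le> graph_spectral_radius G" "real h * (real n - real h) \<le> (graph_spectral_radius G)\<^sup>2"
        using rho0 rho2 by (auto simp: \<rho>_def)
      fix L and x :: "'a \<Rightarrow> real" and \<delta> :: real
      assume "L \<subseteq> verts G" "card L = h" "\<And>u. 0 \<le> x u" "\<And>v. v \<in> L \<Longrightarrow> x v \<le> 1" "\<And>v. v \<in> L \<Longrightarrow> 1 - \<delta> \<le> x v"
        "0 \<le> \<delta>" "\<delta> * (real h)\<^sup>2 \<le> 1 / 8" "\<delta> \<le> 1 / 8" "real h < graph_spectral_radius G"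
        "\<And>u. u \<in> verts G \<Longrightarrow> (\<Sum>v\<in>verts G. adj G u v * x v) = graph_spectral_radius G * x u"
        "(\<Sum>u\<in>verts G - L. \<Sum>v\<in>verts G - L. adj G u v * x v) \<le> 1 / 4"
        "\<exists>u\<in>verts G - L. \<forall>v\<in>L. {u, v} \<in> edges G"
      then show thesis by (intro that[of L x \<delta>]) (simp_all add: V_def \<rho>_def)
    qed
    have finL: "finite L" using L fin finite_subset by blast
    have pos: "0 < \<rho>" using hr by linarith
    define S where "S = (\<Sum>v\<in>L. x v)"
    define sL where "sL = (\<lambda>u. \<Sum>v\<in>L. adj G u v * x v)"
    define rW where "rW = (\<lambda>u. \<Sum>v\<in>V - L. adj G u v * x v)"
    define Z where "Z = (\<lambda>f::'a \<Rightarrow> nat. \<Sum>u\<in>L. \<Sum>v\<in>L. (of_bool (f u \<noteq> f v) - adj G u v) * x u * x v)"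
    define Y where "Y = (\<Sum>u\<in>V - L. S\<^sup>2 - (sL u)\<^sup>2 - sL u * rW u)"
    have no_gap: "Z f + Y / \<rho> + real b * (S / \<rho>)\<^sup>2 \<le> 0" if f: "\<forall>v\<in>L. f v < r" for f
    proof (rule ccontr)
      assume "\<not> ?thesis"
      then have gap: "0 < Z f + Y / \<rho> + real b * (S / \<rho>)\<^sup>2" by simp
      obtain X where X: "extra_edge (V - L) b X" using ex_extra_edge[OF cVL[OF L] b1] by blast
      have "\<rho> < graph_spectral_radius (core_graph V L f X)"
        using core_graph_spectral_gap[OF G Vne[unfolded V_def] L(1)[unfolded V_def] _ _ X[unfolded V_def], of x f]
          pos ev gap unfolding Z_def Y_def S_def sL_def rW_def V_def \<rho>_def by blast
      with core_le[OF L f X] show False by simp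
    qed
    have adj1: "adj G u v \<le> 1" for u v by (simp add: adj_def)
    have S_le: "S \<le> real h" unfolding S_def using sum_mono[of L x "\<lambda>_. 1"] x1 L by simp
    have S_pos: "0 < S"
    proof -
      obtain v where "v \<in> L" using L h by fastforce
      moreover have "0 < x v" if "v \<in> L" for v using xd[OF that] d by linarith
      ultimately show ?thesis unfolding S_def using finL by (intro sum_pos) auto
    qed
    have sL_le: "sL u \<le> S" for u
      unfolding sL_def S_def using x0 adj1 by (intro sum_mono) (simp add: mult_left_le_one_le adj_nonneg)
    have sL0: "0 \<le> sL u" for u unfolding sL_def using x0 by (intro sum_nonneg) (simp add: adj_nonneg)
    have rW0: "0 \<le> rW u" for u unfolding rW_def using x0 by (intro sum_nonneg) (simp add: adj_nonneg)
    \<comment> \<open>Each summand equals S(S - sL) + sL(S - sL) - sL rW. The middle part is dropped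
      as nonnegative and \<open>sL u\<close> is replaced by \<open>S\<close> in the last, whose
      total is at most S/4.\<close>
    have Y_ge: "S * ((\<Sum>u\<in>V - L. S - sL u) - 1 / 4) \<le> Y"
    proof -
      have "S * (\<Sum>u\<in>V - L. rW u) \<le> S * (1 / 4)" using rs S_pos by (intro mult_left_mono) (auto simp: rW_def)
      then have "S * ((\<Sum>u\<in>V - L. S - sL u) - 1 / 4) \<le> (\<Sum>u\<in>V - L. S * (S - sL u) - S * rW u)"
        by (simp add: right_diff_distrib sum_subtractf sum_distrib_left)
      also have "\<dots> \<le> Y" unfolding Y_def
      proof (rule sum_mono)
        fix u
        have "0 \<le> sL u * (S - sL u)" using sL0 sL_le by (intro mult_nonneg_nonneg) auto
        moreover have "sL u * rW u \<le> S * rW u" using sL_le rW0 by (intro mult_right_mono)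
        ultimately show "S * (S - sL u) - S * rW u \<le> S\<^sup>2 - (sL u)\<^sup>2 - sL u * rW u"
          by (simp add: power2_eq_square algebra_simps)
      qed
      finally show ?thesis .
    qed
    have bS: "0 \<le> real b * (S / \<rho>)\<^sup>2" by simp
    \<comment> \<open>S \<le> h < \<rho>, so the loss S/4 stays below 1/4 after division by
      \<rho>.\<close>
    have Yneg: "- 1 / 4 < Y / \<rho>"
    proof -
      have "0 \<le> S * (\<Sum>u\<in>V - L. S - sL u)" using S_pos sL_le by (intro mult_nonneg_nonneg sum_nonneg) auto
      then have "- (S / 4) \<le> Y" using Y_ge by (simp add: right_diff_distrib)
      then have "- (\<rho> / 4) < Y" using S_le hr by linarith
      then show ?thesis using pos by (simp add: field_simps)
    qed
    have adjb: "adj G u v = of_bool ({u, v} \<in> edges G)" for u v by (simp add: adj_def)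
    have Z_big: "1 / 2 \<le> Z g"
      if lt: "(\<Sum>u\<in>L. \<Sum>v\<in>L. adj G u v) < (\<Sum>u\<in>L. \<Sum>v\<in>L. of_bool (g u \<noteq> g v))" for g
    proof -
      let ?eA = "\<Sum>u\<in>L. \<Sum>v\<in>L. adj G u v" and ?eT = "\<Sum>u\<in>L. \<Sum>v\<in>L. of_bool (g u \<noteq> g v) :: real"
      have "?eA = real (\<Sum>u\<in>L. \<Sum>v\<in>L. of_bool ({u, v} \<in> edges G))" by (simp add: adjb del: sum_of_bool_eq)
      moreover have "?eT = real (\<Sum>u\<in>L. \<Sum>v\<in>L. of_bool (g u \<noteq> g v))" by (simp del: sum_of_bool_eq)
      ultimately obtain a t :: nat where at: "?eA = real a" "?eT = real t" by blast
      have "a < t" using lt unfolding at by simp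
      then have int: "?eA + 1 \<le> ?eT" unfolding at by simp
      have Th: "?eT \<le> (real h)\<^sup>2"
      proof -
        have "?eT \<le> (\<Sum>u\<in>L. \<Sum>v\<in>L. 1)" by (intro sum_mono) simp
        then show ?thesis using L by (simp add: power2_eq_square)
      qed
      have "?eT * (1 - 2 * \<delta>) - ?eA \<le> Z g"
      proof -
        have "?eT * (1 - 2 * \<delta>) - ?eA = (\<Sum>u\<in>L. \<Sum>v\<in>L. of_bool (g u \<noteq> g v) * (1 - 2 * \<delta>) - adj G u v)"
          by (simp add: sum_subtractf sum_distrib_right del: sum_of_bool_eq)
        also have "\<dots> \<le> Z g" unfolding Z_def
        proof (intro sum_mono)
          fix u v assume uv: "u \<in> L" "v \<in> L"
          have p1: "x u * x v \<le> 1" using x0 x1 uv by (simp add: mult_le_one)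
          have "(1 - \<delta>) * (1 - \<delta>) \<le> x u * x v" using xd uv d x0 by (intro mult_mono) auto
          moreover have "1 - 2 * \<delta> \<le> (1 - \<delta>) * (1 - \<delta>)" by (simp add: algebra_simps)
          ultimately have p2: "1 - 2 * \<delta> \<le> x u * x v" by linarith
          have "adj G u v * (x u * x v) \<le> adj G u v * 1" using p1 by (intro mult_left_mono adj_nonneg)
          moreover have "of_bool (g u \<noteq> g v) * (1 - 2 * \<delta>) \<le> of_bool (g u \<noteq> g v) * (x u * x v)"
            using p2 by (intro mult_left_mono) auto
          ultimately show "of_bool (g u \<noteq> g v) * (1 - 2 * \<delta>) - adj G u v
              \<le> (of_bool (g u \<noteq> g v) - adj G u v) * x u * x v" by (simp add: algebra_simps)
        qed
        finally show ?thesis .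
      qed
      moreover have "?eT * \<delta> \<le> 1 / 8"
        using mult_right_mono[OF Th d(1)] d(2) by (simp add: mult.commute)
      moreover have "?eT * (1 - 2 * \<delta>) = ?eT - 2 * (?eT * \<delta>)" by (simp add: algebra_simps)
      ultimately show ?thesis using int by linarith
    qed
    have no_lt: "\<not> (\<Sum>u\<in>L. \<Sum>v\<in>L. adj G u v) < (\<Sum>u\<in>L. \<Sum>v\<in>L. of_bool (g u \<noteq> g v))"
      if "\<forall>v\<in>L. g v < r" for g
      using Z_big[of g] no_gap[OF that] Yneg bS by linarith
    obtain f :: "'a \<Rightarrow> nat" where f: "\<forall>v\<in>L. f v < r"
      and f': "(\<Sum>u\<in>L. \<Sum>v\<in>L. of_bool ({u, v} \<in> edges G)) < (\<Sum>u\<in>L. \<Sum>v\<in>L. of_bool (f u \<noteq> f v) :: real)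
        \<or> (\<forall>u\<in>L. \<forall>v\<in>L. {u, v} \<in> edges G \<longleftrightarrow> f u \<noteq> f v)"
    proof -
      have "\<exists>f::'a \<Rightarrow> nat. (\<forall>v\<in>L. f v < r) \<and>
        ((\<Sum>u\<in>L. \<Sum>v\<in>L. of_bool ({u, v} \<in> edges G)) < (\<Sum>u\<in>L. \<Sum>v\<in>L. of_bool (f u \<noteq> f v) :: real)
        \<or> (\<forall>u\<in>L. \<forall>v\<in>L. {u, v} \<in> edges G \<longleftrightarrow> f u \<noteq> f v))"
      proof (rule turan_multipartite[OF finL, of "\<lambda>u v. {u, v} \<in> edges G"])
        fix C assume C: "C \<subseteq> L" "\<And>u v. u \<in> C \<Longrightarrow> v \<in> C \<Longrightarrow> u \<noteq> v \<Longrightarrow> {u, v} \<in> edges G"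
        \<comment> \<open>A vertex joined to all of \<open>L\<close> extends every clique of
          \<open>L\<close>, which lowers the clique bound in \<open>L\<close> from
          \<open>r + 1\<close> to \<open>r\<close>.\<close>
        obtain w where w: "w \<in> V - L" "\<forall>v\<in>L. {w, v} \<in> edges G" using full by blast
        have "card (insert w C) \<le> r + 1"
        proof (rule clique)
          show "insert w C \<subseteq> V" using w C L by auto
          show "{u, v} \<in> edges G" if "u \<in> insert w C" "v \<in> insert w C" "u \<noteq> v" for u v
            using that w C by (auto simp: insert_commute)
        qed
        moreover have "w \<notin> C" "finite C" using w C finL finite_subset by auto
        ultimately show "card C \<le> r" by simp
      qed (auto simp: insert_commute simple_graph_no_loop[OF G])
      then show thesis using that by blast
    qed
    have inside: "{u, v} \<in> edges G \<longleftrightarrow> f u \<noteq> f v" if "u \<in> L" "v \<in> L" for u v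
      using f' no_lt[OF f] that by (auto simp: adjb)
    \<comment> \<open>An unbalanced \<open>f\<close> has strictly fewer crossing pairs than a
      balanced \<open>g\<close>, and a core with fewer edges than \<open>g\<close> offers was just
      excluded.\<close>
    have bal: "balanced L r f"
    proof (rule ccontr)
      assume nb: "\<not> balanced L r f"
      obtain g where g: "balanced L r g" using ex_balanced[OF finL r] by blast
      have "(\<Sum>u\<in>L. \<Sum>v\<in>L. adj G u v) = (\<Sum>u\<in>L. \<Sum>v\<in>L. of_bool (f u \<noteq> f v))"
        using inside by (intro sum.cong refl) (simp add: adjb)
      also have "\<dots> < (\<Sum>u\<in>L. \<Sum>v\<in>L. of_bool (g u \<noteq> g v))"
        by (rule balanced_multipartite_maximal[OF finL f g nb])
      finally show False using no_lt[of g] g by (simp add: balanced_def)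
    qed
    have Z0: "Z f = 0" unfolding Z_def using inside by (intro sum.neutral ballI) (simp add: adjb)
    have join: "{u, w} \<in> edges G" if uw: "u \<in> L" "w \<in> V - L" for u w
    proof (rule ccontr)
      assume "{u, w} \<notin> edges G"
      then have "adj G w u = 0" by (simp add: adj_def insert_commute)
      then have "sL w = (\<Sum>v\<in>L - {u}. adj G w v * x v)"
        unfolding sL_def using uw finL by (simp add: sum.remove)
      also have "\<dots> \<le> (\<Sum>v\<in>L - {u}. x v)"
        using x0 adj1 by (intro sum_mono) (simp add: mult_left_le_one_le adj_nonneg)
      also have "\<dots> = S - x u" unfolding S_def using uw finL by (simp add: sum.remove)
      \<comment> \<open>One missing edge to the core makes the deficit at least 7/8, more than the
        1/4 that edges outside the core can compensate, so \<open>Y\<close> becomes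
        positive.\<close>
      finally have "1 - \<delta> \<le> S - sL w" using xd[OF uw(1)] by linarith
      also have "\<dots> \<le> (\<Sum>w\<in>V - L. S - sL w)"
        using uw fin sL_le by (intro member_le_sum[of w "V - L" "\<lambda>w. S - sL w"]) auto
      finally have "0 < S * ((\<Sum>u\<in>V - L. S - sL u) - 1 / 4)"
        using S_pos d by (intro mult_pos_pos) auto
      then have "0 < Y / \<rho>" using Y_ge pos by (intro divide_pos_pos) auto
      then show False using no_gap[OF f] Z0 bS by linarith
    qed
    \<comment> \<open>Without an outside edge \<open>Z f\<close> and \<open>Y\<close> are both
      exactly 0, so the positive term of the extra edge alone would improve \<rho>.\<close>
    have nz: "\<exists>e\<in>edges G. e \<inter> L = {}" if "b = 1"
    proof (rule ccontr)
      assume none: "\<not> ?thesis"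
      have "S\<^sup>2 - (sL u)\<^sup>2 - sL u * rW u = 0" if u: "u \<in> V - L" for u
      proof -
        have "adj G u v = 0" if "v \<in> V - L" for v
          using none that u by (auto simp: adj_def)
        then have "rW u = 0" by (simp add: rW_def)
        moreover have "sL u = S" unfolding sL_def S_def
          using join u by (intro sum.cong) (auto simp: adj_def insert_commute)
        ultimately show ?thesis by simp
      qed
      then have "Y = 0" by (simp add: Y_def)
      moreover have "0 < (S / \<rho>)\<^sup>2" using S_pos pos by simp
      ultimately show False using no_gap[OF f] Z0 that by simp
    qed
    show ?thesis
      by (rule is_target_if_joined[OF G _ _ L(2) r bal inside _ free _ s(1) b])
        (use n L nh nz join clique in \<open>auto simp: V_def\<close>)
  qed
qed

text \<open>That \<open>H\<close> attains the maximum is never checked directly: some extremal graph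
  exists, it is a target and so isomorphic to \<open>H\<close>, and every graph isomorphic to it is
  equally free and has at least its spectral radius.\<close>

lemma Ex_sp_eq_iso_class:
  fixes H :: "'b graph"
  assumes r: "0 < r" and s: "s = 2 * h + 1 \<or> s = 2 * h + 2" "2 \<le> s"
    and b: "b = (if s = 2 * h + 2 \<and> h < r then 1 else 0)"
    and big: "36288 * (h + 1) ^ 8 \<le> n" and H: "is_target b r h n H"
  shows "(Ex_sp n ({complete_graph (r + 2)} \<union> linear_forests s) :: nat graph set) = iso_class H"
proof
  let ?\<F> = "{complete_graph (r + 2)} \<union> linear_forests s"
  note target = extremal_is_target[OF r s b big]
  show "(Ex_sp n ?\<F> :: nat graph set) \<subseteq> iso_class H"
  proof
    fix G :: "nat graph" assume G: "G \<in> Ex_sp n ?\<F>"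
    have "isomorphic G H" by (rule is_target_isomorphic[OF target[OF G] H])
    then show "G \<in> iso_class H" using G by (simp add: iso_class_def Ex_sp_def)
  qed
  have nh: "36288 * (h + 1) \<le> n"
  proof -
    have "(h + 1) ^ 1 \<le> (h + 1) ^ 8" by (intro power_increasing) auto
    then show ?thesis using big by simp
  qed
  have "2 \<le> card ({..<n} - {..<h})" "b \<le> 1" using nh b by (auto simp: card_Diff_subset)
  then obtain X where X: "extra_edge ({..<n} - {..<h}) b X" using ex_extra_edge by blast
  \<comment> \<open>Used only as an admissible graph, so that the set of competitors is
    nonempty.\<close>
  let ?T = "core_graph {..<n} {..<h} (\<lambda>i. i mod r) X"
  have sub: "{..<h} \<subseteq> {..<n}" using nh by auto
  have "2 * card {..<h} + b < s" "b = 1 \<Longrightarrow> card {..<h} < r"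
    using s b by (cases "s = 2 * h + 2 \<and> h < r"; force)+
  then have "free_of ?\<F> ?T" using r by (intro core_graph_free[OF _ sub _ X]) auto
  moreover have "simple_graph ?T" by (rule core_graph_simple[OF _ sub X]) simp
  ultimately obtain G0 :: "nat graph" where G0: "G0 \<in> Ex_sp n ?\<F>"
    using Ex_sp_nonempty[of ?T n ?\<F>] by auto
  show "iso_class H \<subseteq> (Ex_sp n ?\<F> :: nat graph set)"
  proof
    fix G :: "nat graph" assume "G \<in> iso_class H"
    then have G: "simple_graph G" "isomorphic G H" by (auto simp: iso_class_def)
    have "isomorphic G0 H" by (rule is_target_isomorphic[OF target[OF G0] H])
    then have iso: "isomorphic G G0" using G(2) isomorphic_sym isomorphic_trans by blast
    have s0: "simple_graph G0" "card (verts G0) = n" "free_of ?\<F> G0"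
      and max: "\<And>K :: nat graph. simple_graph K \<Longrightarrow> card (verts K) = n \<Longrightarrow> free_of ?\<F> K
        \<Longrightarrow> graph_spectral_radius K \<le> graph_spectral_radius G0"
      using G0 by (auto simp: Ex_sp_def)
    have ne: "verts G0 \<noteq> {}" using s0 nh by auto
    have "graph_spectral_radius G0 \<le> graph_spectral_radius G"
      by (rule isomorphic_spectral_radius_le[OF isomorphic_sym[OF iso] s0(1) ne G(1)])
    moreover have "free_of ?\<F> G" by (rule free_of_isomorphic[OF iso s0(3)])
    moreover have "card (verts G) = n" using isomorphic_card_verts[OF iso] s0 by simp
    ultimately show "G \<in> Ex_sp n ?\<F>" using G(1) max by (force simp: Ex_sp_def)
  qed
qed

theorem theorem1p2:
  fixes k s n :: nat
  assumes "k \<ge> 2" and "s \<ge> 2" and "n \<ge> 36288 * ((s + 1) div 2) ^ 8"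
  shows "(odd s \<and> s \<le> 2 * k - 1 \<longrightarrow>
            (Ex_sp n ({complete_graph (k + 1)} \<union> linear_forests s) :: nat graph set) =
            iso_class (graph_join (complete_graph ((s - 1) div 2)) (edgeless_graph (n - (s - 1) div 2))))
       \<and> (odd s \<and> s \<ge> 2 * k + 1 \<longrightarrow>
            (Ex_sp n ({complete_graph (k + 1)} \<union> linear_forests s) :: nat graph set) =
            iso_class (graph_join (turan_graph ((s - 1) div 2) (k - 1)) (edgeless_graph (n - (s - 1) div 2))))
       \<and> (even s \<and> s \<le> 2 * k - 2 \<longrightarrow>
            (Ex_sp n ({complete_graph (k + 1)} \<union> linear_forests s) :: nat graph set) =
            iso_class (graph_join (complete_graph (s div 2 - 1))
                            (disjoint_union (path_graph 2) (edgeless_graph (n - s div 2 - 1)))))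
       \<and> (even s \<and> s \<ge> 2 * k \<longrightarrow>
            (Ex_sp n ({complete_graph (k + 1)} \<union> linear_forests s) :: nat graph set) =
            iso_class (graph_join (turan_graph (s div 2 - 1) (k - 1)) (edgeless_graph (n - s div 2 + 1))))"
proof -
  \<comment> \<open>\<open>r\<close> is the number of parts of the Turan graph; the forbidden clique
    has \<open>r + 2\<close> vertices because the core is joined to a nonempty remainder.\<close>
  define r where "r = k - 1"
  define h where "h = (s - 1) div 2"
  have r: "0 < r" "k + 1 = r + 2" "k - 1 = r" using assms by (auto simp: r_def)
  have m: "(s + 1) div 2 = h + 1" using assms(2) unfolding h_def by presburger
  have big: "36288 * (h + 1) ^ 8 \<le> n" using assms(3) by (simp only: m)
  have "(h + 1) ^ 1 \<le> (h + 1) ^ 8" by (intro power_increasing) auto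
  then have nh: "h + 2 \<le> n" using big by simp
  have s: "s = 2 * h + 1 \<or> s = 2 * h + 2" using assms(2) unfolding h_def by presburger
  note eq = Ex_sp_eq_iso_class[OF r(1) s assms(2) refl big, folded r(2)]
  have T0: "is_target 0 r h n (graph_join (turan_graph h r) (edgeless_graph (n - h)))"
    using is_target_turan_join[OF r(1)] nh by simp
  have "(Ex_sp n ({complete_graph (k + 1)} \<union> linear_forests s) :: nat graph set) =
      iso_class (graph_join (turan_graph h r) (edgeless_graph (n - h)))"
    if "odd s \<or> r \<le> h"
  proof -
    have "(if s = 2 * h + 2 \<and> h < r then 1 else 0) = (0::nat)" using that by auto
    then show ?thesis using eq T0 by simp
  qed
  note no_edge = this
  have edge: "(Ex_sp n ({complete_graph (k + 1)} \<union> linear_forests s) :: nat graph set) =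
      iso_class (graph_join (complete_graph h) (disjoint_union (path_graph 2) (edgeless_graph (n - h - 2))))"
    if "even s" "h < r"
  proof -
    have "s = 2 * h + 2" using s that by auto
    then have "(if s = 2 * h + 2 \<and> h < r then 1 else 0) = (1::nat)" using that by simp
    then show ?thesis using eq is_target_complete_join[OF r(1) _ nh] that by simp
  qed
  show ?thesis
  proof (intro conjI impI; elim conjE)
    assume a: "odd s" "s \<le> 2 * k - 1"
    \<comment> \<open>For odd \<open>s\<close> there is no outside edge, and \<open>h\<close> \<le>
      \<open>r\<close> turns the Turan core into a complete one.\<close>
    have hr: "h \<le> r" using a unfolding h_def r_def by linarith
    show "(Ex_sp n ({complete_graph (k + 1)} \<union> linear_forests s) :: nat graph set) =
        iso_class (graph_join (complete_graph ((s - 1) div 2)) (edgeless_graph (n - (s - 1) div 2)))"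
      unfolding h_def[symmetric] complete_graph_eq_turan[OF hr] using no_edge a by blast
  next
    assume "odd s" "2 * k + 1 \<le> s"
    then show "(Ex_sp n ({complete_graph (k + 1)} \<union> linear_forests s) :: nat graph set) =
        iso_class (graph_join (turan_graph ((s - 1) div 2) (k - 1)) (edgeless_graph (n - (s - 1) div 2)))"
      unfolding h_def[symmetric] r(3) using no_edge by blast
  next
    assume a: "even s" "s \<le> 2 * k - 2"
    then have "s div 2 - 1 = h" "n - s div 2 - 1 = n - h - 2" "h < r"
      using s assms by (auto simp: r_def)
    then show "(Ex_sp n ({complete_graph (k + 1)} \<union> linear_forests s) :: nat graph set) =
        iso_class (graph_join (complete_graph (s div 2 - 1))
          (disjoint_union (path_graph 2) (edgeless_graph (n - s div 2 - 1))))"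
      using edge a by simp
  next
    assume a: "even s" "2 * k \<le> s"
    \<comment> \<open>The subtraction in \<open>n - s div 2 + 1\<close> is truncated;
      \<open>nh\<close> ensures \<open>s div 2\<close> \<le> \<open>n\<close>.\<close>
    then have "s div 2 - 1 = h" "n - s div 2 + 1 = n - h" "r \<le> h"
      using s assms nh by (auto simp: r_def)
    then show "(Ex_sp n ({complete_graph (k + 1)} \<union> linear_forests s) :: nat graph set) =
        iso_class (graph_join (turan_graph (s div 2 - 1) (k - 1)) (edgeless_graph (n - s div 2 + 1)))"
      using no_edge by (simp only: r(3) simp_thms)
  qed
qed

end
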